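(* Let $F$ be a field of characteristic $p>0$ and let $n\ge 1$ be an integer. Suppose that one of the following holds: (i) $G$ is a permutation group on a set $\Omega$ with $|\Omega|=n$; in this case put $\pi=p$; or (ii) $q$ is a prime power not divisible by $p$ and $G\subseteq \mathrm{P\Gamma L}(n,q)$ is a subgroup; in this case put $\pi=\pi(p,q)$. Let $U$ be an irreducible $FG$-module. For $k\in\mathbb{Z}$ let $c_k$ denote the multiplicity of $U$ in the permutation representation over $F$ of $G$ on the set of $k$-element subsets of $\Omega$ in case (i), respectively on the set of $k$-dimensional subspaces of $\mathrm{GF}_q^{\,n}$ in case (ii). Then $$[c_m]_\pi\ \ge\ [c_{m-1}]_\pi\ \ge\ [c_{m-2}]_\pi\ \ge\ \cdots\ \ge\ [c_{m-s}]_\pi\ \ge\ 0,$$ where $m=\lfloor \frac n2\rfloor$ and $s=\lfloor\frac{\pi}{2}\rfloor$.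
   Context: For a prime $p$ and an integer $q$ coprime to $p$, $\pi(p,q)$ (the characteristic of $q$ in $\mathrm{GF}_p$) is the least integer $\pi>0$ such that $1+q+q^2+\cdots+q^{\pi-1}\equiv 0 \pmod p$. For an integer function $k\mapsto c_k$ on $\mathbb{Z}$ (with finitely many nonzero values) put $[c_k]_\pi:=\sum_{t\in\mathbb{Z}} c_{k+t\pi}$. Here $c_k=0$ for $k<0$ and for $k>n$ (there are no subsets or subspaces of such rank). The permutation representation of $G$ over $F$ on a finite $G$-set $X$ is the $FG$-module $FX$ with basis $X$. The multiplicity of an irreducible $FG$-module $U$ in a finite-dimensional $FG$-module $M$ is the number of composition factors of $M$ isomorphic to $U$. *)

theory Defs
  imports
    "HOL-Algebra.Group_Action"
    "HOL-Algebra.AbelCoset"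
    "HOL-Algebra.Algebraic_Closure_Type"
    "HOL-Analysis.Cartesian_Space"
    "HOL-Library.Groups_Big_Fun"
    "HOL-Number_Theory.Cong"
begin

section \<open>Modules over a group algebra\<close>

text \<open>
  The coefficient field \<open>F\<close> is a type \<open>'f\<close> of class \<open>field\<close>, turned into a HOL-Algebra ring by
  \<^const>\<open>ring_of_type_algebra\<close>.  An \<open>FG\<close>-module is an \<open>F\<close>-vector space with a linear action of
  \<open>G\<close>.  The components \<open>mult\<close> and \<open>one\<close> that the HOL-Algebra record of modules inherits from
  rings are irrelevant for modules.
\<close>

record ('f, 'v, 'g) fg_module = "('f, 'v) module" +
  act :: "'g \<Rightarrow> 'v \<Rightarrow> 'v"

locale group_module =
  Group.group G + M: Module.module "ring_of_type_algebra :: 'f ring" M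
  for G :: "('g, 'b) monoid_scheme" (structure)
    and M :: "('f::field, 'v, 'g) fg_module" +
  assumes act_closed: "\<lbrakk>g \<in> carrier G; v \<in> carrier M\<rbrakk> \<Longrightarrow> act M g v \<in> carrier M"
    and act_add: "\<lbrakk>g \<in> carrier G; v \<in> carrier M; w \<in> carrier M\<rbrakk>
      \<Longrightarrow> act M g (v \<oplus>\<^bsub>M\<^esub> w) = act M g v \<oplus>\<^bsub>M\<^esub> act M g w"
    and act_smult: "\<lbrakk>g \<in> carrier G; v \<in> carrier M\<rbrakk>
      \<Longrightarrow> act M g (a \<odot>\<^bsub>M\<^esub> v) = a \<odot>\<^bsub>M\<^esub> act M g v"
    and act_one: "v \<in> carrier M \<Longrightarrow> act M \<one> v = v"
    and act_mult: "\<lbrakk>g \<in> carrier G; h \<in> carrier G; v \<in> carrier M\<rbrakk>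
      \<Longrightarrow> act M (g \<otimes> h) v = act M g (act M h v)"

definition fg_submodule ::
    "('g, 'b) monoid_scheme \<Rightarrow> ('f::field, 'v, 'g) fg_module \<Rightarrow> 'v set \<Rightarrow> bool" where
  "fg_submodule G M W \<longleftrightarrow>
     submodule W (ring_of_type_algebra :: 'f ring) M \<and>
     (\<forall>g\<in>carrier G. \<forall>w\<in>W. act M g w \<in> W)"

definition fg_quotient ::
    "('f::field, 'v, 'g) fg_module \<Rightarrow> 'v set \<Rightarrow> ('f, 'v set, 'g) fg_module" where
  "fg_quotient M N =
     \<lparr>carrier = a_rcosets\<^bsub>M\<^esub> N, monoid.mult = undefined, monoid.one = undefined,
      ring.zero = N, add = set_add M,
      module.smult = (\<lambda>a A. \<Union>x\<in>A. a_r_coset M N (a \<odot>\<^bsub>M\<^esub> x)),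
      act = (\<lambda>g A. \<Union>x\<in>A. a_r_coset M N (act M g x))\<rparr>"

definition fg_isomorphic ::
    "('g, 'b) monoid_scheme \<Rightarrow> ('f::field, 'v, 'g) fg_module \<Rightarrow> ('f, 'w, 'g) fg_module \<Rightarrow> bool"
  where
  "fg_isomorphic G M N \<longleftrightarrow>
     (\<exists>h. bij_betw h (carrier M) (carrier N) \<and>
       (\<forall>v\<in>carrier M. \<forall>w\<in>carrier M. h (v \<oplus>\<^bsub>M\<^esub> w) = h v \<oplus>\<^bsub>N\<^esub> h w) \<and>
       (\<forall>a. \<forall>v\<in>carrier M. h (a \<odot>\<^bsub>M\<^esub> v) = a \<odot>\<^bsub>N\<^esub> h v) \<and>
       (\<forall>g\<in>carrier G. \<forall>v\<in>carrier M. h (act M g v) = act N g (h v)))"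

definition fg_irreducible ::
    "('g, 'b) monoid_scheme \<Rightarrow> ('f::field, 'v, 'g) fg_module \<Rightarrow> bool" where
  "fg_irreducible G M \<longleftrightarrow>
     group_module G M \<and> carrier M \<noteq> {\<zero>\<^bsub>M\<^esub>} \<and>
     (\<forall>W. fg_submodule G M W \<longrightarrow> W = {\<zero>\<^bsub>M\<^esub>} \<or> W = carrier M)"

definition composition_factor ::
    "('f::field, 'v, 'g) fg_module \<Rightarrow> (nat \<Rightarrow> 'v set) \<Rightarrow> nat \<Rightarrow> ('f, 'v set, 'g) fg_module" where
  "composition_factor M W i = fg_quotient (M\<lparr>carrier := W (Suc i)\<rparr>) (W i)"

definition composition_series ::
    "('g, 'b) monoid_scheme \<Rightarrow> ('f::field, 'v, 'g) fg_module \<Rightarrow> (nat \<Rightarrow> 'v set) \<Rightarrow> nat \<Rightarrow> bool"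
  where
  "composition_series G M W l \<longleftrightarrow>
     W 0 = {\<zero>\<^bsub>M\<^esub>} \<and> W l = carrier M \<and>
     (\<forall>i\<le>l. fg_submodule G M (W i)) \<and>
     (\<forall>i<l. W i \<subseteq> W (Suc i) \<and> fg_irreducible G (composition_factor M W i))"

text \<open>
  By the Jordan--Hoelder theorem the number below does not depend on the composition series;
  a series exists since only finite-dimensional \<open>M\<close> are considered.
\<close>

definition multiplicity_in ::
    "('g, 'b) monoid_scheme \<Rightarrow> ('f::field, 'u, 'g) fg_module \<Rightarrow> ('f, 'v, 'g) fg_module \<Rightarrow> nat"
  where
  "multiplicity_in G U M =
     (THE d. \<exists>W l. composition_series G M W l \<and>
        d = card {i. i < l \<and> fg_isomorphic G (composition_factor M W i) U})"


section \<open>Permutation modules\<close>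

text \<open>
  For a finite set \<open>S\<close> on which \<open>G\<close> acts by \<open>\<phi>\<close>, the formal linear combination \<open>\<Sum>x\<in>S. v x \<cdot> x\<close>
  is represented by its coefficient function, extended by \<open>0\<close> outside \<open>S\<close>.  The action is the
  linear extension of \<open>x \<mapsto> \<phi> g x\<close>.
\<close>

definition perm_module ::
    "'x set \<Rightarrow> ('g \<Rightarrow> 'x \<Rightarrow> 'x) \<Rightarrow> ('f::field, 'x \<Rightarrow> 'f, 'g) fg_module" where
  "perm_module S \<phi> =
     \<lparr>carrier = {v. \<forall>x. x \<notin> S \<longrightarrow> v x = 0}, monoid.mult = undefined, monoid.one = undefined,
      ring.zero = (\<lambda>x. 0), add = (\<lambda>v w x. v x + w x),
      module.smult = (\<lambda>a v x. a * v x),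
      act = (\<lambda>g v y. \<Sum>x | x \<in> S \<and> \<phi> g x = y. v x)\<rparr>"

definition subsets_of_size :: "'a set \<Rightarrow> int \<Rightarrow> 'a set set" where
  "subsets_of_size \<Omega> k = {A. A \<subseteq> \<Omega> \<and> finite A \<and> int (card A) = k}"

definition subspaces_of_dim :: "int \<Rightarrow> ('k::field ^ 'n) set set" where
  "subspaces_of_dim k = {W. vec.subspace W \<and> int (vec.dim W) = k}"


section \<open>The group $P\Gamma L(n,q)$\<close>

definition field_automorphism :: "('k::field \<Rightarrow> 'k) \<Rightarrow> bool" where
  "field_automorphism \<sigma> \<longleftrightarrow>
     bij \<sigma> \<and> \<sigma> 1 = 1 \<and> (\<forall>a b. \<sigma> (a + b) = \<sigma> a + \<sigma> b \<and> \<sigma> (a * b) = \<sigma> a * \<sigma> b)"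

definition semilinear :: "('k::field ^ 'n \<Rightarrow> 'k ^ 'n) \<Rightarrow> bool" where
  "semilinear f \<longleftrightarrow>
     (\<exists>\<sigma>. field_automorphism \<sigma> \<and>
       (\<forall>x y. f (x + y) = f x + f y) \<and> (\<forall>c x. f (c *s x) = \<sigma> c *s f x))"

definition GammaL :: "('k::field ^ 'n \<Rightarrow> 'k ^ 'n) monoid" where
  "GammaL = (BijGroup UNIV)\<lparr>carrier := {f. bij f \<and> semilinear f}\<rparr>"

definition scalar_maps :: "('k::field ^ 'n \<Rightarrow> 'k ^ 'n) set" where
  "scalar_maps = {(\<lambda>x. c *s x) | c. c \<noteq> 0}"

definition PGammaL :: "('k::field ^ 'n \<Rightarrow> 'k ^ 'n) set monoid" where
  "PGammaL = GammaL Mod scalar_maps"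

text \<open>
  Elements of \<^const>\<open>PGammaL\<close> are cosets modulo scalars; all members of a coset map a given
  subspace to the same subspace, so the union below is just their common image.
\<close>

definition coset_image :: "('k::field ^ 'n \<Rightarrow> 'k ^ 'n) set \<Rightarrow> ('k ^ 'n) set \<Rightarrow> ('k ^ 'n) set" where
  "coset_image C W = (\<Union>f\<in>C. f ` W)"


section \<open>Numerical notions\<close>

definition char_in_GF :: "nat \<Rightarrow> int \<Rightarrow> nat" where
  "char_in_GF p q = (LEAST d. 0 < d \<and> [(\<Sum>i<d. q ^ i) = 0] (mod int p))"

definition bracket :: "(int \<Rightarrow> int) \<Rightarrow> nat \<Rightarrow> int \<Rightarrow> int" where
  "bracket c d k = Sum_any (\<lambda>t. c (k + t * int d))"

definition descending_chain :: "(int \<Rightarrow> int) \<Rightarrow> nat \<Rightarrow> nat \<Rightarrow> bool" where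
  "descending_chain c n d \<longleftrightarrow>
     (let m = int (n div 2); s = d div 2 in
       (\<forall>j<s. bracket c d (m - int j) \<ge> bracket c d (m - int j - 1)) \<and>
       bracket c d (m - int s) \<ge> 0)"


section \<open>The two families of multiplicities\<close>

definition subset_multiplicity ::
    "'a set \<Rightarrow> ('a \<Rightarrow> 'a) set \<Rightarrow> ('f::field, 'u, 'a \<Rightarrow> 'a) fg_module \<Rightarrow> int \<Rightarrow> int" where
  "subset_multiplicity \<Omega> G U k =
     int (multiplicity_in ((BijGroup \<Omega>)\<lparr>carrier := G\<rparr>) U
            (perm_module (subsets_of_size \<Omega> k) (\<lambda>g A. g ` A)))"

definition subspace_multiplicity ::
    "('k::field ^ 'n \<Rightarrow> 'k ^ 'n) set set \<Rightarrow>
     ('f::field, 'u, ('k ^ 'n \<Rightarrow> 'k ^ 'n) set) fg_module \<Rightarrow> int \<Rightarrow> int" where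
  "subspace_multiplicity G U k =
     int (multiplicity_in (PGammaL\<lparr>carrier := G\<rparr>) U
            (perm_module (subspaces_of_dim k) coset_image))"

end

theory Submission
  imports Defs "HOL-Library.Function_Algebras" "HOL-Number_Theory.Residues"
begin

text \<open>
  Let \<open>D\<close> be the map sending a subset or subspace to the sum of its maximal proper ones.  It commutes
  with \<open>G\<close> and \<open>D ^ \<pi> = 0\<close>, because the \<open>q\<close>-integer \<open>1 + q + \<dots> + q ^ (\<pi> - 1)\<close> vanishes in \<open>F\<close>.  In each
  sequence \<open>\<dots> \<rightarrow> M (a + \<pi>) \<rightarrow> M b \<rightarrow> M a \<rightarrow> M (b - \<pi>) \<rightarrow> \<dots>\<close> of powers of \<open>D\<close>, with \<open>a < b < a + \<pi>\<close>, at most one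
  homology module is nonzero, namely at the place where its own degree and the next lower one have a sum in the
  open interval \<open>(n - \<pi>, n)\<close>.  Counting the composition factors \<open>U\<close> along the sequence with \<open>b = a + 1\<close> shows that
  \<open>[c b] - [c a]\<close> is, for the relevant \<open>a\<close>, the multiplicity of \<open>U\<close> in that module.

  The vanishing is proved by branching over a hyperplane \<open>H\<close>: the vectors invariant under the transvections with axis
  \<open>H\<close> form a twisted double of the complex of \<open>H\<close>, and the others reduce to complexes of hyperplanes of \<open>H\<close>.
  For subsets only the first part occurs, with \<open>q = 1\<close>.
\<close>

section \<open>Modular exactness and branching\<close>

text \<open>The number \<open>\<pi>\<close> enters twice. The \<open>q\<close>-integer of
  \<open>\<pi>\<close> vanishes in \<open>F\<close>, which makes the constants belonging to
  complementary powers of \<open>D\<close> cancel; by minimality no earlier one vanishes, which is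
  what lets the branching divide by them. Exactness has to be claimed for all pairs of complementary
  powers at once, since the argument for exponent \<open>i\<close> also consults the exponents
  \<open>i - 1\<close> and \<open>i + 1\<close>.

  The interval is shaped by the induction. A single point in degree 0 has homology only at sums
  strictly between \<open>- \<pi>\<close> and 0; a branching step moves both ends by one; passing to
  codimension two lowers the degree by one, hence every sum by two, and leaves the condition
  unchanged.

  The obstacle for subspaces is that a hyperplane has many complements, so a level does not simply
  double as it does for subsets. Averages over transvections separate the part that doubles from the
  rest. Since the \<open>FG\<close>-modules need not be semisimple, composition factors are counted
  instead of splitting off summands.\<close>

definition gauss_sum :: "'f::comm_semiring_1 \<Rightarrow> nat \<Rightarrow> 'f" where
  "gauss_sum Q j = (\<Sum>i<j. Q ^ i)"

text \<open>\<open>gauss_sum Q j\<close> is the \<open>q\<close>-integer of \<open>j\<close> at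
  \<open>q = Q\<close>, not a character sum. The addition law is applied to
  \<open>d = i + e\<close>, where vanishing of the left side ties the constants of the
  \<open>i\<close>-th and \<open>e\<close>-th power of \<open>D\<close> together, and to multiples
  of a period of \<open>Q\<close>.\<close>

lemma gauss_sum_add: "gauss_sum Q (m + n) = gauss_sum Q m + Q ^ m * gauss_sum Q n"
  by (induction n) (simp_all add: gauss_sum_def algebra_simps power_add)

text \<open>The homology of \<open>A (k + d - i) \<rightarrow> A k \<rightarrow> A (k - i)\<close>, with powers of \<open>D\<close> as maps, vanishes whenever
  the sum \<open>2k - i\<close> of the two lower degrees lies outside the open interval \<open>(N - d, N)\<close>.\<close>

definition modular_exact :: "('v::ab_group_add \<Rightarrow> 'v) \<Rightarrow> nat \<Rightarrow> (int \<Rightarrow> 'v set) \<Rightarrow> int \<Rightarrow> bool" where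
  "modular_exact D d A N \<longleftrightarrow>
     (\<forall>k. \<forall>v\<in>A k. (D ^^ d) v = 0) \<and>
     (\<forall>k i. \<forall>v\<in>A k. i \<le> d \<longrightarrow> 2 * k - int i \<ge> N \<or> 2 * k - int i \<le> N - int d \<longrightarrow>
        (D ^^ i) v = 0 \<longrightarrow> v \<in> (D ^^ (d - i)) ` A (k + int (d - i)))"

lemma modular_exactD:
  assumes "modular_exact D d A N" "v \<in> A k" "i \<le> d"
    and "2 * k - int i \<ge> N \<or> 2 * k - int i \<le> N - int d" "(D ^^ i) v = 0"
  obtains w where "w \<in> A (k + int (d - i))" "(D ^^ (d - i)) w = v"
  using assms unfolding modular_exact_def by (metis imageE)

lemma funpow_lower_mem:
  fixes A :: "int \<Rightarrow> 'v set"
  assumes "\<And>k v. v \<in> A k \<Longrightarrow> D v \<in> A (k - 1)" and "v \<in> A k"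
  shows "(D ^^ j) v \<in> A (k - int j)"
proof (induction j)
  case (Suc j)
  then show ?case using assms(1)[OF Suc] by (simp add: algebra_simps)
qed (use assms in simp)

lemma geometric_shift:
  fixes \<theta> :: "int \<Rightarrow> 'f::comm_monoid_mult"
  assumes "\<And>k. \<theta> (k - 1) = Q * \<theta> k"
  shows "\<theta> (k - int j) = Q ^ j * \<theta> k"
proof (induction j)
  case (Suc j)
  have "\<theta> (k - int (Suc j)) = \<theta> (k - int j - 1)" by (simp add: algebra_simps)
  also have "\<dots> = Q * (Q ^ j * \<theta> k)" unfolding assms Suc ..
  finally show ?case by (simp add: mult.assoc)
qed simp

context vector_space
begin

lemma linear_funpow: "module_hom scale scale D \<Longrightarrow> module_hom scale scale (D ^^ j)"
proof (induction j)
  case 0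
  then show ?case using module.module_hom_id[OF module_axioms] by (simp add: id_def)
next
  case (Suc j)
  then show ?case using module_hom_compose[of scale scale "D ^^ j" scale D] by (simp only: funpow.simps)
qed

text \<open>When \<open>\<iota>\<close> is moved out past \<open>Suc j\<close> copies of
  \<open>D\<close>, the error term can arise at any one of them; arising one copy later, in a degree
  lower by one, it carries a further factor \<open>Q\<close>. Summing these powers is where the
  \<open>q\<close>-integers come from.\<close>

lemma funpow_branch:
  fixes A :: "int \<Rightarrow> 'b set"
  assumes D: "module_hom scale scale D" and i: "module_hom scale scale \<iota>"
    and D_A: "\<And>k v. v \<in> A k \<Longrightarrow> D v \<in> A (k - 1)"
    and comm: "\<And>k g. g \<in> A k \<Longrightarrow> D (\<iota> g) = scale (\<theta> k) g + \<iota> (D g)"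
    and \<theta>: "\<And>k. \<theta> (k - 1) = Q * \<theta> k"
    and g: "g \<in> A k"
  shows "(D ^^ Suc j) (\<iota> g) =
    scale (\<theta> k * gauss_sum Q (Suc j)) ((D ^^ j) g) + \<iota> ((D ^^ Suc j) g)"
proof (induction j)
  case 0
  show ?case using comm[OF g] by (simp add: gauss_sum_def)
next
  case (Suc j)
  note th = geometric_shift[of \<theta>, OF \<theta>]
  interpret D: module_hom scale scale D by fact
  have mem: "(D ^^ Suc j) g \<in> A (k - int (Suc j))"
    using funpow_lower_mem[of A D, OF D_A g] .
  have "(D ^^ Suc (Suc j)) (\<iota> g) = D ((D ^^ Suc j) (\<iota> g))" by simp
  also have "\<dots> = scale (\<theta> k * gauss_sum Q (Suc j)) ((D ^^ Suc j) g) + D (\<iota> ((D ^^ Suc j) g))"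
    unfolding Suc D.add D.scale by simp
  also have "\<dots> = scale (\<theta> k * gauss_sum Q (Suc j)) ((D ^^ Suc j) g)
      + scale (Q ^ Suc j * \<theta> k) ((D ^^ Suc j) g) + \<iota> ((D ^^ Suc (Suc j)) g)"
    unfolding comm[OF mem] th by (simp add: add.assoc)
  also have "scale (\<theta> k * gauss_sum Q (Suc j)) ((D ^^ Suc j) g)
      + scale (Q ^ Suc j * \<theta> k) ((D ^^ Suc j) g)
      = scale (\<theta> k * gauss_sum Q (Suc (Suc j))) ((D ^^ Suc j) g)"
    unfolding scale_left_distrib[symmetric] by (simp add: gauss_sum_def algebra_simps)
  finally show ?case .
qed

text \<open>The elements \<open>f \<in> A k\<close> form a subcomplex of \<open>B k\<close> with quotient \<open>A (k - 1)\<close>.  The long exact homology sequence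
  alone leaves the boundary cases \<open>2k - i = N\<close> and \<open>2k - i = N - d\<close> open; there the connecting
  map, which is \<open>D ^ (i - 1)\<close> up to a nonzero multiple of \<open>gauss_sum Q i\<close>, is injective and surjective, respectively.\<close>

lemma modular_exact_branch:
  fixes A B :: "int \<Rightarrow> 'b set"
  assumes D: "module_hom scale scale D" and i: "module_hom scale scale \<iota>"
    and sub: "\<And>k. subspace (A k)"
    and D_A: "\<And>k v. v \<in> A k \<Longrightarrow> D v \<in> A (k - 1)"
    and comm: "\<And>k g. g \<in> A k \<Longrightarrow> D (\<iota> g) = scale (\<theta> k) g + \<iota> (D g)"
    and \<theta>: "\<And>k. \<theta> (k - 1) = Q * \<theta> k" "\<And>k. \<theta> k \<noteq> 0"
    and inj: "\<And>j k f g. f \<in> A j \<Longrightarrow> g \<in> A k \<Longrightarrow> f + \<iota> g = 0 \<Longrightarrow> f = 0 \<and> g = 0"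
    and B: "\<And>k. B k = {f + \<iota> g | f g. f \<in> A k \<and> g \<in> A (k - 1)}"
    and gauss: "gauss_sum Q d = 0" "\<And>j. 0 < j \<Longrightarrow> j < d \<Longrightarrow> gauss_sum Q j \<noteq> 0" and "0 < d"
    and ex: "modular_exact D d A (N - 1)"
  shows "modular_exact D d B N"
proof -
  have iter: "(D ^^ Suc j) (\<iota> g) =
      scale (\<theta> k * gauss_sum Q (Suc j)) ((D ^^ j) g) + \<iota> ((D ^^ Suc j) g)" if "g \<in> A k" for g k j
    using D i D_A comm \<theta>(1) that by (rule funpow_branch)
  have lin: "module_hom scale scale (D ^^ j)" for j using linear_funpow[OF D] .
  note Padd = module_hom.add[OF lin] and Pscale = module_hom.scale[OF lin] and Pdiff = module_hom.diff[OF lin]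
    and P0 = module_hom.zero[OF lin]
  note i0 = module_hom.zero[OF i]
  have PP: "(D ^^ a) ((D ^^ b) x) = (D ^^ (a + b)) x" for a b x by (simp add: funpow_add)
  have mem: "(D ^^ j) v \<in> A m" if "v \<in> A k" "m = k - int j" for j v k m
    using funpow_lower_mem[of A D, OF D_A that(1)] that(2) by simp
  note subA = subspace_add[OF sub] subspace_scale[OF sub] subspace_diff[OF sub] subspace_0[OF sub]
    subspace_neg[OF sub]
  have nilA: "(D ^^ d) v = 0" if "v \<in> A k" for v k
    using ex that unfolding modular_exact_def by blast
  have nil: "(D ^^ d) v = 0" if "v \<in> B k" for v k
  proof -
    from that obtain f g where v: "v = f + \<iota> g" "f \<in> A k" "g \<in> A (k - 1)" unfolding B by blast
    from \<open>0 < d\<close> obtain d' where d': "d = Suc d'" by (cases d) auto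
    have "(D ^^ d) (\<iota> g) = 0"
      using iter[OF v(3), of d'] nilA[OF v(3)] gauss(1) unfolding d'[symmetric] by (simp add: i0)
    then show ?thesis using nilA[OF v(2)] unfolding v(1) Padd by simp
  qed
  have main: "\<exists>w\<in>B (k + int (d - i)). (D ^^ (d - i)) w = v"
    if v: "v \<in> B k" and id: "i \<le> d" and rg: "2 * k - int i \<ge> N \<or> 2 * k - int i \<le> N - int d"
      and z: "(D ^^ i) v = 0" for k i v
  proof (cases "i = 0 \<or> i = d")
    case True
    then show ?thesis
    proof
      assume "i = 0"
      then have "v = 0" using z by simp
      moreover have "0 \<in> B (k + int (d - i))" unfolding B using subA(4) i0 by force
      ultimately show ?thesis using P0 by blast
    next
      assume "i = d" then show ?thesis using v by auto
    qed
  next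
    case False
    define e where "e = d - i"
    have die: "d = i + e" "i > 0" "e > 0" using False id by (auto simp: e_def)
    then obtain i' e' where ie: "i = Suc i'" "e = Suc e'" using gr0_implies_Suc by metis
    from v obtain f g where fg: "v = f + \<iota> g" "f \<in> A k" "g \<in> A (k - 1)" unfolding B by blast
    \<comment> \<open>\<open>c\<close> and \<open>c'\<close> are the cross-term coefficients of
      \<open>D ^^ i\<close> on \<open>\<iota> g\<close> and of \<open>D ^^ e\<close> on
      \<open>\<iota> g'\<close> for a preimage \<open>g'\<close> of \<open>g\<close> under
      \<open>D ^^ e\<close>. Both are multiples of \<open>\<theta> (k - 1 + int e)\<close>, and the
      two factors add up to the \<open>q\<close>-integer of \<open>d\<close>, so
      \<open>c = - c'\<close>.\<close>
    define c where "c = \<theta> (k - 1) * gauss_sum Q i"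
    define c' where "c' = \<theta> (k - 1 + int e) * gauss_sum Q e"
    have c: "c \<noteq> 0" "c' \<noteq> 0" using gauss(2)[of i] gauss(2)[of e] die \<theta>(2) by (auto simp: c_def c'_def)
    note th = geometric_shift[of \<theta>, OF \<theta>(1)]
    have "c = Q ^ e * \<theta> (k - 1 + int e) * gauss_sum Q i"
      using th[of "k - 1 + int e" e] by (simp add: c_def)
    then have "c + c' = \<theta> (k - 1 + int e) * gauss_sum Q (e + i)"
      unfolding gauss_sum_add c'_def by (simp add: algebra_simps)
    also have "\<dots> = 0" using gauss(1) die(1) by (simp add: add.commute)
    finally have cc: "c = - c'" by (simp add: add_eq_0_iff)
    have "((D ^^ i) f + scale c ((D ^^ i') g)) + \<iota> ((D ^^ i) g) = 0"
      using z iter[OF fg(3), of i'] unfolding fg(1) Padd ie(1) c_def by (simp add: add.assoc)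
    moreover have "(D ^^ i) f + scale c ((D ^^ i') g) \<in> A (k - int i)"
      by (intro subA(1,2) mem[OF fg(2)] mem[OF fg(3)]) (simp_all add: ie)
    ultimately have h1: "(D ^^ i) f + scale c ((D ^^ i') g) = 0" and h2: "(D ^^ i) g = 0"
      using inj mem[OF fg(3)] by blast+
    have "\<exists>g'\<in>A (k - 1 + int e). (D ^^ e) g' = g"
    proof (cases "2 * k - int i = N")
      case False
      then have r: "2 * (k - 1) - int i \<ge> N - 1 \<or> 2 * (k - 1) - int i \<le> N - 1 - int d"
        using rg by (cases "2 * k - int i \<ge> N") simp_all
      show ?thesis using modular_exactD[OF ex fg(3) id r h2] unfolding e_def by blast
    next
      case True
      \<comment> \<open>Exactness at exponent \<open>i\<close> says nothing about \<open>g\<close>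
        here. But \<open>h1\<close> puts \<open>scale c g + D f\<close> into the kernel of
        \<open>D ^^ (i - 1)\<close>, where exactness applies; the preimage \<open>y\<close> yields
        \<open>y0\<close> with \<open>D y0 = scale c g\<close>, and exactness at exponent
        \<open>i + 1\<close> makes \<open>y0\<close> an image under
        \<open>D ^^ (e - 1)\<close>.\<close>
      have m0: "(D ^^ i') (scale c g + D f) = 0"
        using h1 by (simp add: Padd Pscale ie funpow_swap1 add.commute)
      have m1: "scale c g + D f \<in> A (k - 1)" by (intro subA(1,2) fg D_A)
      have m2: "i' \<le> d" "2 * (k - 1) - int i' \<ge> N - 1 \<or> 2 * (k - 1) - int i' \<le> N - 1 - int d"
        using True id ie by auto
      obtain y where y: "y \<in> A (k - 1 + int (d - i'))"
        "(D ^^ (d - i')) y = scale c g + D f" using modular_exactD[OF ex m1 m2 m0] .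
      have y': "y \<in> A (k + int e)" "(D ^^ Suc e) y = scale c g + D f"
        using y die ie by (simp_all add: algebra_simps)
      define y0 where "y0 = (D ^^ e) y - f"
      have y0: "y0 \<in> A k" unfolding y0_def by (intro subA(3) fg mem[OF y'(1)]) simp
      have Dy0: "D y0 = scale c g" using y'(2) module_hom.diff[OF D] by (simp add: y0_def)
      have m3: "(D ^^ Suc i) y0 = 0" using Dy0 h2 by (simp add: funpow_swap1 Pscale)
      have m4: "Suc i \<le> d" "2 * k - int (Suc i) \<ge> N - 1 \<or> 2 * k - int (Suc i) \<le> N - 1 - int d"
        using True die by auto
      obtain x where x: "x \<in> A (k + int (d - Suc i))" "(D ^^ (d - Suc i)) x = y0"
        using modular_exactD[OF ex y0 m4 m3] .
      have x': "x \<in> A (k - 1 + int e)" "(D ^^ e') x = y0"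
        using x die ie by (simp_all add: algebra_simps)
      have "(D ^^ e) x = scale c g" using x'(2) Dy0 ie by simp
      then have "(D ^^ e) (scale (inverse c) x) = g" using c by (simp add: Pscale)
      then show ?thesis using subA(2)[OF x'(1)] by blast
    qed
    then obtain g' where g': "g' \<in> A (k - 1 + int e)" "(D ^^ e) g' = g" by blast
    \<comment> \<open>\<open>D ^^ e\<close> sends \<open>\<iota> g'\<close> to
      \<open>\<iota> g\<close> plus a cross term. What remains of \<open>f\<close> after subtracting
      that term is \<open>f0\<close>, and \<open>c = - c'\<close> places it in the kernel of
      \<open>D ^^ i\<close>.\<close>
    define f0 where "f0 = f - scale c' ((D ^^ e') g')"
    have f0: "f0 \<in> A k" unfolding f0_def by (intro subA fg mem[OF g'(1)]) (simp add: ie)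
    have "(D ^^ i) f0 = (D ^^ i) f + scale c ((D ^^ i') g)"
    proof -
      have "(D ^^ i) ((D ^^ e') g') = (D ^^ i') g"
        unfolding g'(2)[symmetric] PP ie by simp
      then show ?thesis by (simp add: f0_def Pdiff Pscale cc)
    qed
    then have Df0: "(D ^^ i) f0 = 0" using h1 by simp
    \<comment> \<open>A change of \<open>g'\<close> by an element of the kernel of
      \<open>D ^^ e\<close> keeps it a preimage of \<open>g\<close> and alters the cross term by a
      multiple of \<open>(D ^^ e') u\<close>. Only the boundary case
      \<open>2 * k - int i = N - int d\<close> exploits this freedom; otherwise
      \<open>u = 0\<close>.\<close>
    have "\<exists>u f'. u \<in> A (k - 1 + int e) \<and> f' \<in> A (k + int e) \<and> (D ^^ e) u = 0 \<and>
      f0 = (D ^^ e') u + (D ^^ e) f'"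
    proof (cases "2 * k - int i = N - int d")
      case False
      then have r: "2 * k - int i \<ge> N - 1 \<or> 2 * k - int i \<le> N - 1 - int d"
        using rg by (cases "2 * k - int i \<ge> N") simp_all
      obtain f' where "f' \<in> A (k + int e)" "(D ^^ e) f' = f0"
        using modular_exactD[OF ex f0 id r Df0] unfolding e_def by blast
      then show ?thesis using subA(4) P0 by (intro exI[of _ 0] exI[of _ f']) auto
    next
      case True
      \<comment> \<open>Since \<open>f0\<close> also lies in the kernel of
        \<open>D ^^ (i + 1)\<close>, where the range condition holds, it has a preimage
        \<open>u0\<close> under \<open>D ^^ e'\<close>. Subtracting \<open>D x\<close> from
        \<open>u0\<close> makes it vanish under \<open>D ^^ e\<close>, at the price of the term
        \<open>(D ^^ e) x\<close>.\<close>
      have r: "2 * k - int (Suc i) \<ge> N - 1 \<or> 2 * k - int (Suc i) \<le> N - 1 - int d" "Suc i \<le> d"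
        using True die by auto
      have m5: "(D ^^ Suc i) f0 = 0" using Df0 module_hom.zero[OF D] by simp
      obtain u0
        where "u0 \<in> A (k + int (d - Suc i))" "(D ^^ (d - Suc i)) u0 = f0" using modular_exactD[OF ex f0 r(2,1) m5] .
      then have u0: "u0 \<in> A (k - 1 + int e)" "(D ^^ e') u0 = f0"
        using die ie by (simp_all add: algebra_simps)
      have m: "(D ^^ e) u0 \<in> A (k - 1)" by (rule mem[OF u0(1)]) simp
      have m6: "(D ^^ i') ((D ^^ e) u0) = 0"
        using Df0 unfolding u0(2)[symmetric] PP ie by simp
      have m7: "i' \<le> d" "2 * (k - 1) - int i' \<ge> N - 1 \<or> 2 * (k - 1) - int i' \<le> N - 1 - int d"
        using True id ie by auto
      obtain x where x: "x \<in> A (k - 1 + int (d - i'))" "(D ^^ (d - i')) x = (D ^^ e) u0"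
        using modular_exactD[OF ex m m7 m6] .
      have x': "x \<in> A (k + int e)" "(D ^^ e) (D x) = (D ^^ e) u0"
        using x die ie by (simp_all add: algebra_simps funpow_swap1)
      have "D x \<in> A (k - 1 + int e)" using D_A[OF x'(1)] by (simp add: algebra_simps)
      moreover have "(D ^^ e) (u0 - D x) = 0" using x'(2) by (simp add: Pdiff)
      moreover have "f0 = (D ^^ e') (u0 - D x) + (D ^^ e) x"
        using u0(2) by (simp add: Pdiff ie funpow_swap1)
      ultimately show ?thesis using x'(1) u0(1) subA(3) by blast
    qed
    then obtain u f' where u: "u \<in> A (k - 1 + int e)" "(D ^^ e) u = 0"
      and f': "f' \<in> A (k + int e)" "f0 = (D ^^ e') u + (D ^^ e) f'" by blast
    define h where "h = g' + scale (inverse c') u"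
    have h: "h \<in> A (k - 1 + int e)" unfolding h_def by (intro subA g' u)
    have Dh: "(D ^^ e) h = g" using u(2) g'(2) by (simp add: h_def Padd Pscale)
    have "(D ^^ e) (\<iota> h) = scale c' ((D ^^ e') h) + \<iota> g"
      using iter[OF h, of e'] Dh unfolding ie(2)[symmetric] c'_def by simp
    moreover have "scale c' ((D ^^ e') h) = scale c' ((D ^^ e') g') + (D ^^ e') u"
      using c by (simp add: h_def Padd Pscale scale_right_distrib)
    ultimately have "(D ^^ e) (f' + \<iota> h) = v"
      using f'(2) unfolding fg(1) Padd f0_def by (simp add: algebra_simps)
    moreover have "f' + \<iota> h \<in> B (k + int e)"
      unfolding B using f'(1) h by (auto simp: algebra_simps)
    ultimately show ?thesis unfolding e_def by blast
  qed
  show ?thesis unfolding modular_exact_def 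
  proof (intro conjI allI ballI impI)
    fix k i v
    assume "v \<in> B k" "i \<le> d" "2 * k - int i \<ge> N \<or> 2 * k - int i \<le> N - int d" "(D ^^ i) v = 0"
    from main[OF this] show "v \<in> (D ^^ (d - i)) ` B (k + int (d - i))" by blast
  qed (rule nil)
qed

end

section \<open>Functions on a ranked family of sets and the lowering map\<close>

definition fscale :: "'f::field \<Rightarrow> ('x \<Rightarrow> 'f) \<Rightarrow> 'x \<Rightarrow> 'f" where
  "fscale a v = (\<lambda>x. a * v x)"

lemma fscale_apply [simp]: "fscale a v x = a * v x"
  by (simp add: fscale_def)

interpretation fun_space: vector_space "fscale :: 'f::field \<Rightarrow> ('x \<Rightarrow> 'f) \<Rightarrow> _"
  by standard (auto simp: fun_eq_iff algebra_simps)

lemma sum_fun_apply: "(\<Sum>i\<in>I. f i) x = (\<Sum>i\<in>I. f i x)"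
  by (induction I rule: infinite_finite_induct) auto

text \<open>The map \<open>D\<close> in coefficients: \<open>W\<close> contributes to every
  \<open>Y\<close> one rank below it, so the coefficient at \<open>Y\<close> collects from above.
  The value 0 off \<open>L\<close> keeps images supported on \<open>L\<close>.\<close>

definition lower :: "'x set set \<Rightarrow> ('x set \<Rightarrow> int) \<Rightarrow> ('x set \<Rightarrow> 'f::field) \<Rightarrow> 'x set \<Rightarrow> 'f" where
  "lower L rk v Y = (if Y \<in> L then (\<Sum>W\<in>{W \<in> L. Y \<subseteq> W \<and> rk W = rk Y + 1}. v W) else 0)"

text \<open>Integer degrees make every shift legitimate, with zero spaces out of range. Only the
  bounding set \<open>S\<close> shrinks in the inductions, while \<open>lower L rk\<close> remains
  one and the same map.\<close>

definition fun_level :: "'x set set \<Rightarrow> ('x set \<Rightarrow> int) \<Rightarrow> 'x set \<Rightarrow> int \<Rightarrow> ('x set \<Rightarrow> 'f::field) set" where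
  "fun_level L rk S k = {v. \<forall>W. v W \<noteq> 0 \<longrightarrow> W \<in> L \<and> W \<subseteq> S \<and> rk W = k}"

lemma fun_levelD: "v \<in> fun_level L rk S k \<Longrightarrow> \<not> (W \<in> L \<and> W \<subseteq> S \<and> rk W = k) \<Longrightarrow> v W = 0"
  by (auto simp: fun_level_def)

lemma module_hom_lower: "module_hom fscale fscale (lower L rk)"
  unfolding module_hom_iff
  by (auto simp: fun_space.module_axioms fun_eq_iff lower_def sum.distrib sum_distrib_left)

lemma module_hom_lower_funpow: "module_hom fscale fscale (lower L rk ^^ j)"
  by (rule fun_space.linear_funpow[OF module_hom_lower])

lemma subspace_fun_level: "fun_space.subspace (fun_level L rk S k :: ('x set \<Rightarrow> 'f::field) set)"
proof (rule fun_space.subspaceI)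
  fix v w :: "'x set \<Rightarrow> 'f" assume vw: "v \<in> fun_level L rk S k" "w \<in> fun_level L rk S k"
  have "W \<in> L \<and> W \<subseteq> S \<and> rk W = k" if "(v + w) W \<noteq> 0" for W
    using that vw by (cases "v W = 0") (auto simp: fun_level_def)
  then show "v + w \<in> fun_level L rk S k" by (simp add: fun_level_def)
qed (auto simp: fun_level_def)

lemma lower_mem_fun_level:
  assumes "v \<in> fun_level L rk S k"
  shows "lower L rk v \<in> fun_level L rk S (k - 1)"
proof -
  have "Y \<in> L \<and> Y \<subseteq> S \<and> rk Y = k - 1" if "lower L rk v Y \<noteq> 0" for Y
  proof -
    from that have Y: "Y \<in> L" by (auto simp: lower_def split: if_splits)
    with that have "sum v {W \<in> L. Y \<subseteq> W \<and> rk W = rk Y + 1} \<noteq> 0" by (simp add: lower_def)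
    then obtain W where "W \<in> {W \<in> L. Y \<subseteq> W \<and> rk W = rk Y + 1}" "v W \<noteq> 0"
      by (rule sum.not_neutral_contains_not_neutral)
    then show ?thesis using assms Y by (auto simp: fun_level_def)
  qed
  then show ?thesis by (auto simp: fun_level_def)
qed

text \<open>Equivariance of the lowering map in the generality that serves both the transvections
  and the action of \<open>G\<close>: a rank-preserving order automorphism permutes the sets one
  rank above.\<close>

lemma lower_comp_automorphism:
  assumes "bij_betw \<tau> L L" and "\<And>W Y. W \<in> L \<Longrightarrow> Y \<in> L \<Longrightarrow> \<tau> W \<subseteq> \<tau> Y \<longleftrightarrow> W \<subseteq> Y"
    and "\<And>W. W \<in> L \<Longrightarrow> rk (\<tau> W) = rk W" and Y: "Y \<in> L"
  shows "lower L rk (\<lambda>W. v (\<tau> W)) Y = lower L rk v (\<tau> Y)"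
proof -
  have \<tau>: "inj_on \<tau> L" "\<tau> ` L = L" using assms(1) by (auto simp: bij_betw_def)
  let ?A = "{W \<in> L. Y \<subseteq> W \<and> rk W = rk Y + 1}"
  have im: "\<tau> ` ?A = {W \<in> L. \<tau> Y \<subseteq> W \<and> rk W = rk (\<tau> Y) + 1}"
  proof (intro equalityI subsetI)
    fix W assume W: "W \<in> {W \<in> L. \<tau> Y \<subseteq> W \<and> rk W = rk (\<tau> Y) + 1}"
    then obtain V where "V \<in> L" "W = \<tau> V" using \<tau>(2) by blast
    then show "W \<in> \<tau> ` ?A" using W Y assms(2,3) by auto
  qed (use assms(2,3) Y \<tau>(2) in auto)
  have "inj_on \<tau> ?A" using \<tau>(1) by (rule inj_on_subset) auto
  then have "(\<Sum>W\<in>?A. v (\<tau> W)) = sum v (\<tau> ` ?A)" by (simp add: sum.reindex)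
  then show ?thesis using Y \<tau>(2) unfolding lower_def im by auto
qed

lemma modular_exact_base:
  assumes "D 0 = 0" "\<And>v. v \<in> A 0 \<Longrightarrow> D v = 0" "\<And>k. k \<noteq> 0 \<Longrightarrow> A k = {0}" "\<And>k. 0 \<in> A k" "0 < d"
  shows "modular_exact D d A 0"
proof -
  have D0: "(D ^^ j) 0 = 0" for j using assms(1) by (induction j) simp_all
  have "(D ^^ Suc j) v = 0" if "v \<in> A k" for v k j
    using that assms(1-3) D0 by (cases "k = 0") (auto simp: funpow_swap1)
  then have n: "(D ^^ j) v = 0" if "v \<in> A k" "0 < j" for v k j
    using that by (cases j) auto
  show ?thesis unfolding modular_exact_def
  proof (intro conjI allI ballI impI)
    fix k i v assume a: "v \<in> A k" "i \<le> d" "0 \<le> 2 * k - int i \<or> 2 * k - int i \<le> 0 - int d" "(D ^^ i) v = 0"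
    \<comment> \<open>In degree 0 the sum is \<open>- int i\<close>, which lies strictly between
      \<open>- int d\<close> and 0 unless \<open>i\<close> is 0 or \<open>d\<close>; the range
      condition thus removes exactly the cases with homology.\<close>
    consider "i = 0" | "i = d" | "v = 0" using a assms(3)[of k] by force
    then show "v \<in> (D ^^ (d - i)) ` A (k + int (d - i))"
    proof cases
      case 1
      then have "v = (D ^^ (d - i)) 0" using a D0 by simp
      then show ?thesis using assms(4) by blast
    next
      case 3
      then have "v = (D ^^ (d - i)) 0" using a D0 by simp
      then show ?thesis using assms(4) by blast
    qed (use a in auto)
  qed (use n assms(5) in blast)
qed

section \<open>Subsets of a finite set\<close>

definition lift_set :: "'a \<Rightarrow> ('a set \<Rightarrow> 'f::field) \<Rightarrow> 'a set \<Rightarrow> 'f" where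
  "lift_set e g W = (if e \<in> W then g (W - {e}) else 0)"

text \<open>On basis elements: removing one element from \<open>insert e Z\<close> either removes
  \<open>e\<close> and returns \<open>Z\<close>, or removes an element of \<open>Z\<close> and keeps
  \<open>e\<close>. A coefficient at \<open>Y\<close> containing \<open>e\<close> sees only the
  second kind, one at \<open>Y\<close> avoiding \<open>e\<close> only the first.\<close>

lemma lower_lift_set:
  fixes g :: "'a set \<Rightarrow> 'f::field"
  assumes \<Omega>: "finite \<Omega>" and e: "e \<in> \<Omega>" "e \<notin> H" and H: "H \<subseteq> \<Omega>"
    and g: "g \<in> fun_level (Pow \<Omega>) (\<lambda>W. int (card W)) H k"
  shows "lower (Pow \<Omega>) (\<lambda>W. int (card W)) (lift_set e g)
    = g + lift_set e (lower (Pow \<Omega>) (\<lambda>W. int (card W)) g)"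
proof
  let ?D = "lower (Pow \<Omega>) (\<lambda>W. int (card W)) :: ('a set \<Rightarrow> 'f) \<Rightarrow> _"
  fix Y
  consider "\<not> Y \<subseteq> \<Omega>" | "Y \<subseteq> \<Omega>" "e \<in> Y" | "Y \<subseteq> \<Omega>" "e \<notin> Y" by blast
  then show "?D (lift_set e g) Y = (g + lift_set e (?D g)) Y"
  proof cases
    case 1
    then have "\<not> Y - {e} \<subseteq> \<Omega>" using e by blast
    then show ?thesis using fun_levelD[OF g, of Y] 1 by (auto simp: lower_def lift_set_def)
  next
    case 2
    then have gY: "g Y = 0" using fun_levelD[OF g, of Y] e by blast
    have fY: "finite Y" using 2 \<Omega> finite_subset by blast
    have "?D (lift_set e g) Y = (\<Sum>W\<in>{W. W \<subseteq> \<Omega> \<and> Y \<subseteq> W \<and> int (card W) = int (card Y) + 1}. g (W - {e}))"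
      unfolding lower_def using 2 by (auto intro!: sum.cong simp: lift_set_def)
    also have "\<dots> = (\<Sum>Z\<in>{Z. Z \<subseteq> \<Omega> \<and> Y - {e} \<subseteq> Z \<and> int (card Z) = int (card (Y - {e})) + 1 \<and> e \<notin> Z}. g Z)"
    proof (rule sum.reindex_bij_witness[of _ "insert e" "\<lambda>W. W - {e}"])
      fix Z assume Z: "Z \<in> {Z. Z \<subseteq> \<Omega> \<and> Y - {e} \<subseteq> Z \<and> int (card Z) = int (card (Y - {e})) + 1 \<and> e \<notin> Z}"
      then have "finite Z" using \<Omega> finite_subset by blast
      then show "insert e Z \<in> {W. W \<subseteq> \<Omega> \<and> Y \<subseteq> W \<and> int (card W) = int (card Y) + 1}"
        using Z 2 e fY card_Suc_Diff1[OF fY 2(2)] by auto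
    next
      fix W assume W: "W \<in> {W. W \<subseteq> \<Omega> \<and> Y \<subseteq> W \<and> int (card W) = int (card Y) + 1}"
      then have "finite W" using \<Omega> finite_subset by blast
      then show "W - {e} \<in> {Z. Z \<subseteq> \<Omega> \<and> Y - {e} \<subseteq> Z \<and> int (card Z) = int (card (Y - {e})) + 1 \<and> e \<notin> Z}"
        using W 2 card_Suc_Diff1[OF fY 2(2)] card_Suc_Diff1[of W e] by auto
    qed (use 2 in auto)
    also have "\<dots> = ?D g (Y - {e})"
    proof -
      have "Y - {e} \<in> Pow \<Omega>" using 2 by blast
      moreover have "g W = 0" if "e \<in> W" for W using fun_levelD[OF g, of W] e that by blast
      ultimately show ?thesis unfolding lower_def using \<Omega>
        by (simp, intro sum.mono_neutral_left) auto
    qed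
    finally show ?thesis using 2 gY by (simp add: lift_set_def)
  next
    case 3
    have fY: "finite Y" using 3 \<Omega> finite_subset by blast
    let ?M = "{W. W \<subseteq> \<Omega> \<and> Y \<subseteq> W \<and> int (card W) = int (card Y) + 1}"
    have z: "lift_set e g W = 0" if W: "W \<in> ?M - {insert e Y}" for W
    proof -
      have "e \<notin> W"
      proof
        assume "e \<in> W"
        then have "insert e Y \<subseteq> W" using W by blast
        moreover have "card (insert e Y) = card W" using W 3 fY by auto
        moreover have "finite W" using W \<Omega> finite_subset by blast
        ultimately show False using W card_subset_eq by blast
      qed
      then show ?thesis by (simp add: lift_set_def)
    qed
    have "?D (lift_set e g) Y = sum (lift_set e g) ?M"
      unfolding lower_def using 3 by simp
    also have "\<dots> = sum (lift_set e g) {insert e Y}"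
      using \<Omega> 3 e fY z by (intro sum.mono_neutral_right) auto
    finally have "?D (lift_set e g) Y = lift_set e g (insert e Y)" by simp
    then show ?thesis using 3 by (simp add: lift_set_def)
  qed
qed

text \<open>A subset of \<open>insert e H\<close> avoids \<open>e\<close> or is \<open>e\<close>
  joined to a subset of \<open>H\<close>, so branching describes the whole level. The error term has
  coefficient 1 in every degree, hence \<open>Q = 1\<close> and the \<open>q\<close>-integers are
  ordinary integers in the field.\<close>

lemma modular_exact_subsets:
  assumes \<Omega>: "finite \<Omega>" and S: "S \<subseteq> \<Omega>" and d: "0 < d"
    and gauss: "gauss_sum (1::'f::field) d = 0" "\<And>j. 0 < j \<Longrightarrow> j < d \<Longrightarrow> gauss_sum (1::'f) j \<noteq> 0"
  shows "modular_exact (lower (Pow \<Omega>) (\<lambda>W. int (card W)) :: _ \<Rightarrow> 'a set \<Rightarrow> 'f) d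
    (fun_level (Pow \<Omega>) (\<lambda>W. int (card W)) S) (int (card S))"
proof -
  let ?D = "lower (Pow \<Omega>) (\<lambda>W. int (card W)) :: ('a set \<Rightarrow> 'f) \<Rightarrow> _"
  let ?A = "\<lambda>S k. fun_level (Pow \<Omega>) (\<lambda>W. int (card W)) S k :: ('a set \<Rightarrow> 'f) set"
  have "finite S" using \<Omega> S finite_subset by blast
  then show ?thesis using S
  proof (induction S rule: finite_induct)
    case empty
    have "?D v = 0" if "v \<in> ?A {} 0" for v
    proof
      fix Y :: "'a set"
      have "v W = 0" if "int (card W) = int (card Y) + 1" for W
        using fun_levelD[OF \<open>v \<in> ?A {} 0\<close>, of W] that by (cases "W = {}") auto
      then show "?D v Y = 0 Y" by (simp add: lower_def)
    qed
    moreover have "?A {} k = {0}" if "k \<noteq> 0" for k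
    proof -
      have "v W = 0" if "v \<in> ?A {} k" for v W
        using fun_levelD[OF that, of W] \<open>k \<noteq> 0\<close> by (cases "W = {}") auto
      moreover have "0 \<in> ?A {} k" by (simp add: fun_level_def)
      ultimately show ?thesis by (auto simp: fun_eq_iff)
    qed
    moreover have "0 \<in> ?A {} k" for k by (simp add: fun_level_def)
    moreover have "?D 0 = 0" by (simp add: lower_def fun_eq_iff)
    ultimately show ?case using modular_exact_base[of ?D "?A {}" d] d by simp
  next
    case (insert e H)
    have eH: "e \<in> \<Omega>" "e \<notin> H" "H \<subseteq> \<Omega>" using insert by auto
    have fin: "finite W" if "W \<subseteq> \<Omega>" for W using \<Omega> that finite_subset by blast
    have B: "?A (insert e H) k = {f + lift_set e g | f g. f \<in> ?A H k \<and> g \<in> ?A H (k - 1)}" (is "_ = ?R") for k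
    proof (intro equalityI subsetI)
      fix v assume v: "v \<in> ?A (insert e H) k"
      define f where "f = (\<lambda>W. if e \<in> W then 0 else v W)"
      define g where "g = (\<lambda>W. if e \<in> W then 0 else v (insert e W))"
      have "v = f + lift_set e g"
        by (auto simp: fun_eq_iff f_def g_def lift_set_def insert_absorb)
      moreover have "f \<in> ?A H k" using v by (auto simp: fun_level_def f_def)
      moreover have "g \<in> ?A H (k - 1)"
      proof -
        have "W \<in> Pow \<Omega> \<and> W \<subseteq> H \<and> int (card W) = k - 1" if "g W \<noteq> 0" for W
        proof -
          have e: "e \<notin> W" "v (insert e W) \<noteq> 0" using that by (auto simp: g_def split: if_splits)
          then have "insert e W \<subseteq> \<Omega>" "insert e W \<subseteq> insert e H" "int (card (insert e W)) = k"
            using v by (auto simp: fun_level_def)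
          then show ?thesis using e fin[of W] by auto
        qed
        then show ?thesis by (auto simp: fun_level_def)
      qed
      ultimately show "v \<in> ?R" by blast
    next
      fix v assume "v \<in> ?R"
      then obtain f g where fg: "v = f + lift_set e g" "f \<in> ?A H k" "g \<in> ?A H (k - 1)" by blast
      have "W \<in> Pow \<Omega> \<and> W \<subseteq> insert e H \<and> int (card W) = k" if "v W \<noteq> 0" for W
      proof (cases "f W = 0")
        case True
        then have "e \<in> W" "g (W - {e}) \<noteq> 0" using that fg(1) by (auto simp: lift_set_def split: if_splits)
        then have W: "W - {e} \<subseteq> \<Omega>" "W - {e} \<subseteq> H" "int (card (W - {e})) = k - 1"
          using fg(3) by (auto simp: fun_level_def)
        then have "W \<subseteq> \<Omega>" using eH by blast
        then show ?thesis using W card_Suc_Diff1[OF fin \<open>e \<in> W\<close>] by auto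
      next
        case False
        then show ?thesis using fg(2) by (auto simp: fun_level_def)
      qed
      then show "v \<in> ?A (insert e H) k" by (auto simp: fun_level_def)
    qed
    show ?case
    proof (rule fun_space.modular_exact_branch[where \<iota> = "lift_set e" and \<theta> = "\<lambda>_. 1" and Q = 1])
      show "module_hom fscale fscale (lift_set e :: _ \<Rightarrow> 'a set \<Rightarrow> 'f)"
        unfolding module_hom_iff
        by (auto simp: fun_space.module_axioms fun_eq_iff lift_set_def)
      show "?D (lift_set e g) = fscale 1 g + lift_set e (?D g)" if "g \<in> ?A H k" for k g
        using lower_lift_set[OF \<Omega> eH that] by (simp add: fun_eq_iff)
      show "f = 0 \<and> g = 0" if "f \<in> ?A H j" "g \<in> ?A H k" "f + lift_set e g = 0" for j k f g
      proof -
        have *: "f W + lift_set e g W = 0" for W using that(3) by (metis plus_fun_apply zero_fun_apply)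
        have f: "f W = 0" for W
          using *[of W] fun_levelD[OF that(1), of W] eH by (cases "e \<in> W") (auto simp: lift_set_def)
        have "g W = 0" for W
          using *[of "insert e W"] fun_levelD[OF that(2), of W] eH f
          by (cases "e \<in> W") (auto simp: lift_set_def)
        with f show ?thesis by auto
      qed
      show "modular_exact ?D d (?A H) (int (card (insert e H)) - 1)"
        using insert by simp
      show "?A (insert e H) k = {f + lift_set e g | f g. f \<in> ?A H k \<and> g \<in> ?A H (k - 1)}" for k
        by (rule B)
      show "?D v \<in> ?A H (k - 1)" if "v \<in> ?A H k" for k v
        using that by (rule lower_mem_fun_level)
    qed (use module_hom_lower subspace_fun_level gauss d in auto)
  qed
qed

no_notation fps_nth (infixl "$" 75)

section \<open>Subspaces of a finite vector space\<close>

definition add_line :: "'k::field ^ 'n \<Rightarrow> ('k ^ 'n) set \<Rightarrow> ('k ^ 'n) set" where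
  "add_line e Z = {z + c *s e | z c. z \<in> Z}"

lemma add_lineI: "z \<in> Z \<Longrightarrow> z + c *s e \<in> add_line e Z"
  by (auto simp: add_line_def)

lemma add_lineE: assumes "y \<in> add_line e Z" obtains z c where "y = z + c *s e" "z \<in> Z"
  using assms by (auto simp: add_line_def)

lemma add_line_eq_span:
  assumes "vec.subspace Z"
  shows "add_line e Z = vec.span (insert e Z)"
proof -
  have Z: "vec.span Z = Z" using assms by simp
  show ?thesis unfolding vec.span_insert Z
  proof (intro equalityI subsetI)
    fix x assume "x \<in> add_line e Z"
    then show "x \<in> {x. \<exists>k. x - k *s e \<in> Z}" by (metis (mono_tags, lifting) add_diff_cancel add_lineE mem_Collect_eq)
  next
    fix x assume "x \<in> {x. \<exists>k. x - k *s e \<in> Z}"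
    then obtain k where "x - k *s e \<in> Z" by blast
    from add_lineI[OF this, of k e] show "x \<in> add_line e Z" by simp
  qed
qed

lemma subspace_add_line: "vec.subspace Z \<Longrightarrow> vec.subspace (add_line e Z)"
  by (simp add: add_line_eq_span)

lemma subset_add_line: "Z \<subseteq> add_line e Z"
  using add_lineI[of _ Z 0 e] by auto

lemma mem_add_line: "vec.subspace Z \<Longrightarrow> e \<in> add_line e Z"
  using add_lineI[of 0 Z 1 e] by (auto simp: vec.subspace_0)

lemma add_line_subset: "vec.subspace S \<Longrightarrow> Z \<subseteq> S \<Longrightarrow> e \<in> S \<Longrightarrow> add_line e Z \<subseteq> S"
  by (auto simp: add_line_def intro!: vec.subspace_add vec.subspace_scale)

lemma dim_add_line:
  assumes "vec.subspace Z" "e \<notin> Z"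
  shows "vec.dim (add_line e Z) = Suc (vec.dim Z)"
proof -
  have "e \<notin> vec.span Z" using assms by (metis vec.span_eq_iff)
  then show ?thesis unfolding add_line_eq_span[OF assms(1)] vec.dim_span vec.dim_insert by simp
qed

lemma add_line_eqI:
  assumes "vec.subspace Z" "vec.subspace W" "Z \<subseteq> W" "e \<in> W" "e \<notin> Z" "vec.dim W = Suc (vec.dim Z)"
  shows "add_line e Z = W"
  using assms by (intro vec.subspace_dim_equal) (auto simp: subspace_add_line add_line_subset dim_add_line)

lemma card_add_line:
  fixes Z :: "('k::{field,finite} ^ 'n) set"
  assumes "vec.subspace Z" "e \<notin> Z"
  shows "card (add_line e Z) = CARD('k) * card Z"
proof -
  have "inj_on (\<lambda>(z, c). z + c *s e) (Z \<times> (UNIV :: 'k set))"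
  proof (rule inj_onI, clarify)
    fix z c z' c' assume z: "z \<in> Z" "z' \<in> Z" and eq: "z + c *s e = z' + c' *s e"
    have "(c - c') *s e = z' - z" using eq by (simp add: vec.scale_left_diff_distrib algebra_simps)
    moreover have "z' - z \<in> Z" using z assms(1) by (simp add: vec.subspace_diff)
    ultimately have m: "(c - c') *s e \<in> Z" by simp
    have "c = c'"
    proof (rule ccontr)
      assume "c \<noteq> c'"
      then have "e = inverse (c - c') *s ((c - c') *s e)" by (simp add: vector_smult_assoc)
      then show False using vec.subspace_scale[OF assms(1) m] assms(2) by metis
    qed
    then show "z = z' \<and> c = c'" using eq by simp
  qed
  moreover have "add_line e Z = (\<lambda>(z, c). z + c *s e) ` (Z \<times> UNIV)" by (auto simp: add_line_def)
  ultimately show ?thesis by (simp add: card_image card_cartesian_product mult.commute)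
qed

lemma card_subspace:
  fixes W :: "('k::{field,finite} ^ 'n) set"
  assumes "vec.subspace W"
  shows "card W = CARD('k) ^ vec.dim W"
proof -
  have "vec.independent B \<Longrightarrow> card (vec.span B) = CARD('k) ^ card B" if "finite B" for B :: "('k ^ 'n) set"
    using that
  proof (induction B rule: finite_induct)
    case (insert b B)
    then have B: "vec.independent B" "b \<notin> vec.span B" by (auto simp: vec.independent_insert)
    have "vec.span (insert b B) = add_line b (vec.span B)"
      unfolding add_line_eq_span[OF vec.subspace_span] vec.span_insert vec.span_span ..
    then show ?case using B insert card_add_line[OF vec.subspace_span B(2)] by simp
  qed simp
  moreover obtain B where B: "B \<subseteq> W" "vec.independent B" "W \<subseteq> vec.span B" "card B = vec.dim W"
    using vec.basis_exists by blast
  moreover have "vec.span B = W" using B assms by (metis vec.span_subspace)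
  ultimately show ?thesis by (metis vec.finiteI_independent)
qed

section \<open>Hyperplane sections and the number of covers off a hyperplane\<close>

definition coord_hyperplane :: "'n \<Rightarrow> ('k::field ^ 'n) set" where
  "coord_hyperplane i = {x. x $ i = 0}"

lemma mem_coord_hyperplane: "x \<in> coord_hyperplane i \<longleftrightarrow> x $ i = 0"
  by (simp add: coord_hyperplane_def)

lemma subspace_coord_hyperplane: "vec.subspace (coord_hyperplane i)"
  by (auto simp: coord_hyperplane_def vec.subspace_def)

lemma subspace_Int_hyperplane: "vec.subspace W \<Longrightarrow> vec.subspace (W \<inter> coord_hyperplane i)"
  by (intro vec.subspace_inter subspace_coord_hyperplane)

lemma add_line_Int_hyperplane:
  assumes "Z \<subseteq> coord_hyperplane i" "e $ i = 1"
  shows "add_line e Z \<inter> coord_hyperplane i = Z"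
proof
  show "add_line e Z \<inter> coord_hyperplane i \<subseteq> Z"
    using assms by (auto simp: add_line_def mem_coord_hyperplane)
qed (use assms subset_add_line in auto)

lemma add_line_of_Int_hyperplane:
  assumes "vec.subspace W" "e \<in> W" "e $ i = 1"
  shows "add_line e (W \<inter> coord_hyperplane i) = W"
proof
  show "add_line e (W \<inter> coord_hyperplane i) \<subseteq> W" using assms by (intro add_line_subset) auto
  show "W \<subseteq> add_line e (W \<inter> coord_hyperplane i)"
  proof
    fix x assume x: "x \<in> W"
    have "x - (x $ i) *s e \<in> W \<inter> coord_hyperplane i"
      using assms x by (auto simp: mem_coord_hyperplane intro!: vec.subspace_diff vec.subspace_scale)
    from add_lineI[OF this, of "x $ i" e] show "x \<in> add_line e (W \<inter> coord_hyperplane i)" by simp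
  qed
qed

lemma normalized_vector:
  assumes "vec.subspace W" "\<not> W \<subseteq> coord_hyperplane i"
  obtains e where "e \<in> W" "e $ i = 1"
proof -
  from assms obtain x where x: "x \<in> W" "x $ i \<noteq> 0" by (auto simp: coord_hyperplane_def)
  then have "inverse (x $ i) *s x \<in> W" "(inverse (x $ i) *s x) $ i = 1"
    using assms by (auto intro!: vec.subspace_scale)
  then show ?thesis using that by blast
qed

lemma dim_Int_hyperplane:
  assumes "vec.subspace W" "\<not> W \<subseteq> coord_hyperplane i"
  shows "vec.dim W = Suc (vec.dim (W \<inter> coord_hyperplane i))"
proof -
  obtain e where e: "e \<in> W" "e $ i = 1" using normalized_vector[OF assms] .
  then have "e \<notin> W \<inter> coord_hyperplane i" by (simp add: mem_coord_hyperplane)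
  from dim_add_line[OF subspace_Int_hyperplane[OF assms(1)] this]
  show ?thesis using add_line_of_Int_hyperplane[OF assms(1) e] by simp
qed

lemma card_affine_slice:
  fixes W :: "('k::{field,finite} ^ 'n) set"
  assumes "vec.subspace W" "\<not> W \<subseteq> coord_hyperplane i"
  shows "card {x \<in> W. x $ i = 1} = card (W \<inter> coord_hyperplane i)"
proof -
  obtain e where e: "e \<in> W" "e $ i = 1" using normalized_vector[OF assms] .
  have "bij_betw (\<lambda>x. x + e) (W \<inter> coord_hyperplane i) {x \<in> W. x $ i = 1}"
  proof (rule bij_betw_byWitness[where f' = "\<lambda>x. x - e"])
  qed (use e assms(1) in \<open>auto simp: mem_coord_hyperplane vec.subspace_add vec.subspace_diff\<close>)
  then show ?thesis by (simp add: bij_betw_same_card)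
qed

text \<open>Each such \<open>W\<close> equals \<open>add_line x Y\<close> for every \<open>x\<close>
  in its affine slice \<open>x $ i = 1\<close>. So these slices partition the slice of
  \<open>S\<close>; each has \<open>CARD('k) ^ vec.dim Y\<close> points and their union has as many
  points as \<open>S \<inter> coord_hyperplane i\<close>.\<close>

lemma card_covers_off_hyperplane:
  fixes S Y :: "('k::{field,finite} ^ 'n) set"
  assumes S: "vec.subspace S" "\<not> S \<subseteq> coord_hyperplane i"
    and Y: "vec.subspace Y" "Y \<subseteq> S \<inter> coord_hyperplane i"
  shows "card {W. vec.subspace W \<and> Y \<subseteq> W \<and> vec.dim W = Suc (vec.dim Y) \<and> W \<subseteq> S \<and>
      \<not> W \<subseteq> coord_hyperplane i}
    = CARD('k) ^ (vec.dim (S \<inter> coord_hyperplane i) - vec.dim Y)" (is "card ?M = _")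
proof -
  have Wext: "W = add_line x Y" "W \<inter> coord_hyperplane i = Y" if "W \<in> ?M" "x \<in> W" "x $ i = 1" for W x
  proof -
    have "x \<notin> Y" using that Y by (auto simp: coord_hyperplane_def)
    then show "W = add_line x Y" using that Y add_line_eqI[of Y W x] by simp
    then show "W \<inter> coord_hyperplane i = Y" using that Y add_line_Int_hyperplane[of Y i x] by simp
  qed
  have slice: "card {x \<in> W. x $ i = 1} = CARD('k) ^ vec.dim Y" if W: "W \<in> ?M" for W
  proof -
    obtain x where x: "x \<in> W" "x $ i = 1" using W normalized_vector[of W i] by auto
    have "card {x \<in> W. x $ i = 1} = card Y"
      using card_affine_slice[of W i] W Wext(2)[OF W x] by simp
    then show ?thesis using card_subspace[OF Y(1)] by simp
  qed
  have un: "{x \<in> S. x $ i = 1} = (\<Union>W\<in>?M. {x \<in> W. x $ i = 1})"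
  proof (intro equalityI subsetI)
    fix x assume x: "x \<in> {x \<in> S. x $ i = 1}"
    then have "x \<notin> Y" using Y by (auto simp: coord_hyperplane_def)
    have "Y \<subseteq> S" using Y by blast
    then have "add_line x Y \<subseteq> S" using x S by (intro add_line_subset) auto
    moreover have "\<not> add_line x Y \<subseteq> coord_hyperplane i"
      using mem_add_line[OF Y(1), of x] x by (auto simp: mem_coord_hyperplane)
    ultimately have "add_line x Y \<in> ?M"
      using subspace_add_line[OF Y(1)] dim_add_line[OF Y(1) \<open>x \<notin> Y\<close>] subset_add_line by blast
    then show "x \<in> (\<Union>W\<in>?M. {x \<in> W. x $ i = 1})" using x mem_add_line[OF Y(1), of x] by blast
  qed blast
  have "card {x \<in> S. x $ i = 1} = (\<Sum>W\<in>?M. card {x \<in> W. x $ i = 1})"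
    unfolding un
  proof (rule card_UN_disjoint)
    show "\<forall>W\<in>?M. \<forall>W'\<in>?M. W \<noteq> W' \<longrightarrow> {x \<in> W. x $ i = 1} \<inter> {x \<in> W'. x $ i = 1} = {}"
      using Wext(1) by blast
  qed auto
  also have "\<dots> = card ?M * CARD('k) ^ vec.dim Y" using slice by simp
  finally have eq: "card ?M * CARD('k) ^ vec.dim Y = CARD('k) ^ vec.dim (S \<inter> coord_hyperplane i)"
    using card_affine_slice[OF S] card_subspace[OF subspace_Int_hyperplane[OF S(1)]] by simp
  have le: "vec.dim Y \<le> vec.dim (S \<inter> coord_hyperplane i)" using Y(2) by (rule vec.dim_subset)
  have "CARD('k) ^ vec.dim (S \<inter> coord_hyperplane i)
      = CARD('k) ^ (vec.dim (S \<inter> coord_hyperplane i) - vec.dim Y) * CARD('k) ^ vec.dim Y"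
    unfolding power_add[symmetric] using le by simp
  with eq show ?thesis by simp
qed

text \<open>For \<open>e \<in> S\<close> outside the hyperplane \<open>H\<close> of \<open>S\<close>, the map \<open>lift_sub\<close> sends the basis vector of \<open>Z \<subseteq> H\<close> to the
  sum of all its extensions \<open>Z + \<langle>e + h\<rangle>\<close>, \<open>h \<in> H\<close>.\<close>

definition lift_sub :: "'n \<Rightarrow> ('k::field ^ 'n) set \<Rightarrow> (('k ^ 'n) set \<Rightarrow> 'f::field) \<Rightarrow> ('k ^ 'n) set \<Rightarrow> 'f" where
  "lift_sub i S g W = (if vec.subspace W \<and> W \<subseteq> S \<and> \<not> W \<subseteq> coord_hyperplane i
     then g (W \<inter> coord_hyperplane i) else 0)"

abbreviation lower_sub :: "(('k::field ^ 'n) set \<Rightarrow> 'f::field) \<Rightarrow> ('k ^ 'n) set \<Rightarrow> 'f" where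
  "lower_sub \<equiv> lower {W. vec.subspace W} (\<lambda>W. int (vec.dim W))"

abbreviation sub_level :: "('k::field ^ 'n) set \<Rightarrow> int \<Rightarrow> (('k ^ 'n) set \<Rightarrow> 'f::field) set" where
  "sub_level \<equiv> fun_level {W. vec.subspace W} (\<lambda>W. int (vec.dim W))"

text \<open>At \<open>Y\<close> off the hyperplane, intersecting with it matches the covers of
  \<open>Y\<close> in \<open>S\<close> with the covers of its trace. At \<open>Y\<close> inside the
  hyperplane, the covers off it all have trace \<open>Y\<close>, and counting them gives
  \<open>\<theta>\<close>. The exponent is an integer power because branching needs
  \<open>\<theta>\<close> nonzero and geometric in every degree.\<close>

lemma lower_lift_sub:
  fixes g :: "('k::{field,finite} ^ 'n) set \<Rightarrow> 'f::field"
  assumes S: "vec.subspace S" "\<not> S \<subseteq> coord_hyperplane i"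
    and g: "g \<in> sub_level (S \<inter> coord_hyperplane i) k"
  shows "lower_sub (lift_sub i S g) =
    fscale (of_nat CARD('k) powi (int (vec.dim (S \<inter> coord_hyperplane i)) - k)) g + lift_sub i S (lower_sub g)"
    (is "_ = fscale ?\<theta> g + _")
proof
  fix Y :: "('k ^ 'n) set"
  let ?P = "coord_hyperplane i :: ('k ^ 'n) set"
  let ?C = "{W. vec.subspace W \<and> Y \<subseteq> W \<and> int (vec.dim W) = int (vec.dim Y) + 1}"
  consider "\<not> (vec.subspace Y \<and> Y \<subseteq> S)" | "vec.subspace Y" "Y \<subseteq> S" "\<not> Y \<subseteq> ?P"
    | "vec.subspace Y" "Y \<subseteq> S" "Y \<subseteq> ?P" by blast
  then show "lower_sub (lift_sub i S g) Y = (fscale ?\<theta> g + lift_sub i S (lower_sub g)) Y"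
  proof cases
    case 1
    then have "g Y = 0" using fun_levelD[OF g, of Y] by auto
    moreover have "lower_sub (lift_sub i S g) Y = 0"
    proof (cases "vec.subspace Y")
      case True
      then have "lift_sub i S g W = 0" if "Y \<subseteq> W" for W using 1 that by (auto simp: lift_sub_def)
      then show ?thesis by (simp add: lower_def)
    qed (simp add: lower_def)
    ultimately show ?thesis using 1 by (auto simp: lift_sub_def)
  next
    case 2
    obtain e where e: "e \<in> Y" "e $ i = 1" using normalized_vector[OF 2(1,3)] .
    let ?C' = "{Z. vec.subspace Z \<and> Y \<inter> ?P \<subseteq> Z \<and> int (vec.dim Z) = int (vec.dim (Y \<inter> ?P)) + 1}"
    have dY: "vec.dim Y = Suc (vec.dim (Y \<inter> ?P))" using dim_Int_hyperplane[OF 2(1,3)] .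
    have eZ: "e \<notin> Z" if "Z \<subseteq> ?P" for Z using e that by (auto simp: coord_hyperplane_def)
    have "lower_sub (lift_sub i S g) Y = (\<Sum>W\<in>?C. lift_sub i S g W)" using 2 by (simp add: lower_def)
    also have "\<dots> = (\<Sum>W\<in>{W \<in> ?C. W \<subseteq> S}. g (W \<inter> ?P))"
      using 2 by (intro sum.mono_neutral_cong_right) (auto simp: lift_sub_def)
    also have "\<dots> = (\<Sum>Z\<in>{Z \<in> ?C'. Z \<subseteq> S \<inter> ?P}. g Z)"
    proof (rule sum.reindex_bij_witness[of _ "add_line e" "\<lambda>W. W \<inter> ?P"])
      fix W assume W: "W \<in> {W \<in> ?C. W \<subseteq> S}"
      then have "e \<in> W" using e by blast
      then show "add_line e (W \<inter> ?P) = W" using W e by (intro add_line_of_Int_hyperplane) auto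
      have "\<not> W \<subseteq> ?P" using W 2 by blast
      then show "W \<inter> ?P \<in> {Z \<in> ?C'. Z \<subseteq> S \<inter> ?P}"
        using W dim_Int_hyperplane[of W i] dY by (auto simp: subspace_Int_hyperplane)
    next
      fix Z assume Z: "Z \<in> {Z \<in> ?C'. Z \<subseteq> S \<inter> ?P}"
      then show "add_line e Z \<inter> ?P = Z" using e by (intro add_line_Int_hyperplane) auto
      have "Y = add_line e (Y \<inter> ?P)" using add_line_of_Int_hyperplane[OF 2(1) e] by simp
      also have "\<dots> \<subseteq> add_line e Z" using Z by (auto simp: add_line_def)
      finally have "Y \<subseteq> add_line e Z" .
      moreover have "add_line e Z \<subseteq> S" using Z e 2 S by (intro add_line_subset) auto
      ultimately show "add_line e Z \<in> {W \<in> ?C. W \<subseteq> S}"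
        using Z dim_add_line[of Z e] eZ[of Z] dY by (auto simp: subspace_add_line)
    qed auto
    also have "\<dots> = lower_sub g (Y \<inter> ?P)"
      unfolding lower_def using subspace_Int_hyperplane[OF 2(1), of i] fun_levelD[OF g]
      by (simp, intro sum.mono_neutral_left) auto
    finally show ?thesis using 2 fun_levelD[OF g, of Y] by (simp add: lift_sub_def)
  next
    case 3
    let ?M = "{W. vec.subspace W \<and> Y \<subseteq> W \<and> vec.dim W = Suc (vec.dim Y) \<and> W \<subseteq> S \<and> \<not> W \<subseteq> ?P}"
    have "lower_sub (lift_sub i S g) Y = (\<Sum>W\<in>?C. lift_sub i S g W)" using 3 by (simp add: lower_def)
    also have "\<dots> = (\<Sum>W\<in>?M. g Y)"
    proof (intro sum.mono_neutral_cong_right ballI)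
      fix W assume W: "W \<in> ?M"
      then have "vec.dim (W \<inter> ?P) = vec.dim Y" using dim_Int_hyperplane[of W i] by simp
      then have "Y = W \<inter> ?P"
        using W 3 by (intro vec.subspace_dim_equal) (auto simp: subspace_Int_hyperplane)
      then show "lift_sub i S g W = g Y" using W by (simp add: lift_sub_def)
    qed (auto simp: lift_sub_def)
    also have "\<dots> = of_nat (card ?M) * g Y" by simp
    also have "\<dots> = ?\<theta> * g Y"
    proof (cases "g Y = 0")
      case False
      then have k: "int (vec.dim Y) = k" using fun_levelD[OF g, of Y] by blast
      have "vec.dim Y \<le> vec.dim (S \<inter> ?P)" using 3 by (intro vec.dim_subset) auto
      then have "?\<theta> = of_nat (CARD('k) ^ (vec.dim (S \<inter> ?P) - vec.dim Y))"
        unfolding k[symmetric] by (simp add: of_nat_diff[symmetric] del: of_nat_diff)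
      then show ?thesis using card_covers_off_hyperplane[OF S 3(1)] 3 by simp
    qed simp
    finally show ?thesis using 3 by (simp add: lift_sub_def)
  qed
qed

lemma card_field_gt_1: "1 < CARD('k::{field,finite})"
proof -
  have "card {0, 1 :: 'k} \<le> CARD('k)" by (rule card_mono) auto
  then show ?thesis by simp
qed

text \<open>Over a finite field the cardinality of a subspace determines its dimension; counting
  points thus also covers semilinear maps.\<close>

lemma dim_inj_image:
  fixes f :: "'k::{field,finite} ^ 'n \<Rightarrow> 'k ^ 'n"
  assumes "inj_on f W" "vec.subspace W" "vec.subspace (f ` W)"
  shows "vec.dim (f ` W) = vec.dim W"
proof -
  have "CARD('k) ^ vec.dim (f ` W) = CARD('k) ^ vec.dim W"
    using card_image[OF assms(1)] card_subspace[OF assms(2)] card_subspace[OF assms(3)] by simp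
  then show ?thesis using card_field_gt_1[where 'k = 'k] by (simp add: power_inject_exp)
qed

section \<open>Transvections with a fixed axis\<close>

text \<open>For \<open>h $ i = 0\<close> these are the transvections whose axis is the coordinate
  hyperplane, and addition of such \<open>h\<close> becomes composition. Subspaces of the hyperplane
  therefore index commuting groups of transvections.\<close>

definition transvect :: "'n \<Rightarrow> 'k::field ^ 'n \<Rightarrow> 'k ^ 'n \<Rightarrow> 'k ^ 'n" where
  "transvect i h x = x + x $ i *s h"

lemma transvect_add: "h' $ i = 0 \<Longrightarrow> transvect i h (transvect i h' x) = transvect i (h + h') x"
  by (simp add: transvect_def vector_add_ldistrib algebra_simps)

lemma transvect_0 [simp]: "transvect i 0 = (\<lambda>x. x)"
  by (simp add: transvect_def fun_eq_iff)

lemma transvect_image_add: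
  "h $ i = 0 \<Longrightarrow> h' $ i = 0 \<Longrightarrow> transvect i h ` transvect i h' ` W = transvect i (h + h') ` W"
  by (simp add: image_image transvect_add)

lemma transvect_image_cancel: "h $ i = 0 \<Longrightarrow> transvect i (- h) ` transvect i h ` W = W"
  by (subst transvect_image_add) auto

lemma transvect_image_cancel': "h $ i = 0 \<Longrightarrow> transvect i h ` transvect i (- h) ` W = W"
  by (subst transvect_image_add) auto

lemma inj_transvect: "h $ i = 0 \<Longrightarrow> inj (transvect i h)"
  by (rule inj_on_inverseI[of _ "transvect i (- h)"]) (simp add: transvect_add)

lemma subspace_transvect_image: "vec.subspace W \<Longrightarrow> vec.subspace (transvect i h ` W)"
proof -
  assume W: "vec.subspace W"
  have "module_hom (*s) (*s) (transvect i h)"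
    unfolding module_hom_iff
    by (auto simp: transvect_def vec.module_axioms vector_add_ldistrib vector_sadd_rdistrib
        vector_smult_assoc algebra_simps)
  then show ?thesis by (rule module_hom.subspace_image[OF _ W])
qed

lemma subspace_transvect_image_iff:
  "h $ i = 0 \<Longrightarrow> vec.subspace (transvect i h ` W) \<longleftrightarrow> vec.subspace W"
  using subspace_transvect_image[of W i h] subspace_transvect_image[of "transvect i h ` W" i "- h"]
  by (auto simp: transvect_image_cancel)

lemma transvect_image_subset: "vec.subspace S \<Longrightarrow> h \<in> S \<Longrightarrow> W \<subseteq> S \<Longrightarrow> transvect i h ` W \<subseteq> S"
  by (auto simp: transvect_def vec.subspace_add vec.subspace_scale subset_iff)

lemma transvect_image_subset_iff:
  "vec.subspace S \<Longrightarrow> h \<in> S \<Longrightarrow> h $ i = 0 \<Longrightarrow> transvect i h ` W \<subseteq> S \<longleftrightarrow> W \<subseteq> S"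
  using transvect_image_subset[of S h W i] transvect_image_subset[of S "- h" "transvect i h ` W" i]
    transvect_image_cancel[of h i W] vec.subspace_neg[of S h] by metis

lemma transvect_image_mem: "vec.subspace W \<Longrightarrow> h \<in> W \<Longrightarrow> h $ i = 0 \<Longrightarrow> transvect i h ` W = W"
  using transvect_image_subset[of W h W i] transvect_image_subset[of W "- h" W i]
    transvect_image_cancel'[of h i W] vec.subspace_neg[of W h] image_mono[of "transvect i (- h) ` W" W "transvect i h"]
  by blast

lemma transvect_image_hyperplane: "W \<subseteq> coord_hyperplane i \<Longrightarrow> transvect i h ` W = W"
proof -
  assume "W \<subseteq> coord_hyperplane i"
  then have "transvect i h x = x" if "x \<in> W" for x
    using that by (auto simp: transvect_def coord_hyperplane_def)
  then show ?thesis by auto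
qed

lemma transvect_image_add_line:
  assumes "Z \<subseteq> coord_hyperplane i" "e $ i = 1"
  shows "transvect i h ` add_line e Z = add_line (e + h) Z"
proof -
  have "transvect i h (z + c *s e) = z + c *s (e + h)" if "z \<in> Z" for z c
    using assms that by (auto simp: transvect_def coord_hyperplane_def vector_add_ldistrib add.assoc)
  then show ?thesis by (force simp: add_line_def image_iff)
qed

definition tact :: "'n \<Rightarrow> 'k::field ^ 'n \<Rightarrow> (('k ^ 'n) set \<Rightarrow> 'f) \<Rightarrow> ('k ^ 'n) set \<Rightarrow> 'f" where
  "tact i h v = (\<lambda>W. v (transvect i h ` W))"

lemma tact_apply: "tact i h v W = v (transvect i h ` W)"
  by (simp add: tact_def)

lemma module_hom_tact: "module_hom fscale fscale (tact i h)"
  unfolding module_hom_iff by (auto simp: fun_space.module_axioms fun_eq_iff tact_def)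

lemma lower_tact:
  fixes v :: "('k::{field,finite} ^ 'n) set \<Rightarrow> 'f::field"
  assumes h: "h $ i = 0"
  shows "lower_sub (tact i h v) = tact i h (lower_sub v)"
proof
  fix Y :: "('k ^ 'n) set"
  show "lower_sub (tact i h v) Y = tact i h (lower_sub v) Y"
  proof (cases "vec.subspace Y")
    case True
    show ?thesis unfolding tact_def
    proof (rule lower_comp_automorphism)
      show "bij_betw ((`) (transvect i h)) {W. vec.subspace W} {W. vec.subspace W}"
        by (rule bij_betw_byWitness[where f' = "(`) (transvect i (- h))"])
          (auto simp: transvect_image_cancel transvect_image_cancel' subspace_transvect_image h)
    qed (use True h in \<open>auto simp: inj_image_subset_iff inj_transvect dim_inj_image
          inj_on_subset[OF inj_transvect] subspace_transvect_image\<close>)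
  next
    case False
    then show ?thesis using h by (simp add: lower_def tact_def subspace_transvect_image_iff)
  qed
qed

lemma lower_funpow_tact:
  fixes v :: "('k::{field,finite} ^ 'n) set \<Rightarrow> 'f::field"
  assumes h: "h $ i = 0"
  shows "(lower_sub ^^ j) (tact i h v) = tact i h ((lower_sub ^^ j) v)"
  by (induction j) (simp_all add: lower_tact[OF h])

lemma tact_mem_sub_level:
  fixes v :: "('k::{field,finite} ^ 'n) set \<Rightarrow> 'f::field"
  assumes "v \<in> sub_level S k" "vec.subspace S" "h \<in> S" "h $ i = 0"
  shows "tact i h v \<in> sub_level S k"
proof -
  have "vec.subspace W \<and> W \<subseteq> S \<and> int (vec.dim W) = k" if "tact i h v W \<noteq> 0" for W
  proof -
    have *: "vec.subspace (transvect i h ` W)" "transvect i h ` W \<subseteq> S" "int (vec.dim (transvect i h ` W)) = k"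
      using that assms(1) by (auto simp: tact_def fun_level_def)
    then have "vec.subspace W" using assms by (simp add: subspace_transvect_image_iff)
    then show ?thesis using * assms
        dim_inj_image[of "transvect i h" W, OF inj_on_subset[OF inj_transvect]]
      by (simp add: transvect_image_subset_iff)
  qed
  then show ?thesis by (auto simp: fun_level_def)
qed

definition avg :: "'n \<Rightarrow> 'k::{field,finite} ^ 'n \<Rightarrow> (('k ^ 'n) set \<Rightarrow> 'f::field) \<Rightarrow> ('k ^ 'n) set \<Rightarrow> 'f" where
  "avg i x v = fscale (inverse (of_nat CARD('k))) (\<Sum>c\<in>UNIV. tact i (c *s x) v)"

lemma avg_apply: "avg i x (v :: ('k::{field,finite} ^ 'n) set \<Rightarrow> 'f::field) W =
    inverse (of_nat CARD('k)) * (\<Sum>c\<in>UNIV. v (transvect i (c *s x) ` W))"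
  by (simp add: avg_def tact_def sum_fun_apply)

lemma avg_mem:
  assumes "fun_space.subspace R" "\<And>v h. v \<in> R \<Longrightarrow> h \<in> H \<Longrightarrow> tact i h v \<in> R"
    and "vec.subspace H" "x \<in> H" "v \<in> R"
  shows "avg i x v \<in> R"
  unfolding avg_def using assms
  by (intro fun_space.subspace_scale fun_space.subspace_sum) (auto intro: vec.subspace_scale)

text \<open>Shifting the summation variable gives invariance along \<open>x\<close>; invariance
  under \<open>T\<close> survives because transvections with the same axis commute.\<close>

lemma avg_invariant:
  fixes v :: "('k::{field,finite} ^ 'n) set \<Rightarrow> 'f::field"
  assumes T: "T \<subseteq> coord_hyperplane i" and x: "x $ i = 0"
    and v: "\<And>h. h \<in> T \<Longrightarrow> tact i h v = v" and h: "h \<in> add_line x T"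
  shows "tact i h (avg i x v) = avg i x v"
proof
  fix W
  obtain t c where h: "h = t + c *s x" "t \<in> T" using h by (rule add_lineE)
  have t: "t $ i = 0" using h T by (auto simp: coord_hyperplane_def)
  have "v (transvect i (d *s x) ` transvect i h ` W) = v (transvect i ((d + c) *s x) ` W)" for d
  proof -
    have "transvect i (d *s x) ` transvect i h ` W = transvect i (d *s x + h) ` W"
      using h t x by (intro transvect_image_add) auto
    also have "d *s x + h = t + (d + c) *s x"
      using h by (simp add: vector_sadd_rdistrib algebra_simps)
    also have "transvect i (t + (d + c) *s x) ` W = transvect i t ` transvect i ((d + c) *s x) ` W"
      using h t x by (intro transvect_image_add[symmetric]) auto
    finally show ?thesis using v[OF h(2)] by (metis tact_apply)
  qed
  then have "tact i h (avg i x v) W = inverse (of_nat CARD('k)) * (\<Sum>d\<in>UNIV. v (transvect i ((d + c) *s x) ` W))"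
    by (simp add: tact_apply avg_apply)
  also have "(\<Sum>d\<in>UNIV. v (transvect i ((d + c) *s x) ` W)) = (\<Sum>d\<in>UNIV. v (transvect i (d *s x) ` W))"
    by (rule sum.reindex_bij_witness[of _ "\<lambda>d. d - c" "\<lambda>d. d + c"]) auto
  also have "inverse (of_nat CARD('k)) * \<dots> = avg i x v W" by (rule avg_apply[symmetric])
  finally show "tact i h (avg i x v) W = avg i x v W" .
qed

lemma avg_of_invariant:
  fixes v :: "('k::{field,finite} ^ 'n) set \<Rightarrow> 'f::field"
  assumes "\<And>c. tact i (c *s x) v = v" and "of_nat CARD('k) \<noteq> (0::'f)"
  shows "avg i x v = v"
  using assms by (simp add: avg_def fun_eq_iff sum_fun_apply)

lemma avg_invariant_base:
  fixes v :: "('k::{field,finite} ^ 'n) set \<Rightarrow> 'f::field"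
  assumes T: "T \<subseteq> coord_hyperplane i" and x: "x $ i = 0"
    and v: "\<And>h. h \<in> T \<Longrightarrow> tact i h v = v" and h: "h \<in> T"
  shows "tact i h (avg i x v) = avg i x v"
  using avg_invariant[OF T x v] subset_add_line[of T x] h by blast

text \<open>In the group ring of a plane \<open>\<langle>a, b\<rangle>\<close> over \<open>GF(q)\<close>, the averages over the \<open>q + 1\<close> lines sum up to
  the identity plus \<open>q\<close> times the average over the plane.\<close>

lemma avg_plane_identity:
  fixes v :: "('k::{field,finite} ^ 'n) set \<Rightarrow> 'f::field"
  assumes a: "a $ i = 0" and b: "b $ i = 0" and q: "of_nat CARD('k) \<noteq> (0::'f)"
  shows "v = (\<Sum>c\<in>UNIV. avg i (a + c *s b) v) + avg i b v - fscale (of_nat CARD('k)) (avg i a (avg i b v))"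
proof
  fix W
  let ?q = "of_nat CARD('k) :: 'f"
  define F where "F h = v (transvect i h ` W)" for h
  have 1: "avg i x v W = inverse ?q * (\<Sum>d\<in>UNIV. F (d *s x))" for x
    by (simp add: avg_apply F_def)
  have 2: "avg i a (avg i b v) W = inverse ?q * (inverse ?q * (\<Sum>d\<in>UNIV. \<Sum>e\<in>UNIV. F (d *s a + e *s b)))"
    using a b by (simp add: avg_apply F_def transvect_image_add sum_distrib_left add.commute)
  \<comment> \<open>For \<open>d \<noteq> 0\<close> the substitution \<open>e = d * c\<close> lets
    the lines through \<open>a + c *s b\<close> sweep out the row of \<open>d *s a\<close> exactly
    once. The row \<open>d = 0\<close> collapses to \<open>CARD('k)\<close> copies of
    \<open>F 0\<close>, and the line through \<open>b\<close> supplies that missing row.\<close>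
  have "(\<Sum>c\<in>UNIV. \<Sum>d\<in>UNIV. F (d *s (a + c *s b)))
      = (\<Sum>d\<in>UNIV. \<Sum>c\<in>UNIV. F (d *s a + (d * c) *s b))"
    by (subst sum.swap) (simp add: vector_add_ldistrib vector_smult_assoc)
  also have "\<dots> = (\<Sum>c\<in>UNIV. F (0 *s a + (0 * c) *s b))
      + (\<Sum>d\<in>UNIV - {0}. \<Sum>c\<in>UNIV. F (d *s a + (d * c) *s b))"
    by (subst sum.remove[of UNIV "0::'k"]) auto
  also have "(\<Sum>c\<in>(UNIV::'k set). F (0 *s a + (0 * c) *s b)) = ?q * F 0" by simp
  also have "(\<Sum>d\<in>UNIV - {0}. \<Sum>c\<in>UNIV. F (d *s a + (d * c) *s b))
      = (\<Sum>d\<in>UNIV - {0}. \<Sum>e\<in>UNIV. F (d *s a + e *s b))"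
  proof (rule sum.cong[OF refl])
    fix d :: 'k assume d: "d \<in> UNIV - {0}"
    show "(\<Sum>c\<in>UNIV. F (d *s a + (d * c) *s b)) = (\<Sum>e\<in>UNIV. F (d *s a + e *s b))"
      by (rule sum.reindex_bij_witness[of _ "\<lambda>e. e / d" "\<lambda>c. d * c"]) (use d in auto)
  qed
  also have "?q * F 0 + \<dots> + (\<Sum>e\<in>UNIV. F (e *s b)) = ?q * F 0 + (\<Sum>d\<in>UNIV. \<Sum>e\<in>UNIV. F (d *s a + e *s b))"
    by (subst (2) sum.remove[of UNIV "0::'k"]) (auto simp: add_ac)
  finally have 3: "(\<Sum>c\<in>UNIV. \<Sum>d\<in>UNIV. F (d *s (a + c *s b))) + (\<Sum>e\<in>UNIV. F (e *s b))
      = ?q * F 0 + (\<Sum>d\<in>UNIV. \<Sum>e\<in>UNIV. F (d *s a + e *s b))" by simp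
  have "((\<Sum>c\<in>UNIV. avg i (a + c *s b) v) + avg i b v - fscale ?q (avg i a (avg i b v))) W
     = inverse ?q * ((\<Sum>c\<in>UNIV. \<Sum>d\<in>UNIV. F (d *s (a + c *s b))) + (\<Sum>e\<in>UNIV. F (e *s b)))
       - ?q * (inverse ?q * (inverse ?q * (\<Sum>d\<in>UNIV. \<Sum>e\<in>UNIV. F (d *s a + e *s b))))"
    by (simp add: sum_fun_apply 1 2 sum_distrib_left distrib_left)
  also have "\<dots> = F 0" unfolding 3 using q by (simp add: field_simps)
  finally show "v W = ((\<Sum>c\<in>UNIV. avg i (a + c *s b) v) + avg i b v - fscale ?q (avg i a (avg i b v))) W"
    by (simp add: F_def)
qed

text \<open>Averaging over the transvections with axis \<open>H\<close> is possible since \<open>q\<close> is invertible.  The plane identity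
  reduces a \<open>T\<close>-invariant vector to vectors invariant under larger subgroups, down to subgroups of
  codimension at most one.  This replaces the decomposition into characters of \<open>H\<close>, which need
  not have their values in \<open>'f\<close>.\<close>

lemma transvection_induct:
  fixes R P :: "(('k::{field,finite} ^ 'n) set \<Rightarrow> 'f::field) set"
  assumes q: "of_nat CARD('k) \<noteq> (0::'f)"
    and H: "vec.subspace H" "H \<subseteq> coord_hyperplane i"
    and R: "fun_space.subspace R" "\<And>v h. v \<in> R \<Longrightarrow> h \<in> H \<Longrightarrow> tact i h v \<in> R"
    and P: "fun_space.subspace P"
    and inv: "\<And>v. v \<in> R \<Longrightarrow> (\<And>h. h \<in> H \<Longrightarrow> tact i h v = v) \<Longrightarrow> v \<in> P"
    and pencil: "\<And>K x v. vec.subspace K \<Longrightarrow> K \<subseteq> H \<Longrightarrow> vec.dim H = Suc (vec.dim K) \<Longrightarrow> x \<in> H \<Longrightarrow>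
      x \<notin> K \<Longrightarrow> v \<in> R \<Longrightarrow> (\<And>h. h \<in> K \<Longrightarrow> tact i h v = v) \<Longrightarrow> avg i x v = 0 \<Longrightarrow> v \<in> P"
  shows "R \<subseteq> P"
proof -
  note subP = fun_space.subspace_add[OF P] fun_space.subspace_scale[OF P] fun_space.subspace_diff[OF P]
    fun_space.subspace_sum[OF P]
  have avgR: "avg i x v \<in> R" if "x \<in> H" "v \<in> R" for x v
    using R(1) R(2) H(1) that by (rule avg_mem)
  have hi: "h $ i = 0" if "h \<in> H" for h using that H by (auto simp: coord_hyperplane_def)
  \<comment> \<open>Generalised to all \<open>T\<close> so that the induction can run on the
    codimension of \<open>T\<close> in \<open>H\<close>; for \<open>T = {0}\<close> the invariance
    condition is vacuous.\<close>
  have "v \<in> P" if "vec.subspace T" "T \<subseteq> H" "v \<in> R" "\<And>h. h \<in> T \<Longrightarrow> tact i h v = v" for T v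
    using that
  proof (induction "vec.dim H - vec.dim T" arbitrary: T v rule: less_induct)
    case less
    note T = less.prems(1,2) and v = less.prems(3,4)
    have THi: "T \<subseteq> coord_hyperplane i" using T H by blast
    have le: "vec.dim T \<le> vec.dim H" using T by (intro vec.dim_subset)
    have ext_step: "add_line x T \<subseteq> H" "vec.dim (add_line x T) = Suc (vec.dim T)"
      "\<And>h. h \<in> add_line x T \<Longrightarrow> tact i h (avg i x w) = avg i x w"
      if "x \<in> H" "x \<notin> T" "\<And>h. h \<in> T \<Longrightarrow> tact i h w = w" for x and w :: "('k ^ 'n) set \<Rightarrow> 'f"
    proof -
      show "add_line x T \<subseteq> H" using that(1) H T by (intro add_line_subset)
      show "vec.dim (add_line x T) = Suc (vec.dim T)" using that T by (intro dim_add_line)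
      show "\<And>h. h \<in> add_line x T \<Longrightarrow> tact i h (avg i x w) = avg i x w"
        using avg_invariant[OF THi hi[OF that(1)] that(3)] .
    qed
    consider "T = H" | "vec.dim H = Suc (vec.dim T)" | "Suc (vec.dim T) < vec.dim H"
      using le vec.subspace_dim_equal[OF T(1) H(1) T(2)] by linarith
    then show ?case
    proof cases
      case 1
      then show ?thesis using inv v by blast
    next
      case 2
      then have "T \<noteq> H" by auto
      then obtain x where x: "x \<in> H" "x \<notin> T" using T by blast
      have e: "add_line x T = H" using add_line_eqI[OF T(1) H(1) T(2) x 2] .
      have av: "avg i x v \<in> P"
        using ext_step(3)[OF x v(2)] inv[OF avgR[OF x(1) v(1)]] unfolding e by blast
      have "c *s x \<in> H" for c using x H by (simp add: vec.subspace_scale)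
      then have idem: "avg i x (avg i x v) = avg i x v"
        using ext_step(3)[OF x v(2)] unfolding e by (intro avg_of_invariant q) blast
      \<comment> \<open>In codimension one, averaging along a complementary \<open>x\<close> splits
        \<open>v\<close> into an \<open>H\<close>-invariant part and a \<open>T\<close>-invariant
        part with zero average, which are the cases \<open>inv\<close> and
        \<open>pencil\<close>.\<close>
      have "v - avg i x v \<in> P"
      proof (rule pencil[OF T 2 x])
        show "v - avg i x v \<in> R" using avgR[OF x(1) v(1)] v R by (intro fun_space.subspace_diff)
        show "tact i h (v - avg i x v) = v - avg i x v" if "h \<in> T" for h
          using avg_invariant_base[OF THi hi[OF x(1)] v(2) that] v(2)[OF that]
          by (simp add: module_hom.diff[OF module_hom_tact])
        have "avg i x (v - avg i x v) = avg i x v - avg i x (avg i x v)"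
          by (simp add: avg_def module_hom.diff[OF module_hom_tact] sum_subtractf fun_space.scale_right_diff_distrib)
        then show "avg i x (v - avg i x v) = 0" using idem by simp
      qed
      from subP(1)[OF this av] show ?thesis by simp
    next
      case 3
      have "T \<noteq> H" using 3 by auto
      then obtain a where a: "a \<in> H" "a \<notin> T" using T by blast
      have "vec.dim (add_line a T) = Suc (vec.dim T)" by (rule dim_add_line[OF T(1) a(2)])
      then have "add_line a T \<noteq> H" using 3 by auto
      then obtain b where b: "b \<in> H" "b \<notin> add_line a T" using add_line_subset[OF H(1) T(2) a(1)] by blast
      have bT: "b \<notin> T" using b subset_add_line by blast
      have step: "avg i x w \<in> P" if "x \<in> H" "x \<notin> T" "w \<in> R" "\<And>h. h \<in> T \<Longrightarrow> tact i h w = w" for x w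
      proof (rule less.hyps)
        show "vec.dim H - vec.dim (add_line x T) < vec.dim H - vec.dim T"
          using ext_step(2)[OF that(1,2,4)] 3 by simp
        show "avg i x w \<in> R" by (rule avgR[OF that(1,3)])
      qed (use ext_step[OF that(1,2,4)] subspace_add_line T in auto)
      \<comment> \<open>Independence of \<open>a\<close> and \<open>b\<close> modulo
        \<open>T\<close> ensures that every average in the plane identity is invariant under a
        subspace strictly larger than \<open>T\<close>, so the induction hypothesis covers
        it.\<close>
      have ab: "a + c *s b \<in> H" "a + c *s b \<notin> T" for c
      proof -
        show "a + c *s b \<in> H" using a b H by (intro vec.subspace_add vec.subspace_scale)
        show "a + c *s b \<notin> T"
        proof
          assume m: "a + c *s b \<in> T"
          then have "c \<noteq> 0" using a by auto
          have "(a + c *s b) + (- 1) *s a = c *s b" by simp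
          then have "c *s b \<in> add_line a T" using add_lineI[OF m, of "- 1" a] by simp
          from vec.subspace_scale[OF subspace_add_line[OF T(1)] this, of "inverse c"]
          show False using b(2) \<open>c \<noteq> 0\<close> by (simp add: vector_smult_assoc)
        qed
      qed
      have "avg i b v \<in> R" using avgR b v by blast
      moreover have "tact i h (avg i b v) = avg i b v" if "h \<in> T" for h
        using avg_invariant_base[OF THi hi[OF b(1)] v(2) that] .
      ultimately have "avg i a (avg i b v) \<in> P" using step[OF a] by blast
      moreover have "(\<Sum>c\<in>UNIV. avg i (a + c *s b) v) \<in> P" using step[OF ab v] by (intro subP)
      moreover have "avg i b v \<in> P" using step[OF b(1) bT v] .
      ultimately have "(\<Sum>c\<in>UNIV. avg i (a + c *s b) v) + avg i b v
          - fscale (of_nat CARD('k)) (avg i a (avg i b v)) \<in> P"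
        using subP(1-3) by metis
      then show ?thesis using avg_plane_identity[OF hi[OF a(1)] hi[OF b(1)] q, of v] by simp
    qed
  qed
  from this[of "{0}"] show ?thesis
    using vec.subspace_0[OF H(1)] by (auto simp: tact_def)
qed

section \<open>Modular exactness for subspaces\<close>

lemma module_hom_lift_sub: "module_hom fscale fscale (lift_sub i S)"
  unfolding module_hom_iff by (auto simp: fun_space.module_axioms fun_eq_iff lift_sub_def)

text \<open>For two hyperplanes \<open>S, T\<close> through the same \<open>K\<close> the two lifts of \<open>K\<close> have the same error term in
  their commutator with \<open>lower\<close>, so the difference is a chain map.\<close>

definition pencil_lift :: "'n \<Rightarrow> ('k::field ^ 'n) set \<Rightarrow> ('k ^ 'n) set \<Rightarrow>
    (('k ^ 'n) set \<Rightarrow> 'f::field) \<Rightarrow> ('k ^ 'n) set \<Rightarrow> 'f" where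
  "pencil_lift i S T g = lift_sub i S g - lift_sub i T g"

lemma lift_sub_mem:
  assumes "g \<in> sub_level (S \<inter> coord_hyperplane i) (k - 1)"
  shows "lift_sub i S g \<in> sub_level S k"
proof -
  have "vec.subspace W \<and> W \<subseteq> S \<and> int (vec.dim W) = k" if "lift_sub i S g W \<noteq> 0" for W
  proof -
    from that have W: "vec.subspace W" "W \<subseteq> S" "\<not> W \<subseteq> coord_hyperplane i" "g (W \<inter> coord_hyperplane i) \<noteq> 0"
      by (auto simp: lift_sub_def split: if_splits)
    then show ?thesis using assms dim_Int_hyperplane[OF W(1,3)] by (auto simp: fun_level_def)
  qed
  then show ?thesis by (auto simp: fun_level_def)
qed

lemma sub_level_mono: "S \<subseteq> T \<Longrightarrow> v \<in> sub_level S k \<Longrightarrow> v \<in> sub_level T k"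
  by (auto simp: fun_level_def)

lemma lower_funpow_mem:
  "v \<in> fun_level L rk S k \<Longrightarrow> (lower L rk ^^ j) v \<in> fun_level L rk S (k - int j)"
  by (rule funpow_lower_mem[of "fun_level L rk S"]) (rule lower_mem_fun_level)

lemma lower_funpow_pencil_lift:
  fixes g :: "('k::{field,finite} ^ 'n) set \<Rightarrow> 'f::field"
  assumes K: "vec.subspace K" "K \<subseteq> coord_hyperplane i" and e: "e $ i = 1" "e' $ i = 1"
    and g: "g \<in> sub_level K k"
  shows "(lower_sub ^^ j) (pencil_lift i (add_line e K) (add_line e' K) g)
    = pencil_lift i (add_line e K) (add_line e' K) ((lower_sub ^^ j) g)"
proof (induction j)
  case (Suc j)
  let ?g = "(lower_sub ^^ j) g"
  have mem: "?g \<in> sub_level K (k - int j)" using lower_funpow_mem[OF g] .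
  have *: "lower_sub (lift_sub i (add_line a K) ?g) =
    fscale (of_nat CARD('k) powi (int (vec.dim K) - (k - int j))) ?g + lift_sub i (add_line a K) (lower_sub ?g)"
    if a: "a $ i = 1" for a
  proof -
    have "\<not> add_line a K \<subseteq> coord_hyperplane i"
      using mem_add_line[OF K(1), of a] a by (auto simp: coord_hyperplane_def)
    then show ?thesis
      using lower_lift_sub[OF subspace_add_line[OF K(1)], of a i ?g "k - int j"] mem add_line_Int_hyperplane[OF K(2) a]
      by simp
  qed
  show ?case
    using *[OF e(1)] *[OF e(2)] unfolding funpow.simps o_apply Suc unfolding pencil_lift_def
    by (simp add: module_hom.diff[OF module_hom_lower])
qed simp

text \<open>As \<open>x\<close> lies outside \<open>K\<close>, the value of \<open>a\<close> can be
  read off modulo \<open>K\<close> from the normalised vector of \<open>W\<close>. Hence, among the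
  members \<open>add_line (e + u *s x) K\<close> of the pencil, exactly one contains
  \<open>W\<close>, and the lifts do not interfere at \<open>W\<close>.\<close>

lemma lift_sub_pencil:
  fixes g :: "('k::field ^ 'n) set \<Rightarrow> 'f::field"
  assumes K: "vec.subspace K" "K \<subseteq> coord_hyperplane i" and e: "e $ i = 1"
    and x: "x $ i = 0" "x \<notin> K"
    and W: "vec.subspace W" "W \<inter> coord_hyperplane i \<subseteq> K" "e + a *s x + t \<in> W" and t: "t \<in> K"
  shows "lift_sub i (add_line (e + u *s x) K) g W = (if u = a then g (W \<inter> coord_hyperplane i) else 0)"
proof -
  let ?w = "e + a *s x + t"
  have t0: "t $ i = 0" using t K by (auto simp: coord_hyperplane_def)
  then have w: "?w $ i = 1" using e x by simp
  then have nW: "\<not> W \<subseteq> coord_hyperplane i" using W(3) by (auto simp: coord_hyperplane_def)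
  have "W \<subseteq> add_line (e + u *s x) K \<longleftrightarrow> u = a"
  proof
    assume "u = a"
    have "W = add_line ?w (W \<inter> coord_hyperplane i)" using add_line_of_Int_hyperplane[OF W(1,3) w] by simp
    also have "\<dots> \<subseteq> add_line (e + u *s x) K"
    proof (rule add_line_subset[OF subspace_add_line[OF K(1)]])
      show "?w \<in> add_line (e + u *s x) K"
        using add_lineI[OF t, of 1 "e + u *s x"] \<open>u = a\<close> by (simp add: algebra_simps)
    qed (use W subset_add_line in blast)
    finally show "W \<subseteq> add_line (e + u *s x) K" .
  next
    assume "W \<subseteq> add_line (e + u *s x) K"
    then obtain z c where z: "?w = z + c *s (e + u *s x)" "z \<in> K" using W(3) by (blast elim: add_lineE)
    have "z $ i = 0" using z K by (auto simp: coord_hyperplane_def)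
    then have "c = 1" using arg_cong[OF z(1), of "\<lambda>y. y $ i"] w e x by simp
    then have "(a - u) *s x = z - t" using z(1) by (simp add: vec.scale_left_diff_distrib algebra_simps)
    then have m: "(a - u) *s x \<in> K" using z t K by (simp add: vec.subspace_diff)
    show "u = a"
    proof (rule ccontr)
      assume "u \<noteq> a"
      then have "x = inverse (a - u) *s ((a - u) *s x)" by (simp add: vector_smult_assoc)
      then show False using vec.subspace_scale[OF K(1) m] x by metis
    qed
  qed
  then show ?thesis using W nW by (simp add: lift_sub_def)
qed

text \<open>Zero average kills \<open>v\<close> at every \<open>W\<close> whose orbit along
  \<open>x\<close> carries a constant value: this happens inside the hyperplane, and also when the
  trace of \<open>W\<close> is not contained in \<open>K\<close>. At the remaining \<open>W\<close>,
  invariance under \<open>K\<close> leaves dependence only on the pencil member \<open>u\<close> and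
  the trace, which is \<open>g u\<close>. Zero average then says that the \<open>g u\<close> sum to
  0; eliminating \<open>g 0\<close> turns the sum of lifts into a sum of differences of
  lifts.\<close>

lemma pencil_decomposition:
  fixes v :: "('k::{field,finite} ^ 'n) set \<Rightarrow> 'f::field"
  assumes q: "of_nat CARD('k) \<noteq> (0::'f)"
    and S: "vec.subspace S" "e \<in> S" "e $ i = 1"
    and K: "vec.subspace K" "K \<subseteq> S \<inter> coord_hyperplane i"
      "vec.dim (S \<inter> coord_hyperplane i) = Suc (vec.dim K)"
    and x: "x \<in> S \<inter> coord_hyperplane i" "x \<notin> K"
    and v: "v \<in> sub_level S k" "\<And>h. h \<in> K \<Longrightarrow> tact i h v = v" "avg i x v = 0"
  obtains g where "\<And>u. g u \<in> sub_level K (k - 1)"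
    and "v = (\<Sum>u\<in>UNIV - {0}. pencil_lift i (add_line (e + u *s x) K) (add_line e K) (g u))"
proof -
  let ?P = "coord_hyperplane i :: ('k ^ 'n) set"
  define g where "g u Z = (if vec.subspace Z \<and> Z \<subseteq> K then v (add_line (e + u *s x) Z) else 0)" for u Z
  have KP: "K \<subseteq> ?P" using K by blast
  have xi: "x $ i = 0" using x by (auto simp: coord_hyperplane_def)
  have eu: "(e + u *s x) $ i = 1" for u using S xi by simp
  have H: "add_line x K = S \<inter> ?P"
    using add_line_eqI[OF K(1) subspace_Int_hyperplane[OF S(1)] K(2) x K(3)] .
  have glev: "g u \<in> sub_level K (k - 1)" for u
  proof -
    have "vec.subspace Z \<and> Z \<subseteq> K \<and> int (vec.dim Z) = k - 1" if "g u Z \<noteq> 0" for Z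
    proof -
      from that have Z: "vec.subspace Z" "Z \<subseteq> K" "v (add_line (e + u *s x) Z) \<noteq> 0"
        by (auto simp: g_def split: if_splits)
      have "e + u *s x \<notin> Z" using eu[of u] Z KP by (auto simp: coord_hyperplane_def)
      then show ?thesis using Z v(1) dim_add_line[OF Z(1)] by (auto simp: fun_level_def)
    qed
    then show ?thesis by (auto simp: fun_level_def)
  qed
  have z: "v W = 0" if W: "\<And>d. v (transvect i (d *s x) ` W) = v W" for W
  proof -
    have "0 = avg i x v W" using v(3) by simp
    also have "\<dots> = v W" using W q by (simp add: avg_apply)
    finally show ?thesis by simp
  qed
  have "v W = (\<Sum>u\<in>UNIV - {0}. pencil_lift i (add_line (e + u *s x) K) (add_line e K) (g u)) W" for W
  proof -
    have extS: "add_line (e + u *s x) K \<subseteq> S" for u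
      using S x K by (intro add_line_subset vec.subspace_add vec.subspace_scale) auto
    consider "\<not> (vec.subspace W \<and> W \<subseteq> S)" | "vec.subspace W" "W \<subseteq> S" "W \<subseteq> ?P"
      | "vec.subspace W" "W \<subseteq> S" "\<not> W \<subseteq> ?P" "\<not> W \<inter> ?P \<subseteq> K"
      | "vec.subspace W" "W \<subseteq> S" "\<not> W \<subseteq> ?P" "W \<inter> ?P \<subseteq> K" by blast
    then show ?thesis
    proof cases
      case 1
      then have "\<not> (vec.subspace W \<and> W \<subseteq> add_line (e + u *s x) K)" for u using extS by blast
      from this this[of 0] have "pencil_lift i (add_line (e + u *s x) K) (add_line e K) (g u) W = 0" for u
        by (auto simp: pencil_lift_def lift_sub_def)
      moreover have "v W = 0" using fun_levelD[OF v(1), of W] 1 by auto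
      ultimately show ?thesis by (simp add: sum_fun_apply)
    next
      case 2
      have "v W = 0" using z[of W] transvect_image_hyperplane[OF 2(3)] by simp
      then show ?thesis using 2 by (simp add: sum_fun_apply pencil_lift_def lift_sub_def)
    next
      case 3
      have "\<not> W \<subseteq> add_line (e + u *s x) K" for u
        using 3(4) add_line_Int_hyperplane[OF KP eu[of u]] by blast
      from this this[of 0] have *: "pencil_lift i (add_line (e + u *s x) K) (add_line e K) (g u) W = 0" for u
        by (auto simp: pencil_lift_def lift_sub_def)
      obtain w where w: "w \<in> W" "w \<in> ?P" "w \<notin> K" using 3 by blast
      \<comment> \<open>Since \<open>w\<close> and \<open>K\<close> span the hyperplane of
        \<open>S\<close>, a shift by a multiple of \<open>x\<close> is a shift along
        \<open>w\<close>, which maps \<open>W\<close> to itself, followed by one along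
        \<open>K\<close>, which leaves \<open>v\<close> unchanged.\<close>
      have wH: "add_line w K = S \<inter> ?P"
        using add_line_eqI[OF K(1) subspace_Int_hyperplane[OF S(1)] K(2) _ _ K(3), of w] w 3 by blast
      have "v (transvect i (d *s x) ` W) = v W" for d
      proof -
        have "d *s x \<in> add_line w K"
          unfolding wH using subspace_Int_hyperplane[OF S(1)] x(1) by (rule vec.subspace_scale)
        then obtain t c where tc: "d *s x = t + c *s w" "t \<in> K" by (rule add_lineE)
        have i: "t $ i = 0" "w $ i = 0" using tc w KP by (auto simp: coord_hyperplane_def)
        have "transvect i (d *s x) ` W = transvect i t ` transvect i (c *s w) ` W"
          unfolding tc(1) using i by (intro transvect_image_add[symmetric]) auto
        also have "transvect i (c *s w) ` W = W"
          using 3 w i by (intro transvect_image_mem) (auto intro: vec.subspace_scale)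
        finally show ?thesis using v(2)[OF tc(2)] by (metis tact_apply)
      qed
      then show ?thesis using z * by (simp add: sum_fun_apply)
    next
      case 4
      obtain w where w: "w \<in> W" "w $ i = 1" using normalized_vector[OF 4(1,3)] .
      have "w - e \<in> S \<inter> ?P" using w 4 S by (auto simp: mem_coord_hyperplane intro: vec.subspace_diff)
      then obtain t a where ta: "w - e = t + a *s x" "t \<in> K" unfolding H[symmetric] by (rule add_lineE)
      then have wt: "w = e + a *s x + t" by (simp add: algebra_simps)
      let ?Z = "W \<inter> ?P"
      have Z: "vec.subspace ?Z" using subspace_Int_hyperplane[OF 4(1)] .
      have "W = add_line w ?Z" using add_line_of_Int_hyperplane[OF 4(1) w] by simp
      also have "\<dots> = transvect i t ` add_line (e + a *s x) ?Z"
        unfolding wt using transvect_image_add_line[OF _ eu, of ?Z t a] by simp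
      finally have "v W = tact i t v (add_line (e + a *s x) ?Z)" by (simp add: tact_apply)
      then have vW: "v W = g a ?Z" using v(2)[OF ta(2)] Z 4 by (simp add: g_def)
      have L: "lift_sub i (add_line (e + u *s x) K) h W = (if u = a then h ?Z else 0)" for u and h :: "_ \<Rightarrow> 'f"
        using lift_sub_pencil[OF K(1) KP S(3) xi x(2) 4(1,4) w(1)[unfolded wt] ta(2)] .
      have S0: "(\<Sum>u\<in>UNIV. g u ?Z) = 0"
      proof -
        have "0 = avg i x v (add_line e ?Z)" using v(3) by simp
        also have "\<dots> = inverse (of_nat CARD('k)) * (\<Sum>u\<in>UNIV. v (add_line (e + u *s x) ?Z))"
          using transvect_image_add_line[of ?Z i e] S(3) by (simp add: avg_apply)
        finally show ?thesis using q Z 4 by (simp add: g_def)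
      qed
      have "(\<Sum>u\<in>UNIV - {0}. pencil_lift i (add_line (e + u *s x) K) (add_line e K) (g u)) W
        = (\<Sum>u\<in>UNIV - {0}. (if u = a then g u ?Z else 0) - (if 0 = a then g u ?Z else 0))"
        using L L[of 0] by (simp add: sum_fun_apply pencil_lift_def)
      also have "\<dots> = g a ?Z"
      proof (cases "a = 0")
        case True
        have "(\<Sum>u\<in>UNIV. g u ?Z) = g 0 ?Z + (\<Sum>u\<in>UNIV - {0}. g u ?Z)" by (rule sum.remove) auto
        then have "g 0 ?Z = - (\<Sum>u\<in>UNIV - {0}. g u ?Z)" using S0 by (simp add: eq_neg_iff_add_eq_0)
        also have "\<dots> = (\<Sum>u\<in>UNIV - {0}. (if u = a then g u ?Z else 0) - (if 0 = a then g u ?Z else 0))"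
          unfolding sum_negf[symmetric] using True by (intro sum.cong) auto
        finally show ?thesis using True by simp
      next
        case False
        then show ?thesis by (simp add: sum.delta)
      qed
      finally show ?thesis using vW by simp
    qed
  qed
  then show ?thesis using that[of g] glev by blast
qed

text \<open>Evaluation at \<open>add_line (e + u *s x) Z\<close> isolates the coefficient of
  \<open>f u\<close> at \<open>Z\<close>, because the subtracted lifts belong to the parameter 0.
  This lets a kernel condition on the sum be passed to each component.\<close>

lemma pencil_independent:
  fixes f :: "'k::{field,finite} \<Rightarrow> ('k ^ 'n) set \<Rightarrow> 'f::field"
  assumes K: "vec.subspace K" "K \<subseteq> coord_hyperplane i" and e: "e $ i = 1"
    and x: "x $ i = 0" "x \<notin> K" and f: "\<And>u. f u \<in> sub_level K k"
    and z: "(\<Sum>u\<in>UNIV - {0}. pencil_lift i (add_line (e + u *s x) K) (add_line e K) (f u)) = 0" and u: "u \<noteq> 0"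
  shows "f u = 0"
proof
  fix Z
  show "f u Z = 0 Z"
  proof (cases "vec.subspace Z \<and> Z \<subseteq> K")
    case True
    let ?W = "add_line (e + u *s x) Z"
    have W: "?W \<inter> coord_hyperplane i = Z"
      using True K e x by (intro add_line_Int_hyperplane) auto
    have L: "lift_sub i (add_line (e + a *s x) K) h ?W = (if a = u then h Z else 0)" for a and h :: "_ \<Rightarrow> 'f"
      using lift_sub_pencil[OF K e x, of ?W u 0 a h] True W mem_add_line[of Z "e + u *s x"] K
      by (simp add: subspace_add_line vec.subspace_0)
    have "0 = (\<Sum>a\<in>UNIV - {0}. pencil_lift i (add_line (e + a *s x) K) (add_line e K) (f a)) ?W" using z by simp
    also have "\<dots> = (\<Sum>a\<in>UNIV - {0}. if a = u then f a Z else 0)"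
      using L L[of 0] u by (simp add: sum_fun_apply pencil_lift_def cong: sum.cong)
    also have "\<dots> = f u Z" using u by (simp add: sum.delta)
    finally show ?thesis by simp
  next
    case False
    then show ?thesis using fun_levelD[OF f, of Z u] by auto
  qed
qed

text \<open>Transvections along \<open>S \<inter> coord_hyperplane i\<close> act transitively on the
  subspaces of \<open>S\<close> off the hyperplane with a given trace, so an invariant function
  depends there on the trace alone.\<close>

lemma invariant_decomposition:
  fixes v :: "('k::{field,finite} ^ 'n) set \<Rightarrow> 'f::field"
  assumes S: "vec.subspace S" "e \<in> S" "e $ i = 1"
    and v: "v \<in> sub_level S k" "\<And>h. h \<in> S \<inter> coord_hyperplane i \<Longrightarrow> tact i h v = v"
  obtains f g where "v = f + lift_sub i S g" "f \<in> sub_level (S \<inter> coord_hyperplane i) k"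
    "g \<in> sub_level (S \<inter> coord_hyperplane i) (k - 1)"
proof -
  let ?P = "coord_hyperplane i :: ('k ^ 'n) set"
  define f where "f W = (if W \<subseteq> ?P then v W else 0)" for W
  define g where "g Z = (if vec.subspace Z \<and> Z \<subseteq> S \<inter> ?P then v (add_line e Z) else 0)" for Z
  have "f \<in> sub_level (S \<inter> ?P) k" using v(1) by (auto simp: fun_level_def f_def)
  moreover have "g \<in> sub_level (S \<inter> ?P) (k - 1)"
  proof -
    have "vec.subspace Z \<and> Z \<subseteq> S \<inter> ?P \<and> int (vec.dim Z) = k - 1" if "g Z \<noteq> 0" for Z
    proof -
      from that have Z: "vec.subspace Z" "Z \<subseteq> S \<inter> ?P" "v (add_line e Z) \<noteq> 0"
        by (auto simp: g_def split: if_splits)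
      have "e \<notin> Z" using S Z by (auto simp: coord_hyperplane_def)
      then show ?thesis using Z v(1) dim_add_line[OF Z(1)] by (auto simp: fun_level_def)
    qed
    then show ?thesis by (auto simp: fun_level_def)
  qed
  moreover have "v W = (f + lift_sub i S g) W" for W
  proof (cases "vec.subspace W \<and> W \<subseteq> S \<and> \<not> W \<subseteq> ?P")
    case True
    then obtain w where w: "w \<in> W" "w $ i = 1" using normalized_vector by blast
    have m: "w - e \<in> S \<inter> ?P" using w True S by (auto simp: mem_coord_hyperplane intro: vec.subspace_diff)
    have "W = add_line (e + (w - e)) (W \<inter> ?P)" using add_line_of_Int_hyperplane[OF _ w] True by simp
    also have "\<dots> = transvect i (w - e) ` add_line e (W \<inter> ?P)"
      using transvect_image_add_line[of "W \<inter> ?P" i e "w - e"] S by simp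
    finally have "v W = tact i (w - e) v (add_line e (W \<inter> ?P))" by (simp add: tact_apply)
    then show ?thesis using v(2)[OF m] True subspace_Int_hyperplane[of W i]
      by (auto simp: f_def g_def lift_sub_def)
  next
    case False
    then show ?thesis using fun_levelD[OF v(1), of W] by (auto simp: f_def lift_sub_def)
  qed
  ultimately show ?thesis using that[of f g] by blast
qed


text \<open>The induction draws on dimension one less for the invariant vectors, where branching
  applies, and on dimension two less for the vectors in the \<open>pencil\<close> case of the
  induction over transvections.\<close>

theorem modular_exact_subspaces:
  fixes S :: "('k::{field,finite} ^ 'n) set"
  assumes q: "of_nat CARD('k) \<noteq> (0::'f::field)" and S: "vec.subspace S" and d: "0 < d"
    and gauss: "gauss_sum (of_nat CARD('k) :: 'f) d = 0"
      "\<And>j. 0 < j \<Longrightarrow> j < d \<Longrightarrow> gauss_sum (of_nat CARD('k) :: 'f) j \<noteq> 0"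
  shows "modular_exact (lower_sub :: (('k ^ 'n) set \<Rightarrow> 'f) \<Rightarrow> _) d (sub_level S) (int (vec.dim S))"
  using S
proof (induction "vec.dim S" arbitrary: S rule: less_induct)
  case less
  let ?D = "lower_sub :: (('k ^ 'n) set \<Rightarrow> 'f) \<Rightarrow> _"
  let ?A = "sub_level :: ('k ^ 'n) set \<Rightarrow> int \<Rightarrow> (('k ^ 'n) set \<Rightarrow> 'f) set"
  show ?case
  proof (cases "S = {0}")
    case True
    have lev: "v W = 0" if "v \<in> ?A S k" "W \<noteq> {0} \<or> k \<noteq> 0" for v W k
    proof (rule ccontr)
      assume "v W \<noteq> 0"
      then have "vec.subspace W" "W \<subseteq> {0}" "int (vec.dim W) = k"
        using that(1) True by (auto simp: fun_level_def)
      then have "W = {0}" using vec.subspace_0 by blast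
      then show False using that(2) \<open>int (vec.dim W) = k\<close> by simp
    qed
    have "?D v = 0" if "v \<in> ?A S 0" for v
    proof
      fix Y :: "('k ^ 'n) set"
      have "v W = 0" if "int (vec.dim W) = int (vec.dim Y) + 1" for W
        using lev[OF \<open>v \<in> ?A S 0\<close>, of W] that by (cases "W = {0}") auto
      then show "?D v Y = 0 Y" by (simp add: lower_def)
    qed
    moreover have z: "0 \<in> ?A S k" for k by (simp add: fun_level_def)
    moreover have "?A S k = {0}" if "k \<noteq> 0" for k
      using z lev that by (auto simp: fun_eq_iff)
    moreover have "?D 0 = 0" by (simp add: lower_def fun_eq_iff)
    ultimately show ?thesis using modular_exact_base[of ?D "?A S" d] d True by simp
  next
    case False
    then obtain y where y: "y \<in> S" "y \<noteq> 0" using vec.subspace_0[OF less.prems] by blast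
    \<comment> \<open>Any coordinate that does not vanish identically on \<open>S\<close> cuts out a
      hyperplane of \<open>S\<close>, so coordinate hyperplanes suffice.\<close>
    then obtain i where i: "y $ i \<noteq> 0" by (auto simp: vec_eq_iff)
    have nS: "\<not> S \<subseteq> coord_hyperplane i" using y i by (auto simp: coord_hyperplane_def)
    obtain e where e: "e \<in> S" "e $ i = 1" using normalized_vector[OF less.prems nS] .
    define H where "H = S \<inter> coord_hyperplane i"
    have H: "vec.subspace H" "H \<subseteq> coord_hyperplane i" "H \<subseteq> S"
      unfolding H_def using subspace_Int_hyperplane[OF less.prems] by auto
    have dS: "vec.dim S = Suc (vec.dim H)"
      unfolding H_def using dim_Int_hyperplane[OF less.prems nS] .
    have exH: "modular_exact ?D d (?A H) (int (vec.dim S) - 1)"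
      using less.hyps[of H] H dS by simp
    define B where "B k = {f + lift_sub i S g | f g. f \<in> ?A H k \<and> g \<in> ?A H (k - 1)}" for k
    have exB: "modular_exact ?D d B (int (vec.dim S))"
    proof (rule fun_space.modular_exact_branch[where \<iota> = "lift_sub i S" and A = "?A H"
          and \<theta> = "\<lambda>k. of_nat CARD('k) powi (int (vec.dim H) - k)" and Q = "of_nat CARD('k)"])
      show "?D (lift_sub i S g) = fscale (of_nat CARD('k) powi (int (vec.dim H) - k)) g + lift_sub i S (?D g)"
        if "g \<in> ?A H k" for k g
        using lower_lift_sub[OF less.prems nS] that unfolding H_def .
      show "of_nat CARD('k) powi (int (vec.dim H) - (k - 1)) =
          (of_nat CARD('k) * of_nat CARD('k) powi (int (vec.dim H) - k) :: 'f)" for k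
        using q power_int_add_1'[of "of_nat CARD('k) :: 'f" "int (vec.dim H) - k"]
        by (simp add: algebra_simps)
      show "f = 0 \<and> g = 0" if "f \<in> ?A H j" "g \<in> ?A H k" "f + lift_sub i S g = 0" for j k f g
      proof -
        have *: "f W + lift_sub i S g W = 0" for W using that(3) by (metis plus_fun_apply zero_fun_apply)
        have f: "f W = 0" for W
          using *[of W] fun_levelD[OF that(1), of W] H by (auto simp: lift_sub_def split: if_splits)
        have "g Z = 0" for Z
        proof (cases "vec.subspace Z \<and> Z \<subseteq> H")
          case True
          have "\<not> add_line e Z \<subseteq> coord_hyperplane i"
            using mem_add_line[of Z e] True e by (auto simp: coord_hyperplane_def)
          moreover have "add_line e Z \<subseteq> S" using True H e less.prems by (intro add_line_subset) auto
          moreover have "add_line e Z \<inter> coord_hyperplane i = Z"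
            using True H e by (intro add_line_Int_hyperplane) auto
          ultimately show ?thesis using *[of "add_line e Z"] f True by (simp add: lift_sub_def subspace_add_line)
        next
          case False
          then show ?thesis using fun_levelD[OF that(2), of Z] by auto
        qed
        with f show ?thesis by auto
      qed
      show "B k = {f + lift_sub i S g | f g. f \<in> ?A H k \<and> g \<in> ?A H (k - 1)}" for k
        by (rule B_def)
      show "?D v \<in> ?A H (k - 1)" if "v \<in> ?A H k" for k v
        using that by (rule lower_mem_fun_level)
    qed (use q gauss d exH module_hom_lower module_hom_lift_sub subspace_fun_level in auto)
    have BA: "B k \<subseteq> ?A S k" for k
    proof
      fix v assume "v \<in> B k"
      then obtain f g where "v = f + lift_sub i S g" "f \<in> ?A H k" "g \<in> ?A H (k - 1)"
        unfolding B_def by blast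
      then show "v \<in> ?A S k"
        using lift_sub_mem[of g S i k] sub_level_mono[OF H(3)] fun_space.subspace_add[OF subspace_fun_level]
        unfolding H_def by metis
    qed
    have inB: "v \<in> B k" if v: "v \<in> ?A S k" "\<And>h. h \<in> H \<Longrightarrow> tact i h v = v" for v k
    proof -
      obtain f g where "v = f + lift_sub i S g" "f \<in> ?A H k" "g \<in> ?A H (k - 1)"
        using invariant_decomposition[OF less.prems e v(1) v(2)[unfolded H_def]]
        unfolding H_def by blast
      then show ?thesis unfolding B_def by blast
    qed
    have tactA: "tact i h v \<in> ?A S k" if "v \<in> ?A S k" "h \<in> H" for v h k
      using tact_mem_sub_level[OF that(1) less.prems] that(2) H by (auto simp: coord_hyperplane_def)
    have hi: "h $ i = 0" if "h \<in> H" for h using that H by (auto simp: coord_hyperplane_def)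
    note tact_ind = transvection_induct[OF q H(1,2)]
    note Dj = module_hom_lower_funpow[where L = "{W. vec.subspace W}" and rk = "\<lambda>W. int (vec.dim W)"]
    have ker: "fun_space.subspace {v. (?D ^^ j) v = 0}" for j
      using module_hom.subspace_kernel[OF Dj] .
    let ?pl = "\<lambda>K x u. pencil_lift i (add_line (e + u *s x) K) (add_line e K) :: (('k ^ 'n) set \<Rightarrow> 'f) \<Rightarrow> _"
    have pen: "\<exists>g. (\<forall>u. g u \<in> ?A K (k - 1)) \<and> v = (\<Sum>u\<in>UNIV - {0}. ?pl K x u (g u)) \<and>
        (\<forall>j. (?D ^^ j) v = (\<Sum>u\<in>UNIV - {0}. ?pl K x u ((?D ^^ j) (g u)))) \<and>
        modular_exact ?D d (?A K) (int (vec.dim S) - 2)"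
      if K: "vec.subspace K" "K \<subseteq> H" "vec.dim H = Suc (vec.dim K)" "x \<in> H" "x \<notin> K"
        and v: "v \<in> ?A S k" "\<And>h. h \<in> K \<Longrightarrow> tact i h v = v" "avg i x v = 0" for K x v k
    proof -
      obtain g where g: "\<And>u. g u \<in> ?A K (k - 1)" "v = (\<Sum>u\<in>UNIV - {0}. ?pl K x u (g u))"
        using pencil_decomposition[OF q less.prems e K[unfolded H_def] v] by blast
      have KP: "K \<subseteq> coord_hyperplane i" using K H by blast
      have eu: "(e + u *s x) $ i = 1" for u using e hi[OF K(4)] by simp
      have "(?D ^^ j) v = (\<Sum>u\<in>UNIV - {0}. ?pl K x u ((?D ^^ j) (g u)))" for j
        unfolding g(2) module_hom.sum[OF Dj]
        using lower_funpow_pencil_lift[OF K(1) KP eu e(2) g(1)] by simp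
      moreover have "modular_exact ?D d (?A K) (int (vec.dim S) - 2)"
        using less.hyps[of K] K dS by simp
      ultimately show ?thesis using g by blast
    qed
    have nil: "?A S k \<subseteq> {v. (?D ^^ d) v = 0}" for k
    proof (rule tact_ind[OF subspace_fun_level tactA ker])
      fix v assume v: "v \<in> ?A S k" "\<And>h. h \<in> H \<Longrightarrow> tact i h v = v"
      show "v \<in> {v. (?D ^^ d) v = 0}"
        using exB inB[OF v] unfolding modular_exact_def by blast
    next
      fix K x v
      assume K: "vec.subspace K" "K \<subseteq> H" "vec.dim H = Suc (vec.dim K)" "x \<in> H" "x \<notin> K"
        and v: "v \<in> ?A S k" "\<And>h. h \<in> K \<Longrightarrow> tact i h v = v" "avg i x v = 0"
      obtain g where g: "\<And>u. g u \<in> ?A K (k - 1)"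
        "\<And>j. (?D ^^ j) v = (\<Sum>u\<in>UNIV - {0}. ?pl K x u ((?D ^^ j) (g u)))"
        "modular_exact ?D d (?A K) (int (vec.dim S) - 2)"
        using pen[OF K v] by blast
      have "(?D ^^ d) (g u) = 0" for u using g(1,3) unfolding modular_exact_def by blast
      then show "v \<in> {v. (?D ^^ d) v = 0}"
        using g(2)[of d] by (simp add: pencil_lift_def module_hom.zero[OF module_hom_lift_sub])
    qed
    \<comment> \<open>The induction over transvections runs with the kernel of \<open>D ^^ j\<close>
      as \<open>R\<close> and the image of \<open>D ^^ (d - j)\<close> as \<open>P\<close>. The
      kernel is stable because transvections commute with \<open>D\<close>, so a cycle is decomposed
      into cycles.\<close>
    have exact: "?A S k \<inter> {v. (?D ^^ j) v = 0} \<subseteq> (?D ^^ (d - j)) ` ?A S (k + int (d - j))"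
      if j: "j \<le> d" "2 * k - int j \<ge> int (vec.dim S) \<or> 2 * k - int j \<le> int (vec.dim S) - int d" for k j
    proof (rule tact_ind)
      show "fun_space.subspace (?A S k \<inter> {v. (?D ^^ j) v = 0})"
        by (intro fun_space.subspace_inter subspace_fun_level ker)
      show "fun_space.subspace ((?D ^^ (d - j)) ` ?A S (k + int (d - j)))"
        by (rule module_hom.subspace_image[OF Dj subspace_fun_level])
      show "tact i h v \<in> ?A S k \<inter> {v. (?D ^^ j) v = 0}"
        if "v \<in> ?A S k \<inter> {v. (?D ^^ j) v = 0}" "h \<in> H" for v h
        using that tactA[of v k h] lower_funpow_tact[OF hi[OF that(2)], of j v]
        by (simp add: module_hom.zero[OF module_hom_tact])
    next
      fix v assume v: "v \<in> ?A S k \<inter> {v. (?D ^^ j) v = 0}" "\<And>h. h \<in> H \<Longrightarrow> tact i h v = v"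
      then have vB: "v \<in> B k" and z: "(?D ^^ j) v = 0" using inB by auto
      obtain w where "w \<in> B (k + int (d - j))" "(?D ^^ (d - j)) w = v"
        using modular_exactD[OF exB vB j z] .
      then show "v \<in> (?D ^^ (d - j)) ` ?A S (k + int (d - j))" using BA by blast
    next
      fix K x v
      assume K: "vec.subspace K" "K \<subseteq> H" "vec.dim H = Suc (vec.dim K)" "x \<in> H" "x \<notin> K"
        and v: "v \<in> ?A S k \<inter> {v. (?D ^^ j) v = 0}" "\<And>h. h \<in> K \<Longrightarrow> tact i h v = v" "avg i x v = 0"
      have v1: "v \<in> ?A S k" and z: "(?D ^^ j) v = 0" using v by auto
      obtain g where g: "\<And>u. g u \<in> ?A K (k - 1)" "v = (\<Sum>u\<in>UNIV - {0}. ?pl K x u (g u))"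
        "\<And>j. (?D ^^ j) v = (\<Sum>u\<in>UNIV - {0}. ?pl K x u ((?D ^^ j) (g u)))"
        "modular_exact ?D d (?A K) (int (vec.dim S) - 2)"
        using pen[OF K v1 v(2,3)] by blast
      have KP: "K \<subseteq> coord_hyperplane i" using K H by blast
      have eu: "(e + u *s x) $ i = 1" for u using e hi[OF K(4)] by simp
      have gz: "(?D ^^ j) (g u) = 0" if "u \<noteq> 0" for u
        using pencil_independent[OF K(1) KP e(2) hi[OF K(4)] K(5) lower_funpow_mem[OF g(1)] _ that]
          g(3)[of j] z by simp
      have "\<exists>w. w \<in> ?A K (k - 1 + int (d - j)) \<and> (?D ^^ (d - j)) w = g u" if "u \<noteq> 0" for u
      proof -
        \<comment> \<open>The dimension drops by two and the degree by one, so both sides of each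
          inequality drop by two.\<close>
        have "2 * (k - 1) - int j \<ge> int (vec.dim S) - 2 \<or> 2 * (k - 1) - int j \<le> int (vec.dim S) - 2 - int d"
          using j(2) by auto
        from modular_exactD[OF g(4) g(1) j(1) this gz[OF that]] show ?thesis by blast
      qed
      then obtain w where w: "\<And>u. u \<noteq> 0 \<Longrightarrow> w u \<in> ?A K (k - 1 + int (d - j))"
        "\<And>u. u \<noteq> 0 \<Longrightarrow> (?D ^^ (d - j)) (w u) = g u" by metis
      define r where "r = (\<Sum>u\<in>UNIV - {0}. ?pl K x u (w u))"
      have "(?D ^^ (d - j)) r = (\<Sum>u\<in>UNIV - {0}. ?pl K x u (g u))"
        unfolding r_def module_hom.sum[OF Dj]
        using lower_funpow_pencil_lift[OF K(1) KP eu e(2) w(1)] w(2) by (intro sum.cong) auto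
      then have "(?D ^^ (d - j)) r = v" using g(2) by simp
      moreover have "r \<in> ?A S (k + int (d - j))"
        unfolding r_def
      proof (rule fun_space.subspace_sum[OF subspace_fun_level])
        fix u :: 'k assume u: "u \<in> UNIV - {0}"
        have l: "lift_sub i (add_line a K) (w u) \<in> ?A S (k + int (d - j))" if a: "a \<in> S" "a $ i = 1" for a
        proof -
          have "add_line a K \<subseteq> S" using a K H less.prems by (intro add_line_subset) auto
          moreover have "lift_sub i (add_line a K) (w u) \<in> ?A (add_line a K) (k + int (d - j))"
            using w(1)[of u] u add_line_Int_hyperplane[OF KP a(2)]
            by (intro lift_sub_mem) (simp add: algebra_simps)
          ultimately show ?thesis by (rule sub_level_mono)
        qed
        have "e + u *s x \<in> S" using e K H less.prems by (auto intro: vec.subspace_add vec.subspace_scale)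
        then show "?pl K x u (w u) \<in> ?A S (k + int (d - j))"
          unfolding pencil_lift_def using l e eu by (intro fun_space.subspace_diff subspace_fun_level) auto
      qed
      ultimately show "v \<in> (?D ^^ (d - j)) ` ?A S (k + int (d - j))" by blast
    qed
    show ?thesis unfolding modular_exact_def
    proof (intro conjI allI ballI impI)
      show "(?D ^^ d) v = 0" if "v \<in> ?A S k" for k v using nil that by blast
      show "v \<in> (?D ^^ (d - j)) ` ?A S (k + int (d - j))"
        if "v \<in> ?A S k" "j \<le> d" "int (vec.dim S) \<le> 2 * k - int j \<or> 2 * k - int j \<le> int (vec.dim S) - int d"
          "(?D ^^ j) v = 0" for k j v
        using exact[OF that(2,3)] that(1,4) by blast
    qed
  qed
qed

section \<open>Counting composition factors\<close>

lemma ring_of_type_algebra_simps [simp]: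
  "carrier (ring_of_type_algebra :: 'f::comm_ring_1 ring) = UNIV"
  "\<zero>\<^bsub>ring_of_type_algebra :: 'f ring\<^esub> = 0"
  "\<one>\<^bsub>ring_of_type_algebra :: 'f ring\<^esub> = 1"
  "a \<oplus>\<^bsub>ring_of_type_algebra :: 'f ring\<^esub> b = a + b"
  "a \<otimes>\<^bsub>ring_of_type_algebra :: 'f ring\<^esub> b = a * b"
  by (simp_all add: ring_of_type_algebra_def)

lemma group_moduleI:
  fixes G (structure) and M :: "('f::field, 'v, 'g) fg_module"
  assumes "Group.group G"
    and "\<And>v w. v \<in> carrier M \<Longrightarrow> w \<in> carrier M \<Longrightarrow> v \<oplus>\<^bsub>M\<^esub> w \<in> carrier M"
    and "\<zero>\<^bsub>M\<^esub> \<in> carrier M"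
    and "\<And>u v w. u \<in> carrier M \<Longrightarrow> v \<in> carrier M \<Longrightarrow> w \<in> carrier M \<Longrightarrow>
      (u \<oplus>\<^bsub>M\<^esub> v) \<oplus>\<^bsub>M\<^esub> w = u \<oplus>\<^bsub>M\<^esub> (v \<oplus>\<^bsub>M\<^esub> w)"
    and "\<And>v w. v \<in> carrier M \<Longrightarrow> w \<in> carrier M \<Longrightarrow> v \<oplus>\<^bsub>M\<^esub> w = w \<oplus>\<^bsub>M\<^esub> v"
    and "\<And>v. v \<in> carrier M \<Longrightarrow> \<zero>\<^bsub>M\<^esub> \<oplus>\<^bsub>M\<^esub> v = v"
    and "\<And>a v. v \<in> carrier M \<Longrightarrow> a \<odot>\<^bsub>M\<^esub> v \<in> carrier M"
    and "\<And>a b v. v \<in> carrier M \<Longrightarrow> (a + b) \<odot>\<^bsub>M\<^esub> v = a \<odot>\<^bsub>M\<^esub> v \<oplus>\<^bsub>M\<^esub> b \<odot>\<^bsub>M\<^esub> v"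
    and "\<And>a v w. v \<in> carrier M \<Longrightarrow> w \<in> carrier M \<Longrightarrow>
      a \<odot>\<^bsub>M\<^esub> (v \<oplus>\<^bsub>M\<^esub> w) = a \<odot>\<^bsub>M\<^esub> v \<oplus>\<^bsub>M\<^esub> a \<odot>\<^bsub>M\<^esub> w"
    and "\<And>a b v. v \<in> carrier M \<Longrightarrow> (a * b) \<odot>\<^bsub>M\<^esub> v = a \<odot>\<^bsub>M\<^esub> (b \<odot>\<^bsub>M\<^esub> v)"
    and "\<And>v. v \<in> carrier M \<Longrightarrow> 1 \<odot>\<^bsub>M\<^esub> v = v"
    and "\<And>v. v \<in> carrier M \<Longrightarrow> 0 \<odot>\<^bsub>M\<^esub> v = \<zero>\<^bsub>M\<^esub>"
    and "\<And>g v. g \<in> carrier G \<Longrightarrow> v \<in> carrier M \<Longrightarrow> act M g v \<in> carrier M"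
    and "\<And>g v w. g \<in> carrier G \<Longrightarrow> v \<in> carrier M \<Longrightarrow> w \<in> carrier M \<Longrightarrow>
      act M g (v \<oplus>\<^bsub>M\<^esub> w) = act M g v \<oplus>\<^bsub>M\<^esub> act M g w"
    and "\<And>g a v. g \<in> carrier G \<Longrightarrow> v \<in> carrier M \<Longrightarrow> act M g (a \<odot>\<^bsub>M\<^esub> v) = a \<odot>\<^bsub>M\<^esub> act M g v"
    and "\<And>v. v \<in> carrier M \<Longrightarrow> act M \<one> v = v"
    and "\<And>g h v. g \<in> carrier G \<Longrightarrow> h \<in> carrier G \<Longrightarrow> v \<in> carrier M \<Longrightarrow>
      act M (g \<otimes> h) v = act M g (act M h v)"
  shows "group_module G M"
proof -
  have "\<exists>w\<in>carrier M. w \<oplus>\<^bsub>M\<^esub> v = \<zero>\<^bsub>M\<^esub>" if v: "v \<in> carrier M" for v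
  proof
    show "(- 1) \<odot>\<^bsub>M\<^esub> v \<in> carrier M" using assms(7) v by blast
    show "(- 1) \<odot>\<^bsub>M\<^esub> v \<oplus>\<^bsub>M\<^esub> v = \<zero>\<^bsub>M\<^esub>"
      using assms(8)[OF v, of "- 1" 1] assms(11,12)[OF v] by simp
  qed
  then have "abelian_group M" using assms(2-6) by (intro abelian_groupI)
  then have "Module.module (ring_of_type_algebra :: 'f ring) M"
    using assms(7-11) by (intro Module.moduleI) (auto intro: cring_from_type_algebra)
  then show ?thesis using assms(1,13-)
    by (intro group_module.intro group_module_axioms.intro) auto
qed

context group_module
begin

lemma smult_closed_carrier: "v \<in> carrier M \<Longrightarrow> a \<odot>\<^bsub>M\<^esub> v \<in> carrier M"
  using M.smult_closed[of a v] by simp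

lemma smult_add_left: "v \<in> carrier M \<Longrightarrow> (a + b) \<odot>\<^bsub>M\<^esub> v = a \<odot>\<^bsub>M\<^esub> v \<oplus>\<^bsub>M\<^esub> b \<odot>\<^bsub>M\<^esub> v"
  using M.smult_l_distr[of a b v] by simp

lemma smult_add_right: "v \<in> carrier M \<Longrightarrow> w \<in> carrier M \<Longrightarrow>
    a \<odot>\<^bsub>M\<^esub> (v \<oplus>\<^bsub>M\<^esub> w) = a \<odot>\<^bsub>M\<^esub> v \<oplus>\<^bsub>M\<^esub> a \<odot>\<^bsub>M\<^esub> w"
  using M.smult_r_distr[of a v w] by simp

lemma smult_mult: "v \<in> carrier M \<Longrightarrow> (a * b) \<odot>\<^bsub>M\<^esub> v = a \<odot>\<^bsub>M\<^esub> (b \<odot>\<^bsub>M\<^esub> v)"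
  using M.smult_assoc1[of a b v] by simp

lemma smult_1: "v \<in> carrier M \<Longrightarrow> 1 \<odot>\<^bsub>M\<^esub> v = v"
  using M.smult_one[of v] by simp

lemma smult_0: "v \<in> carrier M \<Longrightarrow> 0 \<odot>\<^bsub>M\<^esub> v = \<zero>\<^bsub>M\<^esub>"
  using M.smult_l_null[of v] by simp

lemma smult_minus_1: "v \<in> carrier M \<Longrightarrow> (- 1) \<odot>\<^bsub>M\<^esub> v = \<ominus>\<^bsub>M\<^esub> v"
proof -
  assume v: "v \<in> carrier M"
  have "(- 1) \<odot>\<^bsub>M\<^esub> v \<oplus>\<^bsub>M\<^esub> v = \<zero>\<^bsub>M\<^esub>"
    using smult_add_left[OF v, of "- 1" 1] smult_1[OF v] smult_0[OF v] by simp
  then show ?thesis using v smult_closed_carrier M.minus_equality by metis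
qed

lemma fg_submodule_iff:
  "fg_submodule G M W \<longleftrightarrow> W \<subseteq> carrier M \<and> \<zero>\<^bsub>M\<^esub> \<in> W \<and> (\<forall>v\<in>W. \<forall>w\<in>W. v \<oplus>\<^bsub>M\<^esub> w \<in> W) \<and>
     (\<forall>a. \<forall>v\<in>W. a \<odot>\<^bsub>M\<^esub> v \<in> W) \<and> (\<forall>g\<in>carrier G. \<forall>v\<in>W. act M g v \<in> W)" (is "_ = ?R")
proof
  assume "fg_submodule G M W"
  then have s: "submodule W ring_of_type_algebra M" and a: "\<forall>g\<in>carrier G. \<forall>v\<in>W. act M g v \<in> W"
    by (auto simp: fg_submodule_def)
  note E = M.submoduleE[OF s]
  obtain v where v: "v \<in> W" using E(2) by blast
  have "0 \<odot>\<^bsub>M\<^esub> v \<in> W" using E(4)[OF _ v, of 0] by simp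
  then have "\<zero>\<^bsub>M\<^esub> \<in> W" using smult_0 v E(1) by auto
  then show ?R using E a by auto
next
  assume R: ?R
  have "submodule W ring_of_type_algebra M"
  proof (rule M.submoduleI)
    fix v assume "v \<in> W"
    then show "\<ominus>\<^bsub>M\<^esub> v \<in> W" using R smult_minus_1 by (metis subsetD)
  qed (use R in auto)
  then show "fg_submodule G M W" using R by (simp add: fg_submodule_def)
qed

lemma fg_submodule_carrier: "fg_submodule G M (carrier M)"
  unfolding fg_submodule_iff by (auto simp: smult_closed_carrier act_closed)

lemma act_zero: "g \<in> carrier G \<Longrightarrow> act M g \<zero>\<^bsub>M\<^esub> = \<zero>\<^bsub>M\<^esub>"
  using act_smult[of g "\<zero>\<^bsub>M\<^esub>" 0] smult_0 act_closed by simp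

lemma smult_zero: "a \<odot>\<^bsub>M\<^esub> \<zero>\<^bsub>M\<^esub> = \<zero>\<^bsub>M\<^esub>"
  using smult_mult[of "\<zero>\<^bsub>M\<^esub>" a 0] smult_0[of "\<zero>\<^bsub>M\<^esub>"] by simp

lemma fg_submodule_zero: "fg_submodule G M {\<zero>\<^bsub>M\<^esub>}"
  unfolding fg_submodule_iff by (auto simp: smult_zero act_zero)

lemma fg_submodule_Int: "fg_submodule G M A \<Longrightarrow> fg_submodule G M B \<Longrightarrow> fg_submodule G M (A \<inter> B)"
  unfolding fg_submodule_iff by auto

lemma fg_submodule_restrict_iff:
  "fg_submodule G M B \<Longrightarrow> fg_submodule G (M\<lparr>carrier := B\<rparr>) A \<longleftrightarrow> fg_submodule G M A \<and> A \<subseteq> B"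
  and group_module_restrict: "fg_submodule G M B \<Longrightarrow> group_module G (M\<lparr>carrier := B\<rparr>)"
proof -
  assume B: "fg_submodule G M B"
  then have Bc: "B \<subseteq> carrier M" by (simp add: fg_submodule_iff)
  show gm: "group_module G (M\<lparr>carrier := B\<rparr>)"
    by (rule group_moduleI)
      (use B[unfolded fg_submodule_iff] in \<open>auto simp: M.a_ac smult_add_left smult_add_right
        smult_mult smult_1 smult_0 act_add act_smult act_one act_mult subset_iff group_axioms\<close>)
  show "fg_submodule G (M\<lparr>carrier := B\<rparr>) A \<longleftrightarrow> fg_submodule G M A \<and> A \<subseteq> B"
    unfolding group_module.fg_submodule_iff[OF gm] fg_submodule_iff using Bc by auto
qed

lemma diff_eq_zero_iff:
  assumes "v \<in> carrier M" "w \<in> carrier M"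
  shows "v \<oplus>\<^bsub>M\<^esub> (- 1) \<odot>\<^bsub>M\<^esub> w = \<zero>\<^bsub>M\<^esub> \<longleftrightarrow> v = w"
  unfolding smult_minus_1[OF assms(2)]
proof
  assume "v \<oplus>\<^bsub>M\<^esub> \<ominus>\<^bsub>M\<^esub> w = \<zero>\<^bsub>M\<^esub>"
  from M.minus_equality[OF this] show "v = w" using assms by simp
qed (use assms M.r_neg in simp)

end

section \<open>Homomorphisms and marked chains of submodules\<close>

definition fg_hom ::
    "('g, 'b) monoid_scheme \<Rightarrow> ('f::field, 'v, 'g) fg_module \<Rightarrow> ('f, 'w, 'g) fg_module \<Rightarrow> ('v \<Rightarrow> 'w) \<Rightarrow> bool"
  where
  "fg_hom G M N h \<longleftrightarrow> h ` carrier M \<subseteq> carrier N \<and>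
     (\<forall>v\<in>carrier M. \<forall>w\<in>carrier M. h (v \<oplus>\<^bsub>M\<^esub> w) = h v \<oplus>\<^bsub>N\<^esub> h w) \<and>
     (\<forall>a. \<forall>v\<in>carrier M. h (a \<odot>\<^bsub>M\<^esub> v) = a \<odot>\<^bsub>N\<^esub> h v) \<and>
     (\<forall>g\<in>carrier G. \<forall>v\<in>carrier M. h (act M g v) = act N g (h v))"

lemma fg_homD:
  assumes "fg_hom G M N h"
  shows "v \<in> carrier M \<Longrightarrow> h v \<in> carrier N"
    and "v \<in> carrier M \<Longrightarrow> w \<in> carrier M \<Longrightarrow> h (v \<oplus>\<^bsub>M\<^esub> w) = h v \<oplus>\<^bsub>N\<^esub> h w"
    and "v \<in> carrier M \<Longrightarrow> h (a \<odot>\<^bsub>M\<^esub> v) = a \<odot>\<^bsub>N\<^esub> h v"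
    and "g \<in> carrier G \<Longrightarrow> v \<in> carrier M \<Longrightarrow> h (act M g v) = act N g (h v)"
  using assms unfolding fg_hom_def by auto

text \<open>Every element of \<open>Q\<close> is some \<open>h v\<close>, so each axiom is pulled
  back to \<open>M\<close>. For quotients this reduces the module axioms to the fact that the coset
  map respects the operations.\<close>

lemma group_module_surj_image:
  fixes Q :: "('f::field, 'w, 'g) fg_module"
  assumes M: "group_module G M" and h: "fg_hom G M Q h" and surj: "h ` carrier M = carrier Q"
    and z: "h \<zero>\<^bsub>M\<^esub> = \<zero>\<^bsub>Q\<^esub>"
  shows "group_module G Q"
proof -
  interpret group_module G M by fact
  note D = fg_homD[OF h]
  have lift: "\<exists>v\<in>carrier M. x = h v" if "x \<in> carrier Q" for x using that surj by blast
  show ?thesis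
  proof (rule group_moduleI, goal_cases)
    case 1 show ?case by (rule group_axioms)
  next
    case (2 v w) then show ?case using lift D by (metis M.a_closed)
  next
    case 3 show ?case using z D(1) M.zero_closed by metis
  next
    case (4 u v w)
    then obtain u' v' w' where "u = h u'" "v = h v'" "w = h w'" "u' \<in> carrier M" "v' \<in> carrier M" "w' \<in> carrier M"
      using lift by metis
    then show ?case by (simp flip: D(2) add: M.a_assoc)
  next
    case (5 v w)
    then obtain v' w' where "v = h v'" "w = h w'" "v' \<in> carrier M" "w' \<in> carrier M"
      using lift by metis
    then show ?case by (simp flip: D(2) add: M.a_comm)
  next
    case (6 v) then show ?case using lift D(2)[of "\<zero>\<^bsub>M\<^esub>"] z by (metis M.l_zero M.zero_closed)
  next
    case (7 a v) then show ?case using lift D by (metis smult_closed_carrier)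
  next
    case (8 a b v)
    then obtain v' where "v = h v'" "v' \<in> carrier M" using lift by blast
    then show ?case using 8 by (simp flip: D(2-4) add: smult_add_left smult_closed_carrier)
  next
    case (9 a v w)
    then obtain v' w' where "v = h v'" "w = h w'" "v' \<in> carrier M" "w' \<in> carrier M"
      using lift by metis
    then show ?case by (simp flip: D(2-4) add: smult_add_right smult_closed_carrier)
  next
    case (10 a b v)
    then obtain v' where "v = h v'" "v' \<in> carrier M" using lift by blast
    then show ?case using 10 by (simp flip: D(2-4) add: smult_mult smult_closed_carrier)
  next
    case (11 v)
    then obtain v' where "v = h v'" "v' \<in> carrier M" using lift by blast
    then show ?case using 11 by (simp flip: D(2-4) add: smult_1)
  next
    case (12 v)
    then obtain v' where "v = h v'" "v' \<in> carrier M" using lift by blast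
    then show ?case using 12 by (simp flip: D(2-4) add: smult_0 z)
  next
    case (13 g v) then show ?case using lift D by (metis act_closed)
  next
    case (14 g v w)
    then obtain v' w' where "v = h v'" "w = h w'" "v' \<in> carrier M" "w' \<in> carrier M"
      using lift by metis
    then show ?case using 14(1) by (simp flip: D(2-4) add: act_add act_closed)
  next
    case (15 g a v)
    then obtain v' where "v = h v'" "v' \<in> carrier M" using lift by blast
    then show ?case using 15 by (simp flip: D(2-4) add: act_closed act_smult smult_closed_carrier)
  next
    case (16 v)
    then obtain v' where "v = h v'" "v' \<in> carrier M" using lift by blast
    then show ?case using 16 by (simp flip: D(2-4) add: act_one)
  next
    case (17 g k v)
    then obtain v' where "v = h v'" "v' \<in> carrier M" using lift by blast
    then show ?case using 17 by (simp flip: D(2-4) add: act_closed act_mult m_closed)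
  qed
qed

locale fg_module_hom = M: group_module G M + N: group_module G N
  for G :: "('g, 'b) monoid_scheme" and M :: "('f::field, 'v, 'g) fg_module"
    and N :: "('f, 'w, 'g) fg_module" +
  fixes h
  assumes hom: "fg_hom G M N h"
begin

lemmas hom_simps = fg_homD[OF hom]

lemma hom_zero: "h \<zero>\<^bsub>M\<^esub> = \<zero>\<^bsub>N\<^esub>"
  using hom_simps(3)[of "\<zero>\<^bsub>M\<^esub>" 0] hom_simps(1)[of "\<zero>\<^bsub>M\<^esub>"] M.smult_0 N.smult_0 by simp

lemma fg_submodule_image: "fg_submodule G M W \<Longrightarrow> fg_submodule G N (h ` W)"
  unfolding M.fg_submodule_iff N.fg_submodule_iff
proof (elim conjE, intro conjI ballI allI)
  assume W: "W \<subseteq> carrier M" "\<zero>\<^bsub>M\<^esub> \<in> W" "\<forall>v\<in>W. \<forall>w\<in>W. v \<oplus>\<^bsub>M\<^esub> w \<in> W"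
    "\<forall>a. \<forall>v\<in>W. a \<odot>\<^bsub>M\<^esub> v \<in> W" "\<forall>g\<in>carrier G. \<forall>v\<in>W. act M g v \<in> W"
  show "h ` W \<subseteq> carrier N" using W hom_simps(1) by blast
  show "\<zero>\<^bsub>N\<^esub> \<in> h ` W" using W hom_zero by (metis imageI)
  show "x \<oplus>\<^bsub>N\<^esub> y \<in> h ` W" if "x \<in> h ` W" "y \<in> h ` W" for x y
    using that W hom_simps(2) by (smt (verit) imageE imageI subsetD)
  show "a \<odot>\<^bsub>N\<^esub> x \<in> h ` W" if "x \<in> h ` W" for a x
    using that W hom_simps(3) by (smt (verit) imageE imageI subsetD)
  show "act N g x \<in> h ` W" if "g \<in> carrier G" "x \<in> h ` W" for g x
    using that W hom_simps(4) by (smt (verit) imageE imageI subsetD)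
qed

lemma fg_submodule_vimage: "fg_submodule G N V \<Longrightarrow> fg_submodule G M {v \<in> carrier M. h v \<in> V}"
  unfolding M.fg_submodule_iff N.fg_submodule_iff
  by (auto simp: hom_simps hom_zero M.smult_closed_carrier M.act_closed)

lemma fg_submodule_kernel: "fg_submodule G M {v \<in> carrier M. h v = \<zero>\<^bsub>N\<^esub>}"
  using fg_submodule_vimage[OF N.fg_submodule_zero] by simp

end

text \<open>The factor of \<open>B\<close> by \<open>A\<close> is isomorphic to \<open>U\<close>,
  phrased through a surjection from \<open>B\<close> with kernel \<open>A\<close>; no module of
  cosets, with its change of type, has to be mentioned.\<close>

definition fg_step ::
    "('g, 'b) monoid_scheme \<Rightarrow> ('f::field, 'u, 'g) fg_module \<Rightarrow> ('f, 'v, 'g) fg_module \<Rightarrow> 'v set \<Rightarrow> 'v set \<Rightarrow> bool"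
  where
  "fg_step G U M A B \<longleftrightarrow> fg_submodule G M A \<and> fg_submodule G M B \<and> A \<subseteq> B \<and>
     (\<exists>f. fg_hom G (M\<lparr>carrier := B\<rparr>) U f \<and> f ` B = carrier U \<and> (\<forall>x\<in>B. f x = \<zero>\<^bsub>U\<^esub> \<longleftrightarrow> x \<in> A))"

text \<open>\<open>chain_count G U M N k\<close>: some chain of submodules of \<open>M\<close>, not necessarily a maximal one, ends in \<open>N\<close>
  and has \<open>k\<close> marked steps, each with a factor isomorphic to \<open>U\<close>.  The largest such \<open>k\<close> is additive
  on short exact sequences.\<close>

inductive chain_count for G U M where
  base: "fg_submodule G M N \<Longrightarrow> chain_count G U M N 0"
| extend: "chain_count G U M N k \<Longrightarrow> N \<subseteq> N' \<Longrightarrow> fg_submodule G M N' \<Longrightarrow> chain_count G U M N' k"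
| step: "chain_count G U M N k \<Longrightarrow> fg_step G U M N N' \<Longrightarrow> chain_count G U M N' (Suc k)"

lemma chain_count_submodule: "chain_count G U M N k \<Longrightarrow> fg_submodule G M N"
  by (induction rule: chain_count.induct) (auto simp: fg_step_def)

lemma chain_count_restrict_iff:
  assumes "group_module G M" "fg_submodule G M B"
  shows "chain_count G U (M\<lparr>carrier := B\<rparr>) N k \<longleftrightarrow> chain_count G U M N k \<and> N \<subseteq> B"
proof -
  note sub = group_module.fg_submodule_restrict_iff[OF assms]
  have st: "fg_step G U (M\<lparr>carrier := B\<rparr>) N N' \<longleftrightarrow> fg_step G U M N N' \<and> N' \<subseteq> B" for N N'
    unfolding fg_step_def sub by auto
  have "chain_count G U M N k \<and> N \<subseteq> B" if "chain_count G U (M\<lparr>carrier := B\<rparr>) N k"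
    using that by (induction rule: chain_count.induct) (auto simp: sub st intro: chain_count.intros)
  moreover have "chain_count G U (M\<lparr>carrier := B\<rparr>) N k" if "chain_count G U M N k" "N \<subseteq> B"
    using that
  proof (induction rule: chain_count.induct)
    case (base N)
    then show ?case by (intro chain_count.base) (simp add: sub)
  next
    case (extend N k N')
    then have "N \<subseteq> B" by blast
    from chain_count.extend[OF extend.IH[OF this]] show ?case using extend by (simp add: sub)
  next
    case (step N k N')
    then have "N \<subseteq> B" by (auto simp: fg_step_def)
    from chain_count.step[OF step.IH[OF this]] show ?case using step by (simp add: st)
  qed
  ultimately show ?thesis by blast
qed

context fg_module_hom
begin

text \<open>For a marked step from \<open>W\<close> to \<open>W'\<close>, the part of
  \<open>W'\<close> in the kernel of \<open>h\<close> has image 0 or everything in the irreducible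
  \<open>U\<close>. If everything, the step survives in the kernel; if 0, it survives in the image.
  So no marked step is lost.\<close>

lemma chain_count_split:
  fixes U :: "('f, 'u, 'g) fg_module"
  assumes U: "fg_irreducible G U" and "chain_count G U M W k"
  shows "\<exists>i j. i + j = k \<and> chain_count G U M (W \<inter> {v \<in> carrier M. h v = \<zero>\<^bsub>N\<^esub>}) i \<and> chain_count G U N (h ` W) j"
    (is "\<exists>i j. _ \<and> chain_count G U M (W \<inter> ?A) i \<and> _")
  using assms(2)
proof (induction rule: chain_count.induct)
  case (base W)
  then show ?case
    using M.fg_submodule_Int[OF base fg_submodule_kernel] fg_submodule_image[OF base]
    by (intro exI[of _ 0]) (auto intro: chain_count.base)
next
  case (extend W k W')
  then obtain i j where ij: "i + j = k" "chain_count G U M (W \<inter> ?A) i" "chain_count G U N (h ` W) j" by blast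
  have "chain_count G U M (W' \<inter> ?A) i"
    using ij(2) by (rule chain_count.extend) (use extend M.fg_submodule_Int[OF extend(3) fg_submodule_kernel] in auto)
  moreover have "chain_count G U N (h ` W') j"
    using ij(3) by (rule chain_count.extend) (use extend fg_submodule_image[OF extend(3)] in auto)
  ultimately show ?case using ij(1) by blast
next
  case (step W k W')
  then obtain i j where ij: "i + j = k" "chain_count G U M (W \<inter> ?A) i" "chain_count G U N (h ` W) j" by blast
  obtain f where f: "fg_submodule G M W" "fg_submodule G M W'" "W \<subseteq> W'"
    "fg_hom G (M\<lparr>carrier := W'\<rparr>) U f" "f ` W' = carrier U" "\<forall>x\<in>W'. f x = \<zero>\<^bsub>U\<^esub> \<longleftrightarrow> x \<in> W"
    using step(2) unfolding fg_step_def by blast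
  have Ugm: "group_module G U" using U by (simp add: fg_irreducible_def)
  interpret R: group_module G "M\<lparr>carrier := W'\<rparr>" using M.group_module_restrict[OF f(2)] .
  interpret F: fg_module_hom G "M\<lparr>carrier := W'\<rparr>" U f
    using R.group_module_axioms Ugm f(4) by (simp add: fg_module_hom_def fg_module_hom_axioms_def)
  have WA: "fg_submodule G M (W \<inter> ?A)" "fg_submodule G M (W' \<inter> ?A)"
    using M.fg_submodule_Int[OF _ fg_submodule_kernel] f by blast+
  have W'c: "W' \<subseteq> carrier M" using f(2) by (simp add: M.fg_submodule_iff)
  have "fg_submodule G (M\<lparr>carrier := W'\<rparr>) (W' \<inter> ?A)"
    using M.fg_submodule_restrict_iff[OF f(2)] WA by blast
  then have "fg_submodule G U (f ` (W' \<inter> ?A))" by (rule F.fg_submodule_image)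
  then consider "f ` (W' \<inter> ?A) = carrier U" | "f ` (W' \<inter> ?A) = {\<zero>\<^bsub>U\<^esub>}"
    using U unfolding fg_irreducible_def by blast
  then show ?case
  proof cases
    case 1
    have "fg_hom G (M\<lparr>carrier := W' \<inter> ?A\<rparr>) U f" using f(4) unfolding fg_hom_def by auto
    then have "fg_step G U M (W \<inter> ?A) (W' \<inter> ?A)" unfolding fg_step_def using WA f 1 by auto
    then have "chain_count G U M (W' \<inter> ?A) (Suc i)" using ij(2) by (rule chain_count.step[rotated])
    moreover have "chain_count G U N (h ` W') j"
      using ij(3) by (rule chain_count.extend) (use f fg_submodule_image in auto)
    ultimately show ?thesis using ij(1) by (intro exI[of _ "Suc i"] exI[of _ j]) auto
  next
    case 2
    then have AW: "W' \<inter> ?A \<subseteq> W" using f(6) by blast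
    \<comment> \<open>Elements of \<open>W'\<close> with equal image differ by an element of the
      kernel, which in this case lies in \<open>W\<close>; hence \<open>f\<close> descends along
      \<open>h\<close>.\<close>
    have well: "f x = f y" if "x \<in> W'" "y \<in> W'" "h x = h y" for x y
    proof -
      let ?d = "x \<oplus>\<^bsub>M\<^esub> (- 1) \<odot>\<^bsub>M\<^esub> y"
      have d: "?d \<in> W'" using that f(2) by (auto simp: M.fg_submodule_iff)
      have xy: "x \<in> carrier M" "y \<in> carrier M" using that W'c by auto
      have "h ?d = h x \<oplus>\<^bsub>N\<^esub> (- 1) \<odot>\<^bsub>N\<^esub> h y" using xy by (simp add: hom_simps M.smult_closed_carrier)
      also have "\<dots> = \<zero>\<^bsub>N\<^esub>" using xy that(3) N.diff_eq_zero_iff hom_simps(1) by simp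
      finally have "?d \<in> W" using d AW W'c by blast
      then have "f ?d = \<zero>\<^bsub>U\<^esub>" using f(6) d by blast
      moreover have "f ?d = f x \<oplus>\<^bsub>U\<^esub> (- 1) \<odot>\<^bsub>U\<^esub> f y"
        using F.hom_simps(2,3)[simplified] that f(2) by (simp add: M.fg_submodule_iff)
      ultimately show ?thesis using F.N.diff_eq_zero_iff F.hom_simps(1) that by simp
    qed
    define f' where "f' y = f (SOME x. x \<in> W' \<and> h x = y)" for y
    have f': "f' (h x) = f x" if "x \<in> W'" for x
    proof -
      have "\<exists>x'. x' \<in> W' \<and> h x' = h x" using that by blast
      then have "(SOME x'. x' \<in> W' \<and> h x' = h x) \<in> W' \<and> h (SOME x'. x' \<in> W' \<and> h x' = h x) = h x"
        by (rule someI_ex)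
      then show ?thesis unfolding f'_def using well that by blast
    qed
    have cl: "v \<oplus>\<^bsub>M\<^esub> w \<in> W'" "a \<odot>\<^bsub>M\<^esub> v \<in> W'" "g \<in> carrier G \<Longrightarrow> act M g v \<in> W'"
      if "v \<in> W'" "w \<in> W'" for v w a g using that f(2) by (auto simp: M.fg_submodule_iff)
    have c: "v \<in> carrier M" if "v \<in> W'" for v using that W'c by blast
    have "fg_hom G (N\<lparr>carrier := h ` W'\<rparr>) U f'"
      unfolding fg_hom_def using F.hom_simps
      by (auto simp: f' cl c hom_simps(2-4)[symmetric])
    moreover have "f' ` h ` W' = carrier U" using f(5) f' by (force simp: image_image)
    moreover have "\<forall>y\<in>h ` W'. f' y = \<zero>\<^bsub>U\<^esub> \<longleftrightarrow> y \<in> h ` W"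
    proof (intro ballI iffI)
      fix y assume y: "y \<in> h ` W'" "f' y = \<zero>\<^bsub>U\<^esub>"
      then obtain x where "x \<in> W'" "y = h x" by blast
      then show "y \<in> h ` W" using y f' f(6) by auto
    next
      fix y assume "y \<in> h ` W"
      then obtain x where "x \<in> W" "y = h x" by blast
      then show "f' y = \<zero>\<^bsub>U\<^esub>" using f' f(3,6) by auto
    qed
    ultimately have "fg_step G U N (h ` W) (h ` W')"
      unfolding fg_step_def using f(1-3) fg_submodule_image by blast
    then have "chain_count G U N (h ` W') (Suc j)" using ij(3) by (rule chain_count.step[rotated])
    moreover have "W' \<inter> ?A = W \<inter> ?A" using AW f(3) by blast
    ultimately show ?thesis using ij by (intro exI[of _ i] exI[of _ "Suc j"]) auto
  qed
qed

text \<open>Converse to splitting: preimages of a chain in the image are stacked on top of a chain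
  ending in the kernel, and a marked step pulls back along \<open>h\<close>.\<close>

lemma chain_count_vimage:
  assumes "chain_count G U N V j" "V \<subseteq> h ` carrier M"
    and i: "chain_count G U M {v \<in> carrier M. h v = \<zero>\<^bsub>N\<^esub>} i"
  shows "chain_count G U M {v \<in> carrier M. h v \<in> V} (i + j)"
  using assms(1,2)
proof (induction rule: chain_count.induct)
  case (base V)
  have "\<zero>\<^bsub>N\<^esub> \<in> V" using base by (simp add: N.fg_submodule_iff)
  then have "chain_count G U M {v \<in> carrier M. h v \<in> V} i"
    using fg_submodule_vimage[OF base(1)] by (intro chain_count.extend[OF i]) auto
  then show ?case by simp
next
  case (extend V k V')
  then have "chain_count G U M {v \<in> carrier M. h v \<in> V} (i + k)" by blast
  then show ?case
    by (rule chain_count.extend) (use extend fg_submodule_vimage[OF extend(3)] in auto)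
next
  case (step V k V')
  then obtain f where f: "fg_submodule G N V" "fg_submodule G N V'" "V \<subseteq> V'"
    "fg_hom G (N\<lparr>carrier := V'\<rparr>) U f" "f ` V' = carrier U" "\<forall>x\<in>V'. f x = \<zero>\<^bsub>U\<^esub> \<longleftrightarrow> x \<in> V"
    unfolding fg_step_def by blast
  let ?B = "{v \<in> carrier M. h v \<in> V'}"
  have "fg_hom G (M\<lparr>carrier := ?B\<rparr>) U (f \<circ> h)"
    using f(4) unfolding fg_hom_def by (auto simp: hom_simps)
  moreover have "(f \<circ> h) ` ?B = carrier U"
  proof -
    have "h ` ?B = V'" using step.prems by auto
    then show ?thesis using f(5) by (metis image_comp)
  qed
  moreover have "\<forall>x\<in>?B. (f \<circ> h) x = \<zero>\<^bsub>U\<^esub> \<longleftrightarrow> x \<in> {v \<in> carrier M. h v \<in> V}" using f by auto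
  ultimately have "fg_step G U M {v \<in> carrier M. h v \<in> V} ?B"
    unfolding fg_step_def using f(3) fg_submodule_vimage[OF f(1)] fg_submodule_vimage[OF f(2)] by blast
  moreover have "chain_count G U M {v \<in> carrier M. h v \<in> V} (i + k)"
    using step f(3) by blast
  ultimately have "chain_count G U M ?B (Suc (i + k))" by (rule chain_count.step[rotated])
  then show ?case by simp
qed

end

definition chain_max where
  "chain_max G U M N = Max {k. chain_count G U M N k}"

lemma Max_sumset:
  fixes A B :: "nat set"
  assumes "0 \<in> A" "0 \<in> B" and C: "C = {i + j | i j. i \<in> A \<and> j \<in> B}"
  shows "finite C \<longleftrightarrow> finite A \<and> finite B" "finite C \<Longrightarrow> Max C = Max A + Max B"
proof -
  have CC: "C = (\<lambda>(i, j). i + j) ` (A \<times> B)" unfolding C by auto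
  have "A \<subseteq> C" "B \<subseteq> C" unfolding C using assms(1,2) by force+
  then show fin: "finite C \<longleftrightarrow> finite A \<and> finite B" unfolding CC by (auto intro: finite_subset)
  assume "finite C"
  then have f: "finite A" "finite B" using fin by auto
  show "Max C = Max A + Max B"
  proof (rule Max_eqI[OF \<open>finite C\<close>])
    show "Max A + Max B \<in> C" unfolding C using f assms(1,2) Max_in by blast
    show "y \<le> Max A + Max B" if "y \<in> C" for y
      using that unfolding C by (auto intro!: add_mono Max_ge f)
  qed
qed

text \<open>Splitting and stacking make the counts of \<open>M\<close> precisely the sums of counts
  of kernel and image. Finiteness is an equivalence because it travels both ways: up a composition
  series, and down to kernels and images.\<close>

lemma (in fg_module_hom) chain_max_additive:
  fixes U :: "('f, 'u, 'g) fg_module"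
  assumes U: "fg_irreducible G U"
  defines "A \<equiv> {v \<in> carrier M. h v = \<zero>\<^bsub>N\<^esub>}"
  shows "finite {k. chain_count G U M (carrier M) k} \<longleftrightarrow>
      finite {k. chain_count G U M A k} \<and> finite {k. chain_count G U N (h ` carrier M) k}"
    and "finite {k. chain_count G U M (carrier M) k} \<Longrightarrow>
      chain_max G U M (carrier M) = chain_max G U M A + chain_max G U N (h ` carrier M)"
proof -
  have z: "0 \<in> {k. chain_count G U M A k}" "0 \<in> {k. chain_count G U N (h ` carrier M) k}"
    unfolding A_def using fg_submodule_kernel fg_submodule_image[OF M.fg_submodule_carrier]
    by (auto intro: chain_count.base)
  have eq: "{k. chain_count G U M (carrier M) k}
    = {i + j | i j. i \<in> {k. chain_count G U M A k} \<and> j \<in> {k. chain_count G U N (h ` carrier M) k}}"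
  proof (intro equalityI subsetI)
    fix k assume "k \<in> {k. chain_count G U M (carrier M) k}"
    then obtain i j where "i + j = k" "chain_count G U M (carrier M \<inter> A) i" "chain_count G U N (h ` carrier M) j"
      unfolding A_def using chain_count_split[OF U] by blast
    moreover have "carrier M \<inter> A = A" by (auto simp: A_def)
    ultimately show "k \<in> {i + j | i j. i \<in> {k. chain_count G U M A k} \<and> j \<in> {k. chain_count G U N (h ` carrier M) k}}"
      by auto
  next
    fix k assume "k \<in> {i + j | i j. i \<in> {k. chain_count G U M A k} \<and> j \<in> {k. chain_count G U N (h ` carrier M) k}}"
    then obtain i j where ij: "k = i + j" "chain_count G U M A i" "chain_count G U N (h ` carrier M) j" by blast
    have "{v \<in> carrier M. h v \<in> h ` carrier M} = carrier M" by blast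
    then show "k \<in> {k. chain_count G U M (carrier M) k}"
      using chain_count_vimage[OF ij(3) subset_refl ij(2)[unfolded A_def]] ij(1) by simp
  qed
  from Max_sumset[OF z eq]
  show "finite {k. chain_count G U M (carrier M) k} \<longleftrightarrow>
      finite {k. chain_count G U M A k} \<and> finite {k. chain_count G U N (h ` carrier M) k}"
    and "finite {k. chain_count G U M (carrier M) k} \<Longrightarrow>
      chain_max G U M (carrier M) = chain_max G U M A + chain_max G U N (h ` carrier M)"
    unfolding chain_max_def by blast+
qed

section \<open>Quotients, composition series and multiplicities\<close>

context group_module
begin

lemma quotient_map:
  assumes A: "fg_submodule G M A"
  defines "h \<equiv> \<lambda>v. a_r_coset M A v"
  shows "fg_hom G M (fg_quotient M A) h" "h ` carrier M = carrier (fg_quotient M A)"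
    "group_module G (fg_quotient M A)" "\<And>v. v \<in> carrier M \<Longrightarrow> h v = \<zero>\<^bsub>fg_quotient M A\<^esub> \<longleftrightarrow> v \<in> A"
proof -
  note A' = A[unfolded fg_submodule_iff]
  have sub: "subgroup A (add_monoid M)"
    using A by (simp add: fg_submodule_def submodule_def)
  interpret A: abelian_subgroup A M
    by (rule abelian_subgroupI3) (use sub in \<open>auto intro: additive_subgroup.intro M.abelian_group_axioms\<close>)
  have mem: "x \<in> h v \<longleftrightarrow> (\<exists>n\<in>A. x = n \<oplus>\<^bsub>M\<^esub> v)" for x v
    by (auto simp: h_def a_r_coset_def')
  have heq: "h x = h v" if "x \<in> h v" "v \<in> carrier M" for x v
    using M.a_repr_independence[OF that(1)[unfolded h_def] that(2) sub] by (simp add: h_def)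
  have self: "v \<in> h v" if "v \<in> carrier M" for v unfolding h_def using A.a_rcos_self[OF that] .
  have car: "carrier (fg_quotient M A) = h ` carrier M"
    by (auto simp: fg_quotient_def h_def A_RCOSETS_def')
  then show surj: "h ` carrier M = carrier (fg_quotient M A)" by simp
  \<comment> \<open>The operations of the quotient are unions over all representatives; if they all
    yield the same coset, the union is that coset.\<close>
  have union: "(\<Union>x\<in>h v. h (F x)) = h (F v)"
    if v: "v \<in> carrier M" and F: "\<And>x. x \<in> carrier M \<Longrightarrow> F x \<in> carrier M"
      "\<And>n. n \<in> A \<Longrightarrow> \<exists>n'\<in>A. F (n \<oplus>\<^bsub>M\<^esub> v) = n' \<oplus>\<^bsub>M\<^esub> F v" for F v
  proof -
    have "h (F x) = h (F v)" if "x \<in> h v" for x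
    proof (rule heq[OF _ F(1)[OF v]])
      show "F x \<in> h (F v)" using that F(2) by (auto simp: mem)
    qed
    then show ?thesis using self[OF v] by blast
  qed
  show hom: "fg_hom G M (fg_quotient M A) h"
    unfolding fg_hom_def
  proof (intro conjI ballI allI)
    show "h ` carrier M \<subseteq> carrier (fg_quotient M A)" using car by simp
    show "h (v \<oplus>\<^bsub>M\<^esub> w) = h v \<oplus>\<^bsub>fg_quotient M A\<^esub> h w" if "v \<in> carrier M" "w \<in> carrier M" for v w
      using A.a_rcos_sum[OF that] by (simp add: fg_quotient_def h_def)
    show "h (a \<odot>\<^bsub>M\<^esub> v) = a \<odot>\<^bsub>fg_quotient M A\<^esub> h v" if v: "v \<in> carrier M" for a v
    proof -
      have "(\<Union>x\<in>h v. h (a \<odot>\<^bsub>M\<^esub> x)) = h (a \<odot>\<^bsub>M\<^esub> v)"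
      proof (rule union[OF v])
        show "\<exists>n'\<in>A. a \<odot>\<^bsub>M\<^esub> (n \<oplus>\<^bsub>M\<^esub> v) = n' \<oplus>\<^bsub>M\<^esub> a \<odot>\<^bsub>M\<^esub> v" if "n \<in> A" for n
          using that A' v smult_add_right[of n v a] by blast
      qed (rule smult_closed_carrier)
      then show ?thesis by (simp add: fg_quotient_def h_def)
    qed
    show "h (act M g v) = act (fg_quotient M A) g (h v)" if g: "g \<in> carrier G" and v: "v \<in> carrier M" for g v
    proof -
      have "(\<Union>x\<in>h v. h (act M g x)) = h (act M g v)"
      proof (rule union[OF v])
        show "\<exists>n'\<in>A. act M g (n \<oplus>\<^bsub>M\<^esub> v) = n' \<oplus>\<^bsub>M\<^esub> act M g v" if "n \<in> A" for n
          using that A' g v act_add[of g n v] by blast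
      qed (rule act_closed[OF g])
      then show ?thesis by (simp add: fg_quotient_def h_def)
    qed
  qed
  have zero: "\<zero>\<^bsub>fg_quotient M A\<^esub> = A" by (simp add: fg_quotient_def)
  show z: "h v = \<zero>\<^bsub>fg_quotient M A\<^esub> \<longleftrightarrow> v \<in> A" if "v \<in> carrier M" for v
    unfolding zero using self[OF that] M.a_coset_join2[OF that sub] by (auto simp: h_def)
  show "group_module G (fg_quotient M A)"
    using group_module_surj_image[OF group_module_axioms hom surj] z A' M.zero_closed by blast
qed

end

lemma composition_factor_props:
  assumes M: "group_module G M" and AB: "fg_submodule G M (W i)" "fg_submodule G M (W (Suc i))" "W i \<subseteq> W (Suc i)"
  obtains h where "fg_module_hom G (M\<lparr>carrier := W (Suc i)\<rparr>) (composition_factor M W i) h"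
    "h ` W (Suc i) = carrier (composition_factor M W i)"
    "{v \<in> W (Suc i). h v = \<zero>\<^bsub>composition_factor M W i\<^esub>} = W i"
proof -
  interpret M: group_module G M by fact
  interpret B: group_module G "M\<lparr>carrier := W (Suc i)\<rparr>" using M.group_module_restrict[OF AB(2)] .
  have A: "fg_submodule G (M\<lparr>carrier := W (Suc i)\<rparr>) (W i)"
    using M.fg_submodule_restrict_iff[OF AB(2)] AB by blast
  note Q = B.quotient_map[OF A]
  show ?thesis
  proof (rule that)
    show "fg_module_hom G (M\<lparr>carrier := W (Suc i)\<rparr>) (composition_factor M W i)
        (a_r_coset (M\<lparr>carrier := W (Suc i)\<rparr>) (W i))"
      unfolding composition_factor_def fg_module_hom_def fg_module_hom_axioms_def
      using Q(1,3) B.group_module_axioms by auto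
  qed (use Q(2,4) AB(3) in \<open>auto simp: composition_factor_def\<close>)
qed

text \<open>A marked step in an irreducible module must lead from zero to the whole module, and its
  surjection then has trivial kernel.\<close>

lemma chain_count_irreducible:
  assumes Q: "fg_irreducible G Q" and U: "fg_irreducible G U" and "chain_count G U Q V k"
  shows "k = 0 \<or> k = 1 \<and> V = carrier Q \<and> fg_isomorphic G Q U"
  using assms(3)
proof (induction rule: chain_count.induct)
  case (extend V k V')
  have "V' \<subseteq> carrier Q"
    using extend(3) Q group_module.fg_submodule_iff unfolding fg_irreducible_def by metis
  then show ?case using extend by auto
next
  case (step V k V')
  interpret Q: group_module G Q using Q by (simp add: fg_irreducible_def)
  interpret U: group_module G U using U by (simp add: fg_irreducible_def)
  obtain f where f: "fg_submodule G Q V" "fg_submodule G Q V'" "V \<subseteq> V'"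
    "fg_hom G (Q\<lparr>carrier := V'\<rparr>) U f" "f ` V' = carrier U" "\<forall>x\<in>V'. f x = \<zero>\<^bsub>U\<^esub> \<longleftrightarrow> x \<in> V"
    using step(2) unfolding fg_step_def by blast
  have "carrier U \<noteq> {\<zero>\<^bsub>U\<^esub>}" using U by (simp add: fg_irreducible_def)
  have "V \<noteq> V'"
  proof
    assume "V = V'"
    then have "f ` V' \<subseteq> {\<zero>\<^bsub>U\<^esub>}" using f(6) by auto
    then have "carrier U = {\<zero>\<^bsub>U\<^esub>}" unfolding f(5) using U.M.zero_closed by blast
    with \<open>carrier U \<noteq> {\<zero>\<^bsub>U\<^esub>}\<close> show False ..
  qed
  moreover have "V = {\<zero>\<^bsub>Q\<^esub>} \<or> V = carrier Q" "V' = {\<zero>\<^bsub>Q\<^esub>} \<or> V' = carrier Q"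
    using f(1,2) Q by (auto simp: fg_irreducible_def)
  moreover have "V' \<subseteq> carrier Q" "\<zero>\<^bsub>Q\<^esub> \<in> V" using f(1,2) by (auto simp: Q.fg_submodule_iff)
  ultimately have V: "V = {\<zero>\<^bsub>Q\<^esub>}" "V' = carrier Q" using f(3) by auto
  have ncar: "carrier Q \<noteq> {\<zero>\<^bsub>Q\<^esub>}" using Q by (simp add: fg_irreducible_def)
  then have "k = 0" using step.IH V by auto
  have hom: "fg_hom G Q U f" using f(4) V by (simp add: fg_hom_def)
  note D = fg_homD[OF hom]
  have "inj_on f (carrier Q)"
  proof (rule inj_onI)
    fix x y assume xy: "x \<in> carrier Q" "y \<in> carrier Q" "f x = f y"
    let ?d = "x \<oplus>\<^bsub>Q\<^esub> (- 1) \<odot>\<^bsub>Q\<^esub> y"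
    have d: "?d \<in> carrier Q" using xy Q.smult_closed_carrier by simp
    have "f ?d = f x \<oplus>\<^bsub>U\<^esub> (- 1) \<odot>\<^bsub>U\<^esub> f y" using xy by (simp add: D Q.smult_closed_carrier)
    also have "\<dots> = \<zero>\<^bsub>U\<^esub>" using xy U.diff_eq_zero_iff D(1) by simp
    finally have "?d = \<zero>\<^bsub>Q\<^esub>" using f(6) d V by blast
    then show "x = y" using Q.diff_eq_zero_iff xy by blast
  qed
  then have "fg_isomorphic G Q U"
    unfolding fg_isomorphic_def using f(5) V D by (intro exI[of _ f]) (auto simp: bij_betw_def)
  then show ?case using \<open>k = 0\<close> V by simp
qed simp

lemma chain_max_irreducible:
  assumes Q: "fg_irreducible G Q" and U: "fg_irreducible G U"
  shows "finite {k. chain_count G U Q (carrier Q) k}"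
    "chain_max G U Q (carrier Q) = (if fg_isomorphic G Q U then 1 else 0)"
proof -
  interpret Q: group_module G Q using Q by (simp add: fg_irreducible_def)
  interpret U: group_module G U using U by (simp add: fg_irreducible_def)
  have 0: "chain_count G U Q (carrier Q) 0" by (rule chain_count.base[OF Q.fg_submodule_carrier])
  have 1: "chain_count G U Q (carrier Q) 1" if iso: "fg_isomorphic G Q U"
  proof -
    have "fg_hom G Q U f" if "bij_betw f (carrier Q) (carrier U)"
      "(\<forall>v\<in>carrier Q. \<forall>w\<in>carrier Q. f (v \<oplus>\<^bsub>Q\<^esub> w) = f v \<oplus>\<^bsub>U\<^esub> f w) \<and>
       (\<forall>a. \<forall>v\<in>carrier Q. f (a \<odot>\<^bsub>Q\<^esub> v) = a \<odot>\<^bsub>U\<^esub> f v) \<and>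
       (\<forall>g\<in>carrier G. \<forall>v\<in>carrier Q. f (act Q g v) = act U g (f v))" for f
      unfolding fg_hom_def using that(2) bij_betw_imp_surj_on[OF that(1)] by (simp only: subset_refl simp_thms)
    then obtain f where f: "bij_betw f (carrier Q) (carrier U)" "fg_hom G Q U f"
      using iso unfolding fg_isomorphic_def by blast
    interpret F: fg_module_hom G Q U f
      using Q.group_module_axioms U.group_module_axioms f(2) by (simp add: fg_module_hom_def fg_module_hom_axioms_def)
    have "f x = \<zero>\<^bsub>U\<^esub> \<longleftrightarrow> x = \<zero>\<^bsub>Q\<^esub>" if "x \<in> carrier Q" for x
      using F.hom_zero inj_onD[OF bij_betw_imp_inj_on[OF f(1)], of x "\<zero>\<^bsub>Q\<^esub>"] that by auto
    then have "fg_step G U Q {\<zero>\<^bsub>Q\<^esub>} (carrier Q)"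
      unfolding fg_step_def using Q.fg_submodule_zero Q.fg_submodule_carrier f
      by (auto simp: bij_betw_def)
    from chain_count.step[OF chain_count.base[OF Q.fg_submodule_zero] this] show ?thesis by simp
  qed
  have "{k. chain_count G U Q (carrier Q) k} = (if fg_isomorphic G Q U then {0, 1} else {0})"
    using chain_count_irreducible[OF Q U] 0 1 by auto
  then show "finite {k. chain_count G U Q (carrier Q) k}"
    "chain_max G U Q (carrier Q) = (if fg_isomorphic G Q U then 1 else 0)"
    by (simp_all add: chain_max_def)
qed

lemma chain_count_zero:
  assumes M: "group_module G M" and U: "fg_irreducible G U"
    and "chain_count G U M N k" "N = {\<zero>\<^bsub>M\<^esub>}"
  shows "k = 0"
  using assms(3,4)
proof (induction rule: chain_count.induct)
  case (extend N k N')
  then have "N = {\<zero>\<^bsub>M\<^esub>}"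
    using chain_count_submodule[OF extend(1)] group_module.fg_submodule_iff[OF M] by auto
  then show ?case using extend by blast
next
  case (step N k N')
  interpret M: group_module G M by fact
  interpret U: group_module G U using U by (simp add: fg_irreducible_def)
  obtain f where f: "fg_submodule G M N" "N \<subseteq> N'" "f ` N' = carrier U" "\<forall>x\<in>N'. f x = \<zero>\<^bsub>U\<^esub> \<longleftrightarrow> x \<in> N"
    using step(2) unfolding fg_step_def by blast
  have "\<zero>\<^bsub>M\<^esub> \<in> N" using f(1) by (simp add: M.fg_submodule_iff)
  then have "carrier U = {\<zero>\<^bsub>U\<^esub>}" using f step.prems by auto
  then show ?case using U by (simp add: fg_irreducible_def)
qed simp

lemma chain_max_composition_series:
  assumes M: "group_module G M" and U: "fg_irreducible G U" and W: "composition_series G M W l"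
    and "i \<le> l"
  shows "finite {k. chain_count G U M (W i) k} \<and>
    chain_max G U M (W i) = card {j. j < i \<and> fg_isomorphic G (composition_factor M W j) U}"
  using \<open>i \<le> l\<close>
proof (induction i)
  case 0
  interpret M: group_module G M by fact
  have W0: "W 0 = {\<zero>\<^bsub>M\<^esub>}" using W by (simp add: composition_series_def)
  have "{k. chain_count G U M {\<zero>\<^bsub>M\<^esub>} k} = {0}"
    using chain_count_zero[OF M U _ refl] chain_count.base[OF M.fg_submodule_zero] by auto
  then show ?case unfolding W0 chain_max_def by simp
next
  case (Suc i)
  have sub: "fg_submodule G M (W i)" "fg_submodule G M (W (Suc i))" "W i \<subseteq> W (Suc i)"
    and irr: "fg_irreducible G (composition_factor M W i)"
    using W Suc.prems by (auto simp: composition_series_def)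
  let ?B = "M\<lparr>carrier := W (Suc i)\<rparr>" and ?Q = "composition_factor M W i"
  obtain h where h: "fg_module_hom G ?B ?Q h" "h ` W (Suc i) = carrier ?Q"
    "{v \<in> W (Suc i). h v = \<zero>\<^bsub>?Q\<^esub>} = W i"
    using composition_factor_props[of G M W i, OF M sub] .
  note add = fg_module_hom.chain_max_additive[OF h(1) U, simplified, unfolded h(2,3)]
  have res: "chain_count G U ?B N k \<longleftrightarrow> chain_count G U M N k" if "N \<subseteq> W (Suc i)" for N k
    using chain_count_restrict_iff[OF M sub(2)] that by blast
  have IH: "finite {k. chain_count G U M (W i) k}"
    "chain_max G U M (W i) = card {j. j < i \<and> fg_isomorphic G (composition_factor M W j) U}"
    using Suc by auto
  have fin: "finite {k. chain_count G U M (W (Suc i)) k}"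
    using add(1) IH(1) chain_max_irreducible(1)[OF irr U] by (simp add: res sub(3))
  have "chain_max G U M (W (Suc i)) = chain_max G U M (W i) + (if fg_isomorphic G ?Q U then 1 else 0)"
    using add(2) fin chain_max_irreducible(2)[OF irr U] by (simp add: res sub(3) chain_max_def)
  moreover have "{j. j < Suc i \<and> fg_isomorphic G (composition_factor M W j) U}
    = {j. j < i \<and> fg_isomorphic G (composition_factor M W j) U} \<union> (if fg_isomorphic G ?Q U then {i} else {})"
    by (auto simp: less_Suc_eq)
  ultimately show ?case using fin IH(2) by (simp add: card_insert_if)
qed

text \<open>Jordan-Hoelder as a by-product: \<open>chain_max\<close> refers to no composition
  series, so every series yields the same number and the definite description is met.\<close>

theorem multiplicity_in_eq_chain_max:
  assumes M: "group_module G M" and U: "fg_irreducible G U" and W: "composition_series G M W l"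
  shows "multiplicity_in G U M = chain_max G U M (carrier M)"
    "finite {k. chain_count G U M (carrier M) k}"
proof -
  have *: "finite {k. chain_count G U M (carrier M) k} \<and> chain_max G U M (carrier M)
      = card {i. i < l \<and> fg_isomorphic G (composition_factor M W i) U}"
    if W: "composition_series G M W l" for W l
    using chain_max_composition_series[OF M U W order_refl] W by (simp add: composition_series_def)
  show "multiplicity_in G U M = chain_max G U M (carrier M)"
    unfolding multiplicity_in_def
  proof (rule the_equality)
    show "\<exists>W l. composition_series G M W l \<and> chain_max G U M (carrier M) =
        card {i. i < l \<and> fg_isomorphic G (composition_factor M W i) U}"
      using W *[OF W] by blast
    show "d = chain_max G U M (carrier M)" if "\<exists>W l. composition_series G M W l \<and>
        d = card {i. i < l \<and> fg_isomorphic G (composition_factor M W i) U}" for d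
      using that * by auto
  qed
  show "finite {k. chain_count G U M (carrier M) k}" using *[OF W] by blast
qed

text \<open>\<open>\<delta>\<close> stands for a finite dimension; strict growth along submodules
  bounds it on the proper submodules of \<open>N\<close> by \<open>\<delta> N\<close>. A proper
  submodule with the largest \<open>\<delta>\<close> is maximal, so its factor is irreducible, and
  the induction continues below it.\<close>

lemma composition_series_exists:
  fixes \<delta> :: "'v set \<Rightarrow> nat" and M :: "('f::field, 'v, 'g) fg_module"
  assumes M: "group_module G M"
    and \<delta>: "\<And>A B. fg_submodule G M A \<Longrightarrow> fg_submodule G M B \<Longrightarrow> A \<subset> B \<Longrightarrow> \<delta> A < \<delta> B"
  obtains W l where "composition_series G M W l"
proof -
  interpret M: group_module G M by fact
  have "\<exists>W l. W 0 = {\<zero>\<^bsub>M\<^esub>} \<and> W l = N \<and> (\<forall>i\<le>l. fg_submodule G M (W i)) \<and>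
     (\<forall>i<l. W i \<subseteq> W (Suc i) \<and> fg_irreducible G (composition_factor M W i))"
    if "fg_submodule G M N" for N
    using that
  proof (induction "\<delta> N" arbitrary: N rule: less_induct)
    case less
    show ?case
    proof (cases "N = {\<zero>\<^bsub>M\<^esub>}")
      case True
      then show ?thesis using less.prems by (intro exI[of _ "\<lambda>_. N"] exI[of _ 0]) auto
    next
      case False
      have z: "\<zero>\<^bsub>M\<^esub> \<in> N" using less.prems by (simp add: M.fg_submodule_iff)
      let ?P = "\<lambda>A. fg_submodule G M A \<and> A \<subset> N"
      have "?P {\<zero>\<^bsub>M\<^esub>}" using M.fg_submodule_zero z False by auto
      moreover have "\<forall>A. ?P A \<longrightarrow> \<delta> A < \<delta> N" using \<delta> less.prems by blast
      ultimately obtain A where A: "?P A" "\<And>B. ?P B \<Longrightarrow> \<delta> B \<le> \<delta> A"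
        using ex_has_greatest_nat[of ?P "{\<zero>\<^bsub>M\<^esub>}" \<delta> "\<delta> N"] by blast
      have max: "B = A \<or> B = N" if "fg_submodule G M B" "A \<subseteq> B" "B \<subseteq> N" for B
        using A that \<delta>[of A B] by (metis leD psubsetI)
      obtain W l where W: "W 0 = {\<zero>\<^bsub>M\<^esub>}" "W l = A" "\<forall>i\<le>l. fg_submodule G M (W i)"
        "\<forall>i<l. W i \<subseteq> W (Suc i) \<and> fg_irreducible G (composition_factor M W i)"
        using less.hyps[of A] \<delta>[of A N] A(1) less.prems by blast
      define V where "V = W(Suc l := N)"
      have V: "V i = W i" if "i \<le> l" for i using that by (simp add: V_def)
      have VS: "V (Suc l) = N" "V l = A" using W by (simp_all add: V_def)
      obtain h where h: "fg_module_hom G (M\<lparr>carrier := N\<rparr>) (composition_factor M V l) h"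
        "h ` N = carrier (composition_factor M V l)"
        "{v \<in> N. h v = \<zero>\<^bsub>composition_factor M V l\<^esub>} = A"
        using composition_factor_props[of G M V l, OF M] A(1) less.prems unfolding VS by blast
      interpret h: fg_module_hom G "M\<lparr>carrier := N\<rparr>" "composition_factor M V l" h by fact
      have irr: "fg_irreducible G (composition_factor M V l)"
        unfolding fg_irreducible_def
      proof (intro conjI allI impI)
        show "group_module G (composition_factor M V l)" by (rule h.N.group_module_axioms)
        show "carrier (composition_factor M V l) \<noteq> {\<zero>\<^bsub>composition_factor M V l\<^esub>}"
          using h(2,3) A(1) by blast
        fix Y assume Y: "fg_submodule G (composition_factor M V l) Y"
        let ?B = "{v \<in> N. h v \<in> Y}"
        have "fg_submodule G (M\<lparr>carrier := N\<rparr>) ?B" using h.fg_submodule_vimage[OF Y] by simp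
        then have "fg_submodule G M ?B" using M.fg_submodule_restrict_iff[OF less.prems] by blast
        moreover have Y': "\<zero>\<^bsub>composition_factor M V l\<^esub> \<in> Y" "Y \<subseteq> carrier (composition_factor M V l)"
          using Y by (auto simp: h.N.fg_submodule_iff)
        moreover have "A \<subseteq> ?B" using h(3) Y'(1) by auto
        ultimately have "?B = A \<or> ?B = N" using max[of ?B] by blast
        then show "Y = {\<zero>\<^bsub>composition_factor M V l\<^esub>} \<or> Y = carrier (composition_factor M V l)"
        proof
          assume "?B = A"
          have "y = \<zero>\<^bsub>composition_factor M V l\<^esub>" if "y \<in> Y" for y
          proof -
            obtain v where v: "v \<in> N" "y = h v" using Y'(2) \<open>y \<in> Y\<close> h(2) by blast
            then have "v \<in> A" using \<open>?B = A\<close> \<open>y \<in> Y\<close> by blast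
            then show ?thesis using h(3) v by blast
          qed
          then show ?thesis using Y'(1) by blast
        next
          assume "?B = N"
          then have "h ` N \<subseteq> Y" by blast
          then show ?thesis using Y'(2) unfolding h(2) by (intro disjI2 equalityI)
        qed
      qed
      have cf: "composition_factor M V i = composition_factor M W i" if "i < l" for i
        using that by (simp add: composition_factor_def V)
      have "V 0 = {\<zero>\<^bsub>M\<^esub>}" using V W by simp
      moreover have "\<forall>i\<le>Suc l. fg_submodule G M (V i)"
        using V W(3) VS less.prems by (metis le_SucE)
      moreover have "V i \<subseteq> V (Suc i) \<and> fg_irreducible G (composition_factor M V i)" if "i < Suc l" for i
      proof (cases "i = l")
        case True
        then show ?thesis using irr VS A(1) by auto
      next
        case False
        then have "i < l" using that by simp
        then show ?thesis using W(4) cf V by simp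
      qed
      ultimately show ?thesis using VS by blast
    qed
  qed
  from this[OF M.fg_submodule_carrier] show ?thesis
    using that unfolding composition_series_def by blast
qed

section \<open>Permutation modules of a ranked family of sets\<close>

locale permutation_action = Group.group G for G :: "('g, 'b) monoid_scheme" (structure) +
  fixes S :: "'x set" and \<phi> :: "'g \<Rightarrow> 'x \<Rightarrow> 'x"
  assumes finite_S: "finite S"
    and action_closed: "g \<in> carrier G \<Longrightarrow> x \<in> S \<Longrightarrow> \<phi> g x \<in> S"
    and action_one: "x \<in> S \<Longrightarrow> \<phi> \<one> x = x"
    and action_mult: "g \<in> carrier G \<Longrightarrow> h \<in> carrier G \<Longrightarrow> x \<in> S \<Longrightarrow> \<phi> (g \<otimes> h) x = \<phi> g (\<phi> h x)"
begin

lemma action_inj: "g \<in> carrier G \<Longrightarrow> x \<in> S \<Longrightarrow> y \<in> S \<Longrightarrow> \<phi> g x = \<phi> g y \<longleftrightarrow> x = y"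
  by (metis action_mult action_one inv_closed l_inv)

lemma action_surj:
  assumes "g \<in> carrier G" "y \<in> S"
  obtains x where "x \<in> S" "y = \<phi> g x"
proof
  show "\<phi> (inv g) y \<in> S" using assms by (intro action_closed) auto
  show "y = \<phi> g (\<phi> (inv g) y)" using assms action_mult[of g "inv g" y] action_one by simp
qed

lemma act_perm_module:
  assumes "g \<in> carrier G" "x \<in> S"
  shows "act (perm_module S \<phi> :: ('f::field, _, _) fg_module) g v (\<phi> g x) = v x"
proof -
  have "{x' \<in> S. \<phi> g x' = \<phi> g x} = {x}" using assms action_inj by auto
  then show ?thesis by (simp add: perm_module_def)
qed

lemma act_perm_module_outside:
  "g \<in> carrier G \<Longrightarrow> y \<notin> S \<Longrightarrow> act (perm_module S \<phi> :: ('f::field, _, _) fg_module) g v y = 0"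
  by (auto simp: perm_module_def action_closed intro!: sum.neutral)

text \<open>The action is defined by sums over fibres. At a point of the form
  \<open>\<phi> g x\<close> such a fibre is a singleton, and every point of \<open>S\<close> has
  this form.\<close>

lemma fun_eq_via_action:
  assumes g: "g \<in> carrier G" and out: "\<And>y. y \<notin> S \<Longrightarrow> v y = w y"
    and eq: "\<And>x. x \<in> S \<Longrightarrow> v (\<phi> g x) = w (\<phi> g x)"
  shows "v = w"
proof
  fix y show "v y = w y" using out eq action_surj[OF g, of y] by (cases "y \<in> S") metis+
qed

lemma group_module_perm: "group_module G (perm_module S \<phi> :: ('f::field, _, _) fg_module)"
proof -
  let ?M = "perm_module S \<phi> :: ('f, _, _) fg_module"
  have car: "carrier ?M = {v. \<forall>x. x \<notin> S \<longrightarrow> v x = 0}"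
    and add: "v \<oplus>\<^bsub>?M\<^esub> w = (\<lambda>x. v x + w x)" and smul: "a \<odot>\<^bsub>?M\<^esub> v = (\<lambda>x. a * v x)"
    and zero: "\<zero>\<^bsub>?M\<^esub> = (\<lambda>x. 0)" for v w a
    by (simp_all add: perm_module_def)
  note A = act_perm_module[where 'f = 'f] act_perm_module_outside[where 'f = 'f]
  show ?thesis
  proof (rule group_moduleI)
    show "act ?M g (v \<oplus>\<^bsub>?M\<^esub> w) = act ?M g v \<oplus>\<^bsub>?M\<^esub> act ?M g w" if "g \<in> carrier G" for g v w
      by (rule fun_eq_via_action[OF that]) (simp_all add: add A that)
    show "act ?M g (a \<odot>\<^bsub>?M\<^esub> v) = a \<odot>\<^bsub>?M\<^esub> act ?M g v" if "g \<in> carrier G" for g a v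
      by (rule fun_eq_via_action[OF that]) (simp_all add: smul A that)
    show "act ?M \<one> v = v" if "v \<in> carrier ?M" for v
    proof (rule fun_eq_via_action[of \<one>])
      show "act ?M \<one> v (\<phi> \<one> x) = v (\<phi> \<one> x)" if "x \<in> S" for x
        using A(1)[of \<one> x v] that action_one by simp
    qed (use that A(2) car in auto)
    show "act ?M (g \<otimes> h) v = act ?M g (act ?M h v)"
      if gh: "g \<in> carrier G" "h \<in> carrier G" "v \<in> carrier ?M" for g h v
    proof (rule fun_eq_via_action[of "g \<otimes> h"])
      show "act ?M (g \<otimes> h) v (\<phi> (g \<otimes> h) x) = act ?M g (act ?M h v) (\<phi> (g \<otimes> h) x)" if "x \<in> S" for x
        using A(1)[of "g \<otimes> h" x v] A(1)[of g "\<phi> h x"] A(1)[of h x] gh that action_mult action_closed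
        by simp
    qed (use gh A(2) in auto)
    show "act ?M g v \<in> carrier ?M" if "g \<in> carrier G" for g v
      using A(2) that car by auto
  qed (auto simp: car add smul zero algebra_simps group_axioms)
qed

lemma composition_series_perm:
  obtains W l where "composition_series G (perm_module S \<phi> :: ('f::field, _, _) fg_module) W l"
proof -
  let ?M = "perm_module S \<phi> :: ('f, _, _) fg_module"
  interpret M: group_module G ?M by (rule group_module_perm)
  have car: "carrier ?M = {v. \<forall>x. x \<notin> S \<longrightarrow> v x = 0}" by (simp add: perm_module_def)
  define D where "D = (\<lambda>x y. if y = x then 1 else 0 :: 'f) ` S"
  have finD: "finite D" using finite_S by (simp add: D_def)
  have spanD: "v \<in> fun_space.span D" if "v \<in> carrier ?M" for v
  proof -
    have "v = (\<Sum>x\<in>S. fscale (v x) (\<lambda>y. if y = x then 1 else 0))"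
    proof
      fix y
      have "(\<Sum>x\<in>S. fscale (v x) (\<lambda>y. if y = x then 1 else 0)) y = (\<Sum>x\<in>S. if x = y then v x else 0)"
        by (auto simp: sum_fun_apply intro!: sum.cong)
      then show "v y = (\<Sum>x\<in>S. fscale (v x) (\<lambda>y. if y = x then 1 else 0)) y"
        using that finite_S by (simp add: sum.delta car)
    qed
    also have "\<dots> \<in> fun_space.span D"
      by (intro fun_space.span_sum fun_space.span_scale fun_space.span_base) (simp add: D_def)
    finally show ?thesis .
  qed
  have sub: "fun_space.subspace A" "A \<subseteq> carrier ?M" if "fg_submodule G ?M A" for A
  proof -
    from that have A: "A \<subseteq> carrier ?M" "(\<lambda>x. 0) \<in> A" "\<And>v w. v \<in> A \<Longrightarrow> w \<in> A \<Longrightarrow> (\<lambda>x. v x + w x) \<in> A"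
      "\<And>a v. v \<in> A \<Longrightarrow> (\<lambda>x. a * v x) \<in> A"
      unfolding M.fg_submodule_iff by (auto simp: perm_module_def)
    then show "fun_space.subspace A"
      by (intro fun_space.subspaceI) (simp_all add: zero_fun_def plus_fun_def fscale_def)
    show "A \<subseteq> carrier ?M" by fact
  qed
  \<comment> \<open>The ambient space of all functions may be infinite-dimensional, so finiteness of
    the two bases is first obtained from the finitely many indicator functions in
    \<open>D\<close>.\<close>
  have dim: "fun_space.dim A < fun_space.dim B"
    if A: "fg_submodule G ?M A" and B: "fg_submodule G ?M B" and AB: "A \<subset> B" for A B
  proof -
    obtain BA where BA: "BA \<subseteq> A" "fun_space.independent BA" "A \<subseteq> fun_space.span BA" "card BA = fun_space.dim A"
      using fun_space.basis_exists by blast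
    obtain BB where BB: "BB \<subseteq> B" "fun_space.independent BB" "B \<subseteq> fun_space.span BB" "card BB = fun_space.dim B"
      using fun_space.basis_exists by blast
    have "BA \<subseteq> fun_space.span D" "BB \<subseteq> fun_space.span D" using BA(1) BB(1) sub(2)[OF A] sub(2)[OF B] spanD by blast+
    then have fin: "finite BA" "finite BB" using fun_space.independent_span_bound[OF finD] BA(2) BB(2) by blast+
    obtain b where b: "b \<in> B" "b \<notin> A" using AB by blast
    have "fun_space.span BA \<subseteq> A" using BA(1) sub(1)[OF A] by (rule fun_space.span_minimal)
    then have nb: "b \<notin> fun_space.span BA" using b by blast
    then have "fun_space.independent (insert b BA)" using BA(2) by (intro fun_space.independent_insertI)
    moreover have "insert b BA \<subseteq> fun_space.span BB" using b BA(1) AB BB(3) by blast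
    ultimately have "card (insert b BA) \<le> card BB"
      using fun_space.independent_span_bound[OF fin(2)] by blast
    moreover have "b \<notin> BA" using nb fun_space.span_base by blast
    ultimately show ?thesis using fin(1) BA(4) BB(4) by simp
  qed
  show ?thesis
  proof (rule composition_series_exists[OF group_module_perm])
    show "fun_space.dim A < fun_space.dim B"
      if "fg_submodule G ?M A" "fg_submodule G ?M B" "A \<subset> B" for A B
      using that by (rule dim)
  qed (rule that)
qed

end

section \<open>From exactness to inequalities between multiplicities\<close>

lemma fg_hom_funpow:
  assumes "\<And>k. fg_hom G (M k) (M (k - 1)) D"
  shows "fg_hom G (M k) (M (k - int j)) (D ^^ j)"
proof (induction j)
  case 0
  then show ?case by (simp add: fg_hom_def)
next
  case (Suc j)
  note A = fg_homD[OF Suc] and B = fg_homD[OF assms[of "k - int j"]]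
  have eq: "k - int (Suc j) = k - int j - 1" by simp
  show ?case unfolding eq fg_hom_def by (auto simp: A B)
qed

lemma chain_max_mono:
  assumes "finite {k. chain_count G U M B k}" "fg_submodule G M A" "fg_submodule G M B" "A \<subseteq> B"
  shows "chain_max G U M A \<le> chain_max G U M B"
proof -
  have "{k. chain_count G U M A k} \<subseteq> {k. chain_count G U M B k}"
    using chain_count.extend[OF _ assms(4,3)] by blast
  moreover have "{k. chain_count G U M A k} \<noteq> {}" using chain_count.base[OF assms(2)] by blast
  ultimately show ?thesis unfolding chain_max_def using assms(1) by (rule Max_mono)
qed

lemma bracket_eq_sum:
  assumes "finite T" "{t. c (k + t * int d) \<noteq> 0} \<subseteq> T"
  shows "bracket c d k = (\<Sum>t\<in>T. c (k + t * int d))"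
  unfolding bracket_def using assms by (rule Sum_any.expand_superset)

lemma bracket_shift: "bracket c d (k - int d) = bracket c d k"
  unfolding bracket_def
proof (rule Sum_any.reindex_cong)
  show "(\<lambda>t. c (k - int d + t * int d)) \<circ> (\<lambda>t. t + 1) = (\<lambda>t. c (k + t * int d))"
    by (auto simp: algebra_simps)
  show "bij (\<lambda>t::int. t + 1)" by (rule o_bij[of "\<lambda>t. t - 1"]) auto
qed

text \<open>Write \<open>K k\<close> and \<open>I k\<close> for the multiplicities of \<open>U\<close> in the kernel and image of \<open>D\<close> on degree \<open>k\<close>, and let
  \<open>b = a + 1\<close>.  Where \<open>D ^ (d - 1)\<close> is exact at \<open>a\<close>, its kernel contributes \<open>I b\<close> to \<open>c a\<close>, while its image lies
  in the kernel of \<open>D\<close> in degree \<open>b - d\<close>.  Hence \<open>c b - c a \<ge> K b - K (b - d)\<close>, which telescopes.\<close>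

theorem descending_chain_of_modular_exact:
  fixes G :: "('g, 'b) monoid_scheme" (structure) and \<phi> :: "'g \<Rightarrow> 'x set \<Rightarrow> 'x set"
    and U :: "('f::field, 'u, 'g) fg_module"
  assumes U: "fg_irreducible G U" and L: "finite L"
    and closed: "\<And>g Y. g \<in> carrier G \<Longrightarrow> Y \<in> L \<Longrightarrow> \<phi> g Y \<in> L \<and> rk (\<phi> g Y) = rk Y"
    and mono: "\<And>g Y Z. g \<in> carrier G \<Longrightarrow> Y \<in> L \<Longrightarrow> Z \<in> L \<Longrightarrow> Y \<subseteq> Z \<Longrightarrow> \<phi> g Y \<subseteq> \<phi> g Z"
    and one: "\<And>Y. Y \<in> L \<Longrightarrow> \<phi> \<one> Y = Y"
    and mult: "\<And>g h Y. g \<in> carrier G \<Longrightarrow> h \<in> carrier G \<Longrightarrow> Y \<in> L \<Longrightarrow> \<phi> (g \<otimes> h) Y = \<phi> g (\<phi> h Y)"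
    and T: "\<And>Y. Y \<in> L \<Longrightarrow> Y \<subseteq> T" and d: "0 < d"
    and ex: "modular_exact (lower L rk :: _ \<Rightarrow> _ \<Rightarrow> 'f) d (fun_level L rk T) (int n)"
  shows "descending_chain (\<lambda>k. int (multiplicity_in G U (perm_module {Y \<in> L. rk Y = k} \<phi>))) n d"
proof -
  interpret group_module G U using U by (simp add: fg_irreducible_def)
  let ?D = "lower L rk :: _ \<Rightarrow> _ \<Rightarrow> 'f"
  define M :: "int \<Rightarrow> ('f, 'x set \<Rightarrow> 'f, 'g) fg_module"
    where "M k = perm_module {Y \<in> L. rk Y = k} \<phi>" for k
  have pa: "permutation_action G {Y \<in> L. rk Y = k} \<phi>" for k
    by unfold_locales (use L closed one mult in auto)
  have gm: "group_module G (M k)" for k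
    unfolding M_def by (rule permutation_action.group_module_perm[OF pa])
  define c where "c k = multiplicity_in G U (M k)" for k
  have c: "c k = chain_max G U (M k) (carrier (M k))" "finite {j. chain_count G U (M k) (carrier (M k)) j}" for k
  proof -
    obtain W l where "composition_series G (M k) W l"
      unfolding M_def by (rule permutation_action.composition_series_perm[OF pa])
    from multiplicity_in_eq_chain_max[OF gm U this]
    show "c k = chain_max G U (M k) (carrier (M k))" "finite {j. chain_count G U (M k) (carrier (M k)) j}"
      by (simp_all add: c_def)
  qed
  have car: "carrier (M k) = fun_level L rk T k" for k
    using T by (auto simp: M_def perm_module_def fun_level_def)
  have Dact: "?D (act (M k) g v) = act (M (k - 1)) g (?D v)" if g: "g \<in> carrier G" and v: "v \<in> carrier (M k)" for k g v
  proof -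
    interpret P: permutation_action G "{Y \<in> L. rk Y = k}" \<phi> by (rule pa)
    interpret P': permutation_action G "{Y \<in> L. rk Y = k - 1}" \<phi> by (rule pa)
    interpret PL: permutation_action G L \<phi> by unfold_locales (use L closed one mult in auto)
    have bij: "bij_betw (\<phi> g) L L"
      unfolding bij_betw_def
    proof
      show "inj_on (\<phi> g) L" using PL.action_inj[OF g] by (auto simp: inj_on_def)
      show "\<phi> g ` L = L" using PL.action_surj[OF g] closed[OF g] by blast
    qed
    have ord: "\<phi> g Y \<subseteq> \<phi> g Z \<longleftrightarrow> Y \<subseteq> Z" if "Y \<in> L" "Z \<in> L" for Y Z
    proof
      assume "\<phi> g Y \<subseteq> \<phi> g Z"
      then have "\<phi> (inv g) (\<phi> g Y) \<subseteq> \<phi> (inv g) (\<phi> g Z)"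
        using closed[OF g that(1)] closed[OF g that(2)] g by (intro mono[of "inv g"]) simp_all
      then show "Y \<subseteq> Z" using that g mult[of "inv g" g] one by simp
    qed (use mono g that in auto)
    have actL: "act (M j) g w (\<phi> g Y) = w Y" if "w \<in> carrier (M j)" "Y \<in> L" for j w Y
    proof -
      interpret Pj: permutation_action G "{Y \<in> L. rk Y = j}" \<phi> by (rule pa)
      show ?thesis
      proof (cases "rk Y = j")
        case True
        then show ?thesis using Pj.act_perm_module[OF g, of Y w] that unfolding M_def by simp
      next
        case False
        then have "\<phi> g Y \<notin> {Y \<in> L. rk Y = j}" using closed[OF g that(2)] by simp
        then show ?thesis using Pj.act_perm_module_outside[OF g] that False unfolding M_def
          by (simp add: perm_module_def)
      qed
    qed
    have Dv: "?D v \<in> carrier (M (k - 1))" using v unfolding car by (rule lower_mem_fun_level)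
    show ?thesis
    proof (rule PL.fun_eq_via_action[OF g])
      fix Y assume Y: "Y \<in> L"
      have "?D (act (M k) g v) (\<phi> g Y) = ?D (\<lambda>Z. act (M k) g v (\<phi> g Z)) Y"
        using lower_comp_automorphism[OF bij ord _ Y] closed[OF g] by metis
      also have "\<dots> = ?D v Y"
        unfolding lower_def using actL[OF v] by (auto intro!: sum.cong)
      also have "\<dots> = act (M (k - 1)) g (?D v) (\<phi> g Y)" using actL[OF Dv Y] by simp
      finally show "?D (act (M k) g v) (\<phi> g Y) = act (M (k - 1)) g (?D v) (\<phi> g Y)" .
    next
      fix y assume "y \<notin> L"
      then show "?D (act (M k) g v) y = act (M (k - 1)) g (?D v) y"
        using P'.act_perm_module_outside[OF g, of y] by (simp add: lower_def M_def)
    qed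
  qed
  have hom: "fg_hom G (M k) (M (k - 1)) ?D" for k
    unfolding fg_hom_def
  proof (intro conjI ballI allI)
    show "?D ` carrier (M k) \<subseteq> carrier (M (k - 1))" unfolding car using lower_mem_fun_level by blast
    show "?D (v \<oplus>\<^bsub>M k\<^esub> w) = ?D v \<oplus>\<^bsub>M (k - 1)\<^esub> ?D w" for v w
      using module_hom.add[OF module_hom_lower, of L rk v w] by (simp add: M_def perm_module_def plus_fun_def)
    show "?D (a \<odot>\<^bsub>M k\<^esub> v) = a \<odot>\<^bsub>M (k - 1)\<^esub> ?D v" for a v
      using module_hom.scale[OF module_hom_lower, of L rk a v] by (simp add: M_def perm_module_def fscale_def)
  qed (rule Dact)
  have homj: "fg_module_hom G (M k) (M (k - int j)) (?D ^^ j)" for k j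
    using gm fg_hom_funpow[of G M ?D k j, OF hom] by (simp add: fg_module_hom_def fg_module_hom_axioms_def)
  have zero: "\<zero>\<^bsub>M k\<^esub> = 0" for k by (simp add: M_def perm_module_def zero_fun_def)
  define ker where "ker j k = {v \<in> carrier (M k). (?D ^^ j) v = 0}" for j k
  define K where "K j k = chain_max G U (M k) (ker j k)" for j k
  define I where "I j k = chain_max G U (M (k - int j)) ((?D ^^ j) ` carrier (M k))" for j k
  have cKI: "c k = K j k + I j k" and fin: "finite {i. chain_count G U (M k) (ker j k) i}"
    and subs: "fg_submodule G (M k) (ker j k)" "fg_submodule G (M (k - int j)) ((?D ^^ j) ` carrier (M k))" for k j
  proof -
    interpret h: fg_module_hom G "M k" "M (k - int j)" "?D ^^ j" by (rule homj)
    show "c k = K j k + I j k" "finite {i. chain_count G U (M k) (ker j k) i}"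
      using h.chain_max_additive[OF U] c(1)[of k] c(2)[of k] unfolding K_def I_def ker_def zero by auto
    show "fg_submodule G (M k) (ker j k)" using h.fg_submodule_kernel unfolding ker_def zero .
    show "fg_submodule G (M (k - int j)) ((?D ^^ j) ` carrier (M k))"
      by (rule h.fg_submodule_image[OF h.M.fg_submodule_carrier])
  qed
  have nil: "(?D ^^ d) v = 0" if "v \<in> carrier (M k)" for v k
    using ex that unfolding car modular_exact_def by blast
  obtain e where e: "d = Suc e" using d by (cases d) auto
  have diff: "int (c (a + 1)) - int (c a) \<ge> int (K 1 (a + 1)) - int (K 1 (a + 1 - int d))"
    if cond: "2 * a - int e \<ge> int n \<or> 2 * a - int e \<le> int n - int d" for a
  proof -
    \<comment> \<open>Exactness at exponent \<open>e = d - 1\<close>, whose complementary power is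
      \<open>D\<close> itself.\<close>
    have "ker e a = (?D ^^ 1) ` carrier (M (a + 1))"
    proof (intro equalityI subsetI)
      fix v assume "v \<in> ker e a"
      then have v: "v \<in> fun_level L rk T a" "(?D ^^ e) v = 0" by (auto simp: ker_def car)
      obtain w where "w \<in> fun_level L rk T (a + int (d - e))" "(?D ^^ (d - e)) w = v"
        using modular_exactD[OF ex v(1) _ cond v(2)] e by auto
      then show "v \<in> (?D ^^ 1) ` carrier (M (a + 1))" using e by (auto simp: car)
    next
      fix v assume "v \<in> (?D ^^ 1) ` carrier (M (a + 1))"
      then obtain w where w: "w \<in> carrier (M (a + 1))" "v = ?D w" by auto
      have "v \<in> carrier (M a)" using fg_homD(1)[OF hom w(1)] w(2) by simp
      moreover have "(?D ^^ e) v = 0" using nil[OF w(1)] w(2) e by (simp add: funpow_swap1)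
      ultimately show "v \<in> ker e a" by (simp add: ker_def)
    qed
    then have KI: "K e a = I 1 (a + 1)" by (simp add: K_def I_def)
    have ae: "a - int e = a + 1 - int d" using e by simp
    have "(?D ^^ e) ` carrier (M a) \<subseteq> ker 1 (a - int e)"
    proof
      fix v assume "v \<in> (?D ^^ e) ` carrier (M a)"
      then obtain w where w: "w \<in> carrier (M a)" "v = (?D ^^ e) w" by auto
      have "v \<in> carrier (M (a - int e))" using fg_homD(1)[OF fg_module_hom.hom[OF homj] w(1)] w(2) by simp
      moreover have "?D v = 0" using nil[OF w(1)] w(2) e by simp
      ultimately show "v \<in> ker 1 (a - int e)" by (simp add: ker_def)
    qed
    then have "I e a \<le> K 1 (a - int e)"
      unfolding I_def K_def by (intro chain_max_mono fin subs)
    then show ?thesis using cKI[of a e] cKI[of "a + 1" 1] KI unfolding ae by linarith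
  qed
  \<comment> \<open>Finitely many ranks occur in \<open>L\<close>, so this gives the sums in the
    brackets finite support.\<close>
  have c0: "c k = 0" if "k \<notin> rk ` L" for k
  proof -
    have "{Y \<in> L. rk Y = k} = {}" using that by blast
    then have "carrier (M k) = {\<zero>\<^bsub>M k\<^esub>}" by (auto simp: M_def perm_module_def)
    then have "{j. chain_count G U (M k) (carrier (M k)) j} = {0}"
      using chain_count_zero[OF gm U] chain_count.base[OF group_module.fg_submodule_carrier[OF gm[of k]]] by blast
    then show ?thesis using c(1)[of k] by (simp add: chain_max_def)
  qed
  have finT: "finite {t. k + t * int d \<in> rk ` L}" for k
  proof (rule finite_vimage_IntI[of "rk ` L" "\<lambda>t. k + t * int d" UNIV, unfolded vimage_def, simplified])
    show "finite (rk ` L)" using L by simp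
    show "inj (\<lambda>t. k + t * int d)" using d by (auto simp: inj_on_def)
  qed
  have br: "bracket (\<lambda>k. int (c k)) d b \<ge> bracket (\<lambda>k. int (c k)) d (b - 1)"
    if r: "\<And>t. 2 * (b - 1 + t * int d) - int e \<ge> int n \<or> 2 * (b - 1 + t * int d) - int e \<le> int n - int d" for b
  proof -
    let ?f = "\<lambda>k. int (K 1 k)"
    \<comment> \<open>One finite index set large enough for all the brackets to be compared, so that
      the inequality can be summed termwise.\<close>
    define S where "S = {t. b + t * int d \<in> rk ` L} \<union> {t. b - 1 + t * int d \<in> rk ` L}
      \<union> {t. b - int d + t * int d \<in> rk ` L}"
    have S: "finite S" unfolding S_def using finT by simp
    have K0: "K 1 k = 0" if "k \<notin> rk ` L" for k using cKI[of k 1] c0[OF that] by simp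
    have s: "bracket (\<lambda>k. int (c k)) d b = (\<Sum>t\<in>S. int (c (b + t * int d)))"
      "bracket (\<lambda>k. int (c k)) d (b - 1) = (\<Sum>t\<in>S. int (c (b - 1 + t * int d)))"
      "bracket ?f d b = (\<Sum>t\<in>S. ?f (b + t * int d))"
      "bracket ?f d (b - int d) = (\<Sum>t\<in>S. ?f (b - int d + t * int d))"
      by (intro bracket_eq_sum[OF S]; use c0 K0 in \<open>force simp: S_def\<close>)+
    have "(\<Sum>t\<in>S. ?f (b + t * int d) - ?f (b - int d + t * int d))
        \<le> (\<Sum>t\<in>S. int (c (b + t * int d)) - int (c (b - 1 + t * int d)))"
    proof (rule sum_mono)
      fix t assume "t \<in> S"
      have eq: "b - 1 + t * int d + 1 = b + t * int d" by simp
      show "?f (b + t * int d) - ?f (b - int d + t * int d)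
          \<le> int (c (b + t * int d)) - int (c (b - 1 + t * int d))"
        using diff[OF r[of t]] unfolding eq diff_add_eq by simp
    qed
    \<comment> \<open>The kernel terms cancel in total, because a bracket does not change when its
      argument is shifted by \<open>d\<close>.\<close>
    then show ?thesis using bracket_shift[of ?f d b] unfolding sum_subtractf s by linarith
  qed
  show ?thesis
    unfolding descending_chain_def Let_def M_def[symmetric] c_def[symmetric]
  proof (intro conjI allI impI)
    fix j assume j: "j < d div 2"
    show "bracket (\<lambda>k. int (c k)) d (int (n div 2) - int j) \<ge> bracket (\<lambda>k. int (c k)) d (int (n div 2) - int j - 1)"
    proof (rule br)
      fix t :: int
      define m where "m = int (n div 2)"
      define x where "x = t * int d"
      \<comment> \<open>This is where the length \<open>d div 2\<close> of the chain enters: for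
        \<open>t = 1\<close> the sum of degrees must already reach \<open>n\<close>.\<close>
      have jd: "2 * int j + 2 \<le> int d" using j by linarith
      have n: "2 * m \<le> int n" "int n \<le> 2 * m + 1" unfolding m_def by linarith+
      have ie: "int d = int e + 1" using e by simp
      \<comment> \<open>Multiples of \<open>d\<close> skip everything strictly between 0 and
        \<open>d\<close>, so each place of the sequence lies below or above the exceptional
        interval.\<close>
      have "x \<le> 0 \<or> int d \<le> x"
      proof (cases "t \<le> 0")
        case True
        then show ?thesis by (simp add: x_def mult_nonpos_nonneg)
      next
        case False
        then have "1 * int d \<le> t * int d" by (intro mult_right_mono) auto
        then show ?thesis by (simp add: x_def)
      qed
      then have "2 * (m - int j - 1 + x) - int e \<ge> int n \<or> 2 * (m - int j - 1 + x) - int e \<le> int n - int d"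
      proof
        assume "x \<le> 0"
        then have "2 * (m - int j - 1 + x) - int e \<le> int n - int d" using n ie by simp
        then show ?thesis ..
      next
        assume "int d \<le> x"
        then have "int n \<le> 2 * (m - int j - 1 + x) - int e" using n ie jd by simp
        then show ?thesis ..
      qed
      then show "2 * (int (n div 2) - int j - 1 + t * int d) - int e \<ge> int n \<or>
          2 * (int (n div 2) - int j - 1 + t * int d) - int e \<le> int n - int d"
        unfolding m_def x_def .
    qed
  next
    show "0 \<le> bracket (\<lambda>k. int (c k)) d (int (n div 2) - int (d div 2))"
      unfolding bracket_def Sum_any.expand_set by (rule sum_nonneg) simp
  qed
qed

section \<open>Subsets and subspaces as permutation modules\<close>

lemma gauss_sum_of_nat: "gauss_sum (of_nat q :: 'f::comm_semiring_1) j = of_nat (\<Sum>i<j. q ^ i)"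
  by (simp add: gauss_sum_def)

lemma gauss_sum_eq_0_iff:
  "gauss_sum (of_nat q :: 'f::field) j = 0 \<longleftrightarrow> [(\<Sum>i<j. int q ^ i) = 0] (mod int CHAR('f))"
proof -
  have "(\<Sum>i<j. int q ^ i) = int (\<Sum>i<j. q ^ i)" by simp
  then show ?thesis
    unfolding gauss_sum_of_nat of_nat_eq_0_iff_char_dvd cong_0_iff by (metis int_dvd_int_iff)
qed

text \<open>The least element needs a witness, namely \<open>(p - 1) * p\<close> with
  \<open>p = CHAR('f)\<close>. By Fermat \<open>q ^ (p - 1)\<close> is 1 in the field, so over
  \<open>p\<close> periods the \<open>q\<close>-integer is \<open>p\<close> times that of
  \<open>p - 1\<close>. This also covers \<open>q\<close> congruent to 1 modulo
  \<open>p\<close>.\<close>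

lemma gauss_sum_char_in_GF:
  assumes p: "0 < CHAR('f::field)" "\<not> CHAR('f) dvd q"
  defines "d \<equiv> char_in_GF CHAR('f) (int q)"
  shows "0 < d" "gauss_sum (of_nat q :: 'f) d = 0" "\<And>j. 0 < j \<Longrightarrow> j < d \<Longrightarrow> gauss_sum (of_nat q :: 'f) j \<noteq> 0"
proof -
  have pr: "prime CHAR('f)" using p(1) by (rule prime_CHAR_semidom)
  let ?Q = "of_nat q :: 'f" and ?m = "CHAR('f) - 1"
  have "[q ^ ?m = 1] (mod CHAR('f))" using fermat_theorem[OF pr p(2)] .
  then have "of_nat (q ^ ?m) = (of_nat 1 :: 'f)" by (simp only: of_nat_eq_iff_cong_CHAR)
  then have Q: "?Q ^ ?m = 1" by simp
  have "gauss_sum ?Q (m * k) = of_nat k * gauss_sum ?Q m" if Q: "?Q ^ m = 1" for m k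
  proof (induction k)
    case (Suc k)
    show ?case unfolding mult_Suc_right gauss_sum_add Q using Suc by (simp add: algebra_simps)
  qed (simp add: gauss_sum_def)
  from this[OF Q, of "CHAR('f)"] have "gauss_sum ?Q (?m * CHAR('f)) = 0" by simp
  moreover have "0 < ?m * CHAR('f)" using prime_gt_1_nat[OF pr] by simp
  ultimately have ex: "0 < ?m * CHAR('f) \<and> [(\<Sum>i<?m * CHAR('f). int q ^ i) = 0] (mod int CHAR('f))"
    unfolding gauss_sum_eq_0_iff by blast
  from LeastI[of "\<lambda>d. 0 < d \<and> [(\<Sum>i<d. int q ^ i) = 0] (mod int CHAR('f))", OF ex]
  show "0 < d" "gauss_sum ?Q d = 0" unfolding d_def char_in_GF_def gauss_sum_eq_0_iff by auto
  show "gauss_sum ?Q j \<noteq> 0" if "0 < j" "j < d" for j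
    using not_less_Least[of j "\<lambda>d. 0 < d \<and> [(\<Sum>i<d. int q ^ i) = 0] (mod int CHAR('f))"] that
    unfolding d_def char_in_GF_def gauss_sum_eq_0_iff by auto
qed

section \<open>The action of the projective semilinear group on subspaces\<close>

lemma semilinear_image_subspace:
  assumes f: "semilinear f" and W: "vec.subspace W"
  shows "vec.subspace (f ` W)"
proof -
  from f obtain \<sigma> where \<sigma>: "bij \<sigma>" "\<sigma> 0 = 0" "\<And>x y. f (x + y) = f x + f y" "\<And>c x. f (c *s x) = \<sigma> c *s f x"
    unfolding semilinear_def field_automorphism_def by (metis add_cancel_right_right)
  show ?thesis unfolding vec.subspace_def
  proof (intro conjI ballI allI)
    have "f 0 = 0" using \<sigma>(4)[of 0 0] \<sigma>(2) by simp
    then show "0 \<in> f ` W" using vec.subspace_0[OF W] by (metis imageI)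
    show "x + y \<in> f ` W" if "x \<in> f ` W" "y \<in> f ` W" for x y
      using that \<sigma>(3) vec.subspace_add[OF W] by (metis (no_types, lifting) image_iff)
    show "c *s x \<in> f ` W" if x: "x \<in> f ` W" for c x
    proof -
      obtain b where "c = \<sigma> b" using \<sigma>(1) by (metis bij_pointE)
      then show ?thesis using x \<sigma>(4) vec.subspace_scale[OF W] by (metis (no_types, lifting) image_iff)
    qed
  qed
qed

lemma image_scalar_map: "vec.subspace W \<Longrightarrow> c \<noteq> 0 \<Longrightarrow> (\<lambda>x. c *s x) ` W = W"
proof (intro equalityI subsetI)
  fix x assume "vec.subspace W" "c \<noteq> 0" "x \<in> W"
  then have "inverse c *s x \<in> W" "x = c *s (inverse c *s x)"
    by (simp_all add: vec.subspace_scale vector_smult_assoc)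
  then show "x \<in> (\<lambda>x. c *s x) ` W" by blast
qed (auto intro: vec.subspace_scale)

lemma bij_scalar_map: "c \<noteq> 0 \<Longrightarrow> bij (\<lambda>x :: 'k::field ^ 'n. c *s x)"
  by (rule o_bij[of "\<lambda>x. inverse c *s x"]) (auto simp: vector_smult_assoc)

lemma Bij_UNIV: "f \<in> Bij UNIV \<longleftrightarrow> bij f"
  by (auto simp: Bij_def extensional_def)

lemma mult_GammaL:
  "bij f \<Longrightarrow> bij g \<Longrightarrow> f \<otimes>\<^bsub>GammaL\<^esub> g = (f \<circ> g :: 'k::field ^ 'n \<Rightarrow> 'k ^ 'n)"
  by (simp add: GammaL_def BijGroup_def Bij_UNIV compose_def o_def restrict_def)

lemma PGammaL_coset:
  assumes "C \<in> carrier (PGammaL :: ('k::field ^ 'n \<Rightarrow> 'k ^ 'n) set monoid)"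
  obtains f where "bij f" "semilinear f" "C = {(\<lambda>x. c *s f x) | c. c \<noteq> 0}"
proof -
  from assms obtain f where f: "f \<in> carrier GammaL" "C = scalar_maps #>\<^bsub>GammaL\<^esub> f"
    by (auto simp: PGammaL_def FactGroup_def RCOSETS_def)
  then have f': "bij f" "semilinear f" by (auto simp: GammaL_def)
  have "C = {(\<lambda>x. c *s f x) | c. c \<noteq> 0}"
    unfolding f(2) r_coset_def scalar_maps_def
    by (auto simp: mult_GammaL bij_scalar_map f'(1) o_def)
  then show ?thesis using that f' by blast
qed

lemma coset_image_PGammaL:
  assumes "C \<in> carrier (PGammaL :: ('k::field ^ 'n \<Rightarrow> 'k ^ 'n) set monoid)"
  obtains f where "bij f" "semilinear f" "\<And>W. vec.subspace W \<Longrightarrow> coset_image C W = f ` W"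
proof -
  obtain f where f: "bij f" "semilinear f" "C = {(\<lambda>x. c *s f x) | c. c \<noteq> 0}"
    using PGammaL_coset[OF assms] .
  have "coset_image C W = f ` W" if W: "vec.subspace W" for W
  proof -
    have one: "1 \<in> {c :: 'k. c \<noteq> 0}" by simp
    have "coset_image C W = (\<Union>c\<in>{c. c \<noteq> 0}. (\<lambda>x. c *s x) ` f ` W)"
      by (auto simp: coset_image_def f(3) image_image)
    also have "\<dots> = (\<Union>c\<in>{c :: 'k. c \<noteq> 0}. f ` W)"
      using image_scalar_map[OF semilinear_image_subspace[OF f(2) W]] by simp
    also have "\<dots> = f ` W" using one by blast
    finally show ?thesis .
  qed
  then show ?thesis using that f by blast
qed

text \<open>Cosets are multiplied elementwise, and the product of two members is their composition
  once both are known to be bijections.\<close>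

lemma coset_image_mult:
  assumes "C \<in> carrier PGammaL" "C' \<in> carrier PGammaL"
  shows "coset_image (C \<otimes>\<^bsub>PGammaL\<^esub> C') W = coset_image C (coset_image C' W)"
proof -
  have b: "bij g" if "g \<in> C \<or> g \<in> C'" for g
  proof -
    have "bij g" if "D \<in> carrier PGammaL" "g \<in> D" for D
    proof -
      obtain f c where "bij f" "g = (\<lambda>x. c *s f x)" "c \<noteq> 0"
        using PGammaL_coset[OF \<open>D \<in> carrier PGammaL\<close>] \<open>g \<in> D\<close> by blast
      then show ?thesis using bij_comp[OF _ bij_scalar_map, of f c] by (simp add: o_def)
    qed
    then show ?thesis using that assms by blast
  qed
  have "C \<otimes>\<^bsub>PGammaL\<^esub> C' = (\<Union>f\<in>C. \<Union>g\<in>C'. {f \<circ> g})"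
    using b by (auto simp: PGammaL_def FactGroup_def set_mult_def mult_GammaL)
  then show ?thesis by (auto simp: coset_image_def image_image)
qed

theorem theorem1p1:
  fixes p n q :: nat
    and \<Omega> :: "'a set" and G :: "('a \<Rightarrow> 'a) set"
    and U :: "('f::field, 'u, 'a \<Rightarrow> 'a) fg_module"
    and H :: "('k::{field, finite} ^ 'n \<Rightarrow> 'k ^ 'n) set set"
    and V :: "('f, 'v, ('k ^ 'n \<Rightarrow> 'k ^ 'n) set) fg_module"
  assumes "CHAR('f) = p" and "p > 0" and "n \<ge> 1"
  shows "(finite \<Omega> \<and> card \<Omega> = n \<and> subgroup G (BijGroup \<Omega>) \<and>
           fg_irreducible ((BijGroup \<Omega>)\<lparr>carrier := G\<rparr>) U
           \<longrightarrow> descending_chain (subset_multiplicity \<Omega> G U) n p)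
       \<and> (CARD('n) = n \<and> CARD('k) = q \<and> \<not> p dvd q \<and> subgroup H PGammaL \<and>
           fg_irreducible (PGammaL\<lparr>carrier := H\<rparr>) V
           \<longrightarrow> descending_chain (subspace_multiplicity H V) n (char_in_GF p (int q)))"
proof (intro conjI impI; elim conjE)
  assume \<Omega>: "finite \<Omega>" "card \<Omega> = n" and G: "subgroup G (BijGroup \<Omega>)"
    and U: "fg_irreducible ((BijGroup \<Omega>)\<lparr>carrier := G\<rparr>) U"
  let ?G = "(BijGroup \<Omega>)\<lparr>carrier := G\<rparr>"
  have GB: "g \<in> Bij \<Omega>" if "g \<in> G" for g
    using subgroup.subset[OF G] that by (auto simp: BijGroup_def)
  have bij: "bij_betw g \<Omega> \<Omega>" if "g \<in> G" for g using GB[OF that] by (simp add: Bij_def)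
  \<comment> \<open>With \<open>Q = 1\<close> the \<open>q\<close>-integer of \<open>j\<close> is
    \<open>j\<close> itself in the field, so its first positive zero is \<open>p\<close>; this is
    the value of \<open>\<pi>\<close> for subsets.\<close>
  have gauss: "gauss_sum (1::'f) j = 0 \<longleftrightarrow> p dvd j" for j
    by (simp add: gauss_sum_def of_nat_eq_0_iff_char_dvd assms(1))
  have "modular_exact (lower (Pow \<Omega>) (\<lambda>W. int (card W)) :: _ \<Rightarrow> _ \<Rightarrow> 'f) p
      (fun_level (Pow \<Omega>) (\<lambda>W. int (card W)) \<Omega>) (int n)"
    unfolding \<Omega>(2)[symmetric]
  proof (rule modular_exact_subsets[OF \<Omega>(1) subset_refl assms(2)])
    show "gauss_sum (1::'f) p = 0" by (simp add: gauss)
    show "gauss_sum (1::'f) j \<noteq> 0" if "0 < j" "j < p" for j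
      using that by (auto simp: gauss dest: dvd_imp_le)
  qed
  then have "descending_chain (\<lambda>k. int (multiplicity_in ?G U
      (perm_module {Y \<in> Pow \<Omega>. int (card Y) = k} (\<lambda>g A. g ` A)))) n p"
  proof (rule descending_chain_of_modular_exact[OF U, rotated -1])
    show "g ` Y \<in> Pow \<Omega> \<and> int (card (g ` Y)) = int (card Y)" if "g \<in> carrier ?G" "Y \<in> Pow \<Omega>" for g Y
      using that bij[of g] by (auto simp: bij_betw_def card_image inj_on_subset)
    show "\<one>\<^bsub>?G\<^esub> ` Y = Y" if "Y \<in> Pow \<Omega>" for Y using that by (auto simp: BijGroup_def image_iff)
    show "(g \<otimes>\<^bsub>?G\<^esub> h) ` Y = g ` h ` Y" if "g \<in> carrier ?G" "h \<in> carrier ?G" "Y \<in> Pow \<Omega>" for g h Y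
      using that GB by (auto simp: BijGroup_def compose_def image_image intro!: image_cong)
  qed (use \<Omega> assms(2) in auto)
  moreover have "{Y \<in> Pow \<Omega>. int (card Y) = k} = subsets_of_size \<Omega> k" for k
    using \<Omega>(1) finite_subset by (auto simp: subsets_of_size_def)
  ultimately show "descending_chain (subset_multiplicity \<Omega> G U) n p"
    by (simp add: subset_multiplicity_def[abs_def])
next
  assume n: "CARD('n) = n" and q: "CARD('k) = q" "\<not> p dvd q" and H: "subgroup H PGammaL"
    and V: "fg_irreducible (PGammaL\<lparr>carrier := H\<rparr>) V"
  let ?G = "PGammaL\<lparr>carrier := H\<rparr>"
  have HP: "C \<in> carrier PGammaL" if "C \<in> H" for C using subgroup.subset[OF H] that by blast
  let ?d = "char_in_GF p (int q)"
  note gauss = gauss_sum_char_in_GF[where 'f = 'f, of q, unfolded assms(1), OF assms(2) q(2)]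
  have q0: "of_nat CARD('k) \<noteq> (0 :: 'f)" using q by (simp add: of_nat_eq_0_iff_char_dvd assms(1))
  have "modular_exact (lower_sub :: (('k ^ 'n) set \<Rightarrow> 'f) \<Rightarrow> _) ?d (sub_level UNIV) (int n)"
    unfolding n[symmetric] vec_dim_card[where 'a = 'k and 'n = 'n, symmetric]
  proof (rule modular_exact_subspaces[OF q0 vec.subspace_UNIV gauss(1)])
    show "gauss_sum (of_nat CARD('k) :: 'f) ?d = 0" unfolding q(1) by (rule gauss(2))
    show "gauss_sum (of_nat CARD('k) :: 'f) j \<noteq> 0" if "0 < j" "j < ?d" for j
      unfolding q(1) using that by (rule gauss(3))
  qed
  then have "descending_chain (\<lambda>k. int (multiplicity_in ?G V
      (perm_module {Y \<in> {W. vec.subspace W}. int (vec.dim Y) = k} coset_image))) n ?d"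
  proof (rule descending_chain_of_modular_exact[OF V, rotated -1])
    show "coset_image C Y \<in> {W. vec.subspace W} \<and> int (vec.dim (coset_image C Y)) = int (vec.dim Y)"
      if "C \<in> carrier ?G" "Y \<in> {W. vec.subspace W}" for C Y
    proof -
      have C: "C \<in> carrier PGammaL" using HP that(1) by simp
      obtain f where f: "bij f" "semilinear f" "\<And>W. vec.subspace W \<Longrightarrow> coset_image C W = f ` W"
        using coset_image_PGammaL[OF C] by blast
      then show ?thesis using that(2) semilinear_image_subspace[OF f(2)]
        by (auto intro!: dim_inj_image inj_on_subset[OF bij_is_inj])
    qed
    show "coset_image C Y \<subseteq> coset_image C Z" if "Y \<subseteq> Z" for C :: "('k ^ 'n \<Rightarrow> 'k ^ 'n) set" and Y Z
      using that by (auto simp: coset_image_def)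
    show "coset_image \<one>\<^bsub>?G\<^esub> Y = Y" if "Y \<in> {W. vec.subspace W}" for Y
    proof -
      have one: "1 \<in> {c :: 'k. c \<noteq> 0}" by simp
      have "coset_image \<one>\<^bsub>?G\<^esub> Y = (\<Union>c\<in>{c :: 'k. c \<noteq> 0}. (\<lambda>x. c *s x) ` Y)"
        by (auto simp: coset_image_def PGammaL_def FactGroup_def scalar_maps_def)
      also have "\<dots> = (\<Union>c\<in>{c :: 'k. c \<noteq> 0}. Y)"
        using that by (intro SUP_cong) (simp_all add: image_scalar_map)
      also have "\<dots> = Y" using one by blast
      finally show ?thesis .
    qed
    show "coset_image (C \<otimes>\<^bsub>?G\<^esub> C') Y = coset_image C (coset_image C' Y)"
      if "C \<in> carrier ?G" "C' \<in> carrier ?G" for C C' Y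
      using coset_image_mult[of C C' Y] HP that by simp
  qed (use gauss(1) in auto)
  moreover have "{Y \<in> {W. vec.subspace W}. int (vec.dim Y) = k} = (subspaces_of_dim k :: ('k ^ 'n) set set)" for k
    by (auto simp: subspaces_of_dim_def)
  ultimately show "descending_chain (subspace_multiplicity H V) n ?d"
    by (simp add: subspace_multiplicity_def[abs_def])
qed

end
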